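(* Let $a<b$ be two real numbers. If $(X,\mathbb{R})$ is a flow which is an extension of the solenoid flow $(S,\mathbb{R})$ and $\mathrm{mdim}(X,\mathbb{R})<b-a$, then $(X,\mathbb{R})$ can be embedded in the flow $(B_1(V[a,b]),\mathbb{R})$.
   Context: A flow $(X,\mathbb{R})$ is a compact metric space $X$ with a continuous map $\mathbb{R}\times X\to X$, $(r,x)\mapsto rx$, such that $0x=x$ and $r_1(r_2x)=(r_1+r_2)x$. A flow $(Y,\mathbb{R})$ can be embedded in a flow $(X,\mathbb{R})$ if there is an $\mathbb{R}$-equivariant homeomorphism of $Y$ onto a subspace of $X$. A flow $(X,\mathbb{R})$ is an extension of a flow $(Y,\mathbb{R})$ if there is a continuous surjective map $\psi:X\to Y$ with $\psi(rx)=r\psi(x)$ for all $r\in\mathbb{R}$, $x\in X$. Mean dimension: for a compact metric space $(X,d)$ and $\epsilon>0$, a continuous map $f:X\to K$ is a $(d,\epsilon)$-embedding if $f(x_1)=f(x_2)$ implies $d(x_1,x_2)<\epsilon$. $\mathrm{Widim}_\epsilon(X,d)$ is the minimum of the Lebesgue covering dimension $\dim(K)$ over compact metrizable spaces $K$ admitting a $(d,\epsilon)$-embedding $X\to K$. For a flow and $N>0$ put $d_N(x,y)=\sup_{r\in[0,N]}d(rx,ry)$ and $\mathrm{mdim}(X,\mathbb{R})=\lim_{\epsilon\to0}\lim_{N\to\infty}\mathrm{Widim}_\epsilon(X,d_N)/N\in[0,+\infty]$ (the limits exist, and the value does not depend on the compatible metric $d$). Solenoid: for $n\in\mathbb{N}=\{1,2,\dots\}$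 let $S_n=\mathbb{R}/n!\mathbb{Z}$ be the circle of circumference $n!$. Let $S=\{(x_n)_n\in\prod_{n\in\mathbb{N}}S_n : x_n=x_{n+1}\ (\mathrm{mod}\ n!)\text{ for all }n\}$, with $\mathbb{R}$ acting by $r\cdot(x_n)_n=(x_n+r\ (\mathrm{mod}\ n!))_n$. This is a flow. Function space: for real $a<b$, $V[a,b]$ is the space of bounded continuous functions $f:\mathbb{R}\to\mathbb{C}$ whose Fourier transform $\mathcal{F}(f)$ (in the sense of tempered distributions, extending $\mathcal{F}(f)(\xi)=\int_{-\infty}^\infty e^{-2\pi it\xi}f(t)\,dt$) has support in $[a,b]$. $B_1(V[a,b])=\{f\in V[a,b]:\|f\|_\infty\le1\}$ is a compact metric space under $\boldsymbol{d}(f_1,f_2)=\sum_{n\ge1}2^{-n}\|f_1-f_2\|_{L^\infty([-n,n])}$, and $\mathbb{R}$ acts on it by the shift $(\tau_rf)(t)=f(t+r)$, making it a flow. *)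

theory Defs
  imports "HOL-Analysis.Analysis"
begin

section \<open>Flows\<close>

definition flow :: "'a topology \<Rightarrow> (real \<Rightarrow> 'a \<Rightarrow> 'a) \<Rightarrow> bool" where
  "flow X T \<longleftrightarrow>
     compact_space X \<and> metrizable_space X \<and>
     continuous_map (prod_topology euclideanreal X) X (\<lambda>(r, x). T r x) \<and>
     (\<forall>x\<in>topspace X. T 0 x = x) \<and>
     (\<forall>r s. \<forall>x\<in>topspace X. T r (T s x) = T (r + s) x)"

definition equivariant_on :: "'a set \<Rightarrow> (real \<Rightarrow> 'a \<Rightarrow> 'a) \<Rightarrow> (real \<Rightarrow> 'b \<Rightarrow> 'b) \<Rightarrow> ('a \<Rightarrow> 'b) \<Rightarrow> bool" where
  "equivariant_on A T U f \<longleftrightarrow> (\<forall>r. \<forall>x\<in>A. f (T r x) = U r (f x))"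

text \<open>\<open>(X, T)\<close> is an extension of \<open>(Y, U)\<close>.\<close>

definition flow_extension ::
    "'a topology \<Rightarrow> (real \<Rightarrow> 'a \<Rightarrow> 'a) \<Rightarrow> 'b topology \<Rightarrow> (real \<Rightarrow> 'b \<Rightarrow> 'b) \<Rightarrow> bool" where
  "flow_extension X T Y U \<longleftrightarrow>
     (\<exists>\<psi>. continuous_map X Y \<psi> \<and> \<psi> ` topspace X = topspace Y \<and>
          equivariant_on (topspace X) T U \<psi>)"

text \<open>\<open>(Y, U)\<close> can be embedded in \<open>(X, T)\<close>.\<close>

definition flow_embeddable ::
    "'b topology \<Rightarrow> (real \<Rightarrow> 'b \<Rightarrow> 'b) \<Rightarrow> 'a topology \<Rightarrow> (real \<Rightarrow> 'a \<Rightarrow> 'a) \<Rightarrow> bool" where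
  "flow_embeddable Y U X T \<longleftrightarrow>
     (\<exists>f. embedding_map Y X f \<and> equivariant_on (topspace Y) U T f)"


section \<open>Mean dimension\<close>

definition covering_dim_le :: "'a topology \<Rightarrow> int \<Rightarrow> bool" where
  "covering_dim_le K n \<longleftrightarrow>
     (\<forall>\<U>. (\<forall>U\<in>\<U>. openin K U) \<and> \<Union>\<U> = topspace K \<longrightarrow>
        (\<exists>\<V>. (\<forall>V\<in>\<V>. openin K V \<and> (\<exists>U\<in>\<U>. V \<subseteq> U)) \<and> \<Union>\<V> = topspace K \<and>
             (\<forall>x\<in>topspace K. finite {V\<in>\<V>. x \<in> V} \<and> int (card {V\<in>\<V>. x \<in> V}) \<le> n + 1)))"

text \<open>Lebesgue covering dimension, with the convention that the empty space has dimension \<open>-1\<close>.\<close>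

definition covering_dim :: "'a topology \<Rightarrow> ereal" where
  "covering_dim K = (INF n\<in>{n. -1 \<le> n \<and> covering_dim_le K n}. ereal (real_of_int n))"

definition eps_embedding :: "'a metric \<Rightarrow> real \<Rightarrow> 'b topology \<Rightarrow> ('a \<Rightarrow> 'b) \<Rightarrow> bool" where
  "eps_embedding m \<epsilon> K f \<longleftrightarrow>
     continuous_map (mtopology_of m) K f \<and>
     (\<forall>x\<in>mspace m. \<forall>y\<in>mspace m. f x = f y \<longrightarrow> mdist m x y < \<epsilon>)"

text \<open>
  A definition cannot quantify over all types. Letting the target range over all topologies
  whose carrier is a set of real sequences is no restriction, because every compact metrizable
  space embeds in the space of all real sequences (lemma \<open>compact_metrizable_representative\<close>).
\<close>

definition widim :: "real \<Rightarrow> 'a metric \<Rightarrow> ereal" where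
  "widim \<epsilon> m =
     (INF K\<in>{K :: (nat \<Rightarrow> real) topology.
               compact_space K \<and> metrizable_space K \<and> (\<exists>f. eps_embedding m \<epsilon> K f)}.
        covering_dim K)"

text \<open>
  The metric \<open>d\<^sub>N\<close>. The case distinction is needed since a member of the type of metrics must be
  symmetric and nonnegative outside its carrier as well.
\<close>

definition orbit_metric :: "'a metric \<Rightarrow> (real \<Rightarrow> 'a \<Rightarrow> 'a) \<Rightarrow> real \<Rightarrow> 'a metric" where
  "orbit_metric m T N =
     metric (mspace m, \<lambda>x y. if x \<in> mspace m \<and> y \<in> mspace m
                             then SUP r\<in>{0..N}. mdist m (T r x) (T r y) else 0)"

definition mdim :: "'a metric \<Rightarrow> (real \<Rightarrow> 'a \<Rightarrow> 'a) \<Rightarrow> ereal" where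
  "mdim m T =
     Lim (at_right 0) (\<lambda>\<epsilon>. Lim at_top (\<lambda>N. widim \<epsilon> (orbit_metric m T N) / ereal N))"


section \<open>The solenoid\<close>

definition coset :: "nat \<Rightarrow> real \<Rightarrow> real set" where
  "coset n x = range (\<lambda>k::int. x + of_int k * fact n)"

text \<open>The circle \<open>\<real> / n!\<int>\<close>: cosets of \<open>n!\<int>\<close>, with the quotient topology.\<close>

definition circle :: "nat \<Rightarrow> real set topology" where
  "circle n = topology (\<lambda>W. W \<subseteq> range (coset n) \<and> open (coset n -` W))"

text \<open>Reduction of a coset of \<open>m!\<int>\<close>, where \<open>m \<ge> n\<close>, modulo \<open>n!\<int>\<close>.\<close>

definition reduce :: "nat \<Rightarrow> real set \<Rightarrow> real set" where
  "reduce n A = (\<Union>a\<in>A. coset n a)"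

definition solenoid :: "(nat \<Rightarrow> real set) topology" where
  "solenoid =
     subtopology (product_topology circle {1..}) {x. \<forall>n\<ge>1. x n = reduce n (x (Suc n))}"

definition solenoid_action :: "real \<Rightarrow> (nat \<Rightarrow> real set) \<Rightarrow> (nat \<Rightarrow> real set)" where
  "solenoid_action r x = (\<lambda>n\<in>{1..}. (\<lambda>a. a + r) ` x n)"


section \<open>Band-limited functions\<close>

text \<open>Here \<open>D n\<close> is the \<open>n\<close>-th derivative of \<open>\<phi>\<close>.\<close>

definition schwartz :: "(real \<Rightarrow> complex) \<Rightarrow> bool" where
  "schwartz \<phi> \<longleftrightarrow>
     (\<exists>D :: nat \<Rightarrow> real \<Rightarrow> complex. D 0 = \<phi> \<and>
        (\<forall>n x. (D n has_vector_derivative D (Suc n) x) (at x)) \<and>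
        (\<forall>n k. bounded (range (\<lambda>x. of_real (x ^ k) * D n x))))"

definition fourier :: "(real \<Rightarrow> complex) \<Rightarrow> real \<Rightarrow> complex" where
  "fourier \<phi> \<xi> = (LINT t|lborel. exp (- 2 * of_real pi * \<i> * of_real t * of_real \<xi>) * \<phi> t)"

text \<open>
  Tempered distributions are represented by their values on Schwartz functions. A bounded
  continuous function \<open>f\<close> acts by integration, and the Fourier transform of a distribution is
  defined by duality.
\<close>

definition regular_distribution :: "(real \<Rightarrow> complex) \<Rightarrow> (real \<Rightarrow> complex) \<Rightarrow> complex" where
  "regular_distribution f \<phi> = (LINT t|lborel. f t * \<phi> t)"

definition fourier_distribution :: "((real \<Rightarrow> complex) \<Rightarrow> complex) \<Rightarrow> (real \<Rightarrow> complex) \<Rightarrow> complex" where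
  "fourier_distribution u \<phi> = u (fourier \<phi>)"

definition vanishes_on :: "((real \<Rightarrow> complex) \<Rightarrow> complex) \<Rightarrow> real set \<Rightarrow> bool" where
  "vanishes_on u U \<longleftrightarrow>
     (\<forall>\<phi>. schwartz \<phi> \<and> compact (closure {x. \<phi> x \<noteq> 0}) \<and> closure {x. \<phi> x \<noteq> 0} \<subseteq> U \<longrightarrow> u \<phi> = 0)"

definition distribution_support :: "((real \<Rightarrow> complex) \<Rightarrow> complex) \<Rightarrow> real set" where
  "distribution_support u = - \<Union>{U. open U \<and> vanishes_on u U}"

definition bandlimited :: "real \<Rightarrow> real \<Rightarrow> (real \<Rightarrow>\<^sub>C complex) set" where
  "bandlimited a b =
     {f. distribution_support
           (fourier_distribution (regular_distribution (apply_bcontfun f))) \<subseteq> {a..b}}"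

text \<open>
  For continuous functions the \<open>L\<^sup>\<infinity>\<close>-norm on \<open>[-n,n]\<close> is the supremum; the summation index is
  shifted by one.
\<close>

definition local_uniform_dist :: "(real \<Rightarrow>\<^sub>C complex) \<Rightarrow> (real \<Rightarrow>\<^sub>C complex) \<Rightarrow> real" where
  "local_uniform_dist f g =
     (\<Sum>n. (1/2) ^ Suc n * (SUP t\<in>{- real (Suc n)..real (Suc n)}. cmod (f t - g t)))"

text \<open>The space \<open>B\<^sub>1(V[a,b])\<close>; \<open>norm\<close> is the supremum norm.\<close>

definition bandlimited_ball :: "real \<Rightarrow> real \<Rightarrow> (real \<Rightarrow>\<^sub>C complex) metric" where
  "bandlimited_ball a b = metric ({f \<in> bandlimited a b. norm f \<le> 1}, local_uniform_dist)"

definition shift :: "real \<Rightarrow> (real \<Rightarrow>\<^sub>C complex) \<Rightarrow> (real \<Rightarrow>\<^sub>C complex)" where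
  "shift r f = Bcontfun (\<lambda>t. f (t + r))"


section \<open>Well-definedness\<close>

lemma compact_metrizable_representative:
  assumes "compact_space X" and "metrizable_space X"
  shows "\<exists>K :: (nat \<Rightarrow> real) topology.
           compact_space K \<and> metrizable_space K \<and> X homeomorphic_space K"
proof -
  obtain M d where M: "Metric_space M d" and X: "X = Metric_space.mtopology M d"
    using assms(2) by (auto simp: metrizable_space_def)
  interpret Metric_space M d by (fact M)
  have "mtotally_bounded M"
    using assms(1) by (simp add: X compact_space_eq_mcomplete_mtotally_bounded)
  then have "\<forall>n. \<exists>F. finite F \<and> F \<subseteq> M \<and> M \<subseteq> (\<Union>x\<in>F. mball x (1 / real (Suc n)))"
    unfolding mtotally_bounded_def by simp
  then obtain F where F: "\<And>n. finite (F n)" "\<And>n. F n \<subseteq> M"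
      "\<And>n. M \<subseteq> (\<Union>x\<in>F n. mball x (1 / real (Suc n)))"
    by metis
  define Q where "Q = (\<Union>n. F n)"
  have "countable Q" unfolding Q_def using F(1) by (auto intro: countable_finite)
  define q where "q = from_nat_into Q"
  define f where "f = (\<lambda>x n. d (q n) x)"
  have qM: "q n \<in> M" if "M \<noteq> {}" for n
  proof -
    have "Q \<noteq> {}" using that F(3)[of 0] by (auto simp: Q_def)
    then show ?thesis using F(2) from_nat_into[of Q n] by (auto simp: q_def Q_def)
  qed
  have inj: "inj_on f M"
  proof (rule inj_onI, rule ccontr)
    fix x y assume x: "x \<in> M" and y: "y \<in> M" and eq: "f x = f y" and ne: "x \<noteq> y"
    then have "d x y > 0" by simp
    then obtain n where n: "1 / real (Suc n) < d x y / 2"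
      using nat_approx_posE by (metis half_gt_zero_iff)
    obtain p where p: "p \<in> F n" "d p x < 1 / real (Suc n)" using F(3)[of n] x by auto
    have "p \<in> Q" using p by (auto simp: Q_def)
    then obtain k where k: "q k = p"
      unfolding q_def using \<open>countable Q\<close> from_nat_into_surj by metis
    have "d p x = d p y" using eq k by (auto simp: f_def dest: fun_cong[of _ _ k])
    moreover have "p \<in> M" using p F(2) by auto
    ultimately have "d x y \<le> d p x + d p x"
      using triangle[of x p y] x y commute by metis
    then show False using n p by simp
  qed
  have cont: "continuous_map X (powertop_real UNIV) f"
  proof (cases "M = {}")
    case True
    then have "topspace X = {}" unfolding X topspace_mtopology .
    then show ?thesis
      by (simp add: continuous_map_on_empty)
  next
    case False
    have "continuous_map mtopology euclideanreal (\<lambda>x. d (q k) x)" for k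
      using continuous_map_mdist[of mtopology Self "\<lambda>_. q k" "\<lambda>x. x"] qM[OF False]
      by (simp add: mtopology_of_def)
    then show ?thesis by (simp add: X continuous_map_componentwise_UNIV f_def)
  qed
  have "embedding_map X (powertop_real UNIV) f"
  proof (rule continuous_imp_embedding_map)
    show "Hausdorff_space (powertop_real (UNIV :: nat set))"
      by (simp add: Hausdorff_space_product_topology)
  qed (use assms(1) cont inj in \<open>auto simp: X\<close>)
  then have "X homeomorphic_space subtopology (powertop_real UNIV) (f ` topspace X)"
    by (rule embedding_map_imp_homeomorphic_space)
  then show ?thesis
    using assms homeomorphic_compact_space homeomorphic_metrizable_space by blast
qed

lemma Metric_space_orbit:
  assumes "flow (mtopology_of m) T" and "0 \<le> N"
  shows "Metric_space (mspace m) (\<lambda>x y. if x \<in> mspace m \<and> y \<in> mspace m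
           then SUP r\<in>{0..N}. mdist m (T r x) (T r y) else 0)" (is "Metric_space _ ?d")
proof -
  have cs: "compact_space (mtopology_of m)"
    and ct: "continuous_map (prod_topology euclideanreal (mtopology_of m)) (mtopology_of m) (\<lambda>(r, x). T r x)"
    and T0: "\<And>x. x \<in> mspace m \<Longrightarrow> T 0 x = x"
    using assms(1) unfolding flow_def topspace_mtopology_of by blast+
  have T: "T r x \<in> mspace m" if "x \<in> mspace m" for r x
    using continuous_map_image_subset_topspace[OF ct] that by auto
  interpret M: Metric_space "mspace m" "mdist m"
    by (rule Metric_space_mspace_mdist)
  have "M.mbounded (mspace m)"
    using cs M.compactin_imp_mbounded
    unfolding compact_space_def mtopology_of_def M.topspace_mtopology by blast
  then obtain B where B: "\<And>x y. x \<in> mspace m \<Longrightarrow> y \<in> mspace m \<Longrightarrow> mdist m x y \<le> B"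
    unfolding M.mbounded_alt by auto
  have bdd: "bdd_above ((\<lambda>r. mdist m (T r x) (T r y)) ` {0..N})"
    if "x \<in> mspace m" "y \<in> mspace m" for x y
    using B T that by (auto intro!: bdd_aboveI[of _ B])
  have up: "mdist m (T r x) (T r y) \<le> ?d x y"
    if "x \<in> mspace m" "y \<in> mspace m" "r \<in> {0..N}" for x y r
    using that bdd by (auto intro: cSUP_upper)
  have nonneg: "0 \<le> ?d x y" for x y
  proof (cases "x \<in> mspace m \<and> y \<in> mspace m")
    case True
    then have "mdist m (T 0 x) (T 0 y) \<le> ?d x y" using assms(2) by (intro up) auto
    then show ?thesis using mdist_nonneg[of m "T 0 x" "T 0 y"] by linarith
  qed auto
  show ?thesis
  proof
    fix x y
    show "0 \<le> ?d x y" by (fact nonneg)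
    show "?d x y = ?d y x" by (auto simp: mdist_commute)
    assume x: "x \<in> mspace m" and y: "y \<in> mspace m"
    show "?d x y = 0 \<longleftrightarrow> x = y"
    proof
      assume "?d x y = 0"
      then have "mdist m x y \<le> 0" using up[of x y 0] x y assms(2) T0 by auto
      then show "x = y" using x y mdist_nonneg[of m x y] by (metis mdist_zero order_antisym)
    next
      assume "x = y"
      then show "?d x y = 0" using assms(2) T x by simp
    qed
    fix z assume z: "z \<in> mspace m"
    have "(SUP r\<in>{0..N}. mdist m (T r x) (T r z)) \<le> ?d x y + ?d y z"
    proof (rule cSUP_least)
      show "{0..N} \<noteq> {}" using assms(2) by simp
    next
      fix r assume r: "r \<in> {0..N}"
      have "mdist m (T r x) (T r z) \<le> mdist m (T r x) (T r y) + mdist m (T r y) (T r z)"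
        using T x y z by (intro mdist_triangle)
      then show "mdist m (T r x) (T r z) \<le> ?d x y + ?d y z"
        using up[OF x y r] up[OF y z r] by linarith
    qed
    then show "?d x z \<le> ?d x y + ?d y z" using x z by simp
  qed
qed

lemma quotient_map_circle: "quotient_map euclideanreal (circle n) (coset n)"
proof -
  have "istopology (\<lambda>W. W \<subseteq> range (coset n) \<and> open (coset n -` W))"
    unfolding istopology_def by (auto simp: vimage_Union intro!: open_Int)
  then have op: "openin (circle n) W \<longleftrightarrow> W \<subseteq> range (coset n) \<and> open (coset n -` W)" for W
    by (simp add: circle_def)
  have "topspace (circle n) = range (coset n)"
  proof
    have "openin (circle n) (range (coset n))" by (simp add: op vimage_def)
    then show "range (coset n) \<subseteq> topspace (circle n)" by (rule openin_subset)
    show "topspace (circle n) \<subseteq> range (coset n)"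
      using op[of "topspace (circle n)"] by simp
  qed
  then show ?thesis
    by (auto simp: quotient_map_def op vimage_def)
qed

lemma Metric_space_local_uniform_dist: "Metric_space A local_uniform_dist"
proof -
  define s where "s f g n = (SUP t\<in>{- real (Suc n)..real (Suc n)}. cmod (f t - g t))"
    for f g :: "real \<Rightarrow>\<^sub>C complex" and n
  have le: "cmod (f t - g t) \<le> dist f g" for f g :: "real \<Rightarrow>\<^sub>C complex" and t
    using dist_bounded[of f t g] by (simp add: dist_norm)
  have bdd: "bdd_above ((\<lambda>t. cmod (f t - g t)) ` S)" for f g :: "real \<Rightarrow>\<^sub>C complex" and S
    using le by (auto intro!: bdd_aboveI)
  have up: "cmod (f t - g t) \<le> s f g n" if "\<bar>t\<bar> \<le> real (Suc n)"
    for f g :: "real \<Rightarrow>\<^sub>C complex" and t n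
    unfolding s_def using that by (intro cSUP_upper bdd) auto
  have s0: "0 \<le> s f g n" for f g n
    using up[of 0 n f g] norm_ge_zero[of "f 0 - g 0"] by linarith
  have sd: "s f g n \<le> dist f g" for f g n
    unfolding s_def using le by (intro cSUP_least) auto
  have summ: "summable (\<lambda>n. (1/2) ^ Suc n * s f g n)" for f g
  proof (rule summable_comparison_test')
    show "summable (\<lambda>n. (1/2 :: real) ^ Suc n * dist f g)"
      by (intro summable_mult2) (simp add: summable_Suc_iff summable_geometric)
    show "\<And>n. n \<ge> 0 \<Longrightarrow> norm ((1/2) ^ Suc n * s f g n) \<le> (1/2) ^ Suc n * dist f g"
      using s0 sd by (simp add: abs_mult mult_left_mono)
  qed
  have d: "local_uniform_dist f g = (\<Sum>n. (1/2) ^ Suc n * s f g n)" for f g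
    by (simp add: local_uniform_dist_def s_def)
  show ?thesis
  proof
    fix f g :: "real \<Rightarrow>\<^sub>C complex"
    show "0 \<le> local_uniform_dist f g"
      unfolding d by (intro suminf_nonneg summ) (simp add: s0)
    show "local_uniform_dist f g = local_uniform_dist g f"
      by (simp add: d s_def norm_minus_commute)
    show "local_uniform_dist f g = 0 \<longleftrightarrow> f = g"
    proof
      assume "local_uniform_dist f g = 0"
      then have "\<forall>n. (1/2) ^ Suc n * s f g n = 0"
        unfolding d using suminf_eq_zero_iff[OF summ] s0 by simp
      then have z: "s f g n = 0" for n by auto
      show "f = g"
      proof (rule bcontfun_eqI)
        fix t
        obtain n where "\<bar>t\<bar> \<le> real n" using real_arch_simple by blast
        then have "cmod (f t - g t) \<le> s f g n" by (intro up) simp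
        then show "f t = g t" using z by simp
      qed
    next
      assume "f = g"
      then show "local_uniform_dist f g = 0" by (simp add: d s_def)
    qed
    fix h :: "real \<Rightarrow>\<^sub>C complex"
    have tri: "s f h n \<le> s f g n + s g h n" for n
    proof -
      have "cmod (f t - h t) \<le> s f g n + s g h n" if "\<bar>t\<bar> \<le> real (Suc n)" for t
        using up[OF that, of f g] up[OF that, of g h]
          norm_triangle_ineq[of "f t - g t" "g t - h t"] by simp
      then show ?thesis unfolding s_def[of f h] by (intro cSUP_least) auto
    qed
    have "local_uniform_dist f h \<le> (\<Sum>n. (1/2) ^ Suc n * s f g n + (1/2) ^ Suc n * s g h n)"
      unfolding d using tri
      by (intro suminf_le summ summable_add)
        (simp add: distrib_left[symmetric] mult_left_mono)
    also have "\<dots> = local_uniform_dist f g + local_uniform_dist g h"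
      unfolding d by (rule suminf_add[symmetric]) (rule summ)+
    finally show "local_uniform_dist f h \<le> local_uniform_dist f g + local_uniform_dist g h" .
  qed
qed

lemma apply_bcontfun_shift: "apply_bcontfun (shift r f) = (\<lambda>t. f (t + r))"
proof -
  have "continuous_on UNIV (\<lambda>t. apply_bcontfun f (t + r))"
    by (rule continuous_on_compose2[of UNIV "apply_bcontfun f"]) (auto intro!: continuous_intros)
  moreover have "bounded (range (\<lambda>t. apply_bcontfun f (t + r)))"
    by (rule bounded_subset[OF bounded_apply_bcontfun]) auto
  ultimately show ?thesis
    by (simp add: shift_def bcontfun_def Bcontfun_inverse)
qed

end

theory Submission
  imports Defs "HOL-Probability.Sinc_Integral"
begin

text \<open>
  An equivariant map of \<open>X\<close> into a space of functions is determined by the observable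
  \<open>v x = f x 0\<close>, since \<open>f x t = v (T t x)\<close>. Let \<open>a < c < b\<close> with mean dimension less than \<open>\<rho> < c - a\<close>.
  A factor map onto the circle of length \<open>N = n!\<close> cuts each orbit into pieces of length \<open>N\<close>. By
  interpolation at the lattice \<open>(1/\<rho>)\<int>\<close> with a rapidly decaying kernel with spectrum in \<open>[a,c]\<close> one may
  prescribe \<open>\<rho> N\<close> complex values on each piece; as \<open>Widim\<^sub>\<epsilon> (X, d\<^sub>N) < \<rho> N\<close>, a small generic change of
  these values separates any two points at distance at least \<open>\<epsilon>\<close> with the same image in the solenoid.
  Iterating the changes gives \<open>u\<close> with spectrum in \<open>[a,c]\<close> that separates points together with the factor
  map. The solenoid is recorded by an almost periodic function with frequencies in \<open>[c,b]\<close>; adding it to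
  \<open>u\<close> loses no information, because the spectra are separated.
\<close>

section \<open>Fourier analysis of bounded functions\<close>

text \<open>Complex values match the bound exactly: m = \<rho> N complex samples are 2 m real
  coordinates, and general position in 2 m real coordinates separates the points of a complex of
  dimension below m. As m must be an integer, \<rho> is taken rational and n large. The inequality
  \<rho> < c - a leaves spare band, which buys a kernel with quadratic decay in place of the sinc
  function; its lattice sums converge absolutely, so small changes of the samples change the
  observable uniformly little. The position of a point in its block is known only modulo N, so
  corrections are attached to the whole lattice in a way that is invariant under passing to the next
  block. The iteration is a Baire category argument with explicit radii: a function uniformly close
  to one that separates at a given scale separates at that scale too. Finally, \<open>mdim\<close>
  is defined through \<open>Lim\<close>, which carries information only once the limits are known to
  exist. Existence rests on subadditivity of Widim, hence on dim (K x L) \<le> dim K + dim L, which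
  is obtained from Ostrand's families of disjoint open sets.\<close>

lemma borel_measurable_cis [measurable]: "cis \<in> borel_measurable borel"
  by (intro borel_measurable_continuous_onI continuous_intros)

lemma integrable_mult_cis:
  assumes "integrable lborel f" "g \<in> borel_measurable borel"
  shows "integrable lborel (\<lambda>t. cis (g t) * f t)"
  by (rule Bochner_Integration.integrable_bound[OF assms(1)]) (use assms in \<open>auto simp: norm_mult\<close>)

lemma integrable_cis_mult:
  assumes "integrable lborel f" "g \<in> borel_measurable borel"
  shows "integrable lborel (\<lambda>t. f t * cis (g t))"
  using integrable_mult_cis[OF assms] by (simp add: mult.commute)

section \<open>Triangle functions and Fejer means\<close>

definition triangle :: "real \<Rightarrow> real \<Rightarrow> real" where
  "triangle R t = max 0 (1 - \<bar>t\<bar> / R)"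

lemma triangle_nonneg: "0 \<le> triangle R t"
  by (simp add: triangle_def)

lemma triangle_le_1: "0 < R \<Longrightarrow> triangle R t \<le> 1"
  by (simp add: triangle_def)

lemma triangle_eq_0: "0 < R \<Longrightarrow> R \<le> \<bar>t\<bar> \<Longrightarrow> triangle R t = 0"
  by (simp add: triangle_def)

lemma triangle_measurable [measurable]: "triangle R \<in> borel_measurable borel"
  unfolding triangle_def by measurable

lemma integrable_triangle: "0 < R \<Longrightarrow> integrable lborel (triangle R)"
proof -
  assume R: "0 < R"
  have "integrable lborel (indicator {-R..R} :: real \<Rightarrow> real)"
    by (rule integrable_real_indicator) (use R in auto)
  then show ?thesis
    by (rule Bochner_Integration.integrable_bound)
      (use R in \<open>auto intro!: AE_I2 simp: indicator_def triangle_eq_0 triangle_nonneg triangle_le_1\<close>)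
qed

lemma integrable_triangle_mult_cis:
  assumes "0 < R" "g \<in> borel_measurable borel"
  shows "integrable lborel (\<lambda>t. of_real (triangle R t) * cis (g t))"
  by (intro integrable_cis_mult integrable_of_real integrable_triangle assms)

lemma has_integral_linear_times_exp:
  fixes c :: complex
  assumes R: "0 < R" and c: "c \<noteq> 0"
  shows "((\<lambda>t. (1 - of_real t / of_real R) * exp (c * of_real t)) has_integral
           (exp (c * of_real R) / (of_real R * c\<^sup>2) - 1 / c - 1 / (of_real R * c\<^sup>2))) {0..R}"
proof -
  \<comment> \<open>An antiderivative, found by integrating by parts once. It is complex
    differentiable in \<open>z\<close>, so the real derivative follows by restriction to the real
    line.\<close>
  define F where "F z = (1 - z / of_real R) * exp (c * z) / c + exp (c * z) / (of_real R * c\<^sup>2)" for z :: complex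
  have "((\<lambda>t. (1 - of_real t / of_real R) * exp (c * of_real t)) has_integral (F (of_real R) - F (of_real 0))) {0..R}"
  proof (rule fundamental_theorem_of_calculus)
    show "0 \<le> R" using R by simp
    fix x :: real
    have "(F has_field_derivative ((1 - of_real x / of_real R) * exp (c * of_real x))) (at (of_real x))"
      unfolding F_def using R c
      by (auto intro!: derivative_eq_intros simp: field_simps power2_eq_square)
    then show "((\<lambda>x. F (of_real x)) has_vector_derivative (1 - of_real x / of_real R) * exp (c * of_real x)) (at x within {0..R})"
      by (rule has_vector_derivative_real_field)
  qed
  then show ?thesis using R c by (simp add: F_def diff_diff_eq)
qed

text \<open>The right half is the preceding integral with \<open>c\<close>, the left half its
  reflection with \<open>- c\<close>; the terms \<open>1 / c\<close> cancel. The result is the Fejer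
  kernel sin^2 (pi R s) / (pi^2 R s^2), kept in the form with 1 - cos because the interpolation
  kernel needs the cosines of two such kernels to cancel.\<close>

lemma triangle_transform:
  assumes R: "0 < R" and s: "s \<noteq> 0"
  shows "(LINT t|lborel. of_real (triangle R t) * cis (2 * pi * s * t)) =
           of_real ((1 - cos (2 * pi * R * s)) / (2 * pi\<^sup>2 * R * s\<^sup>2))"
proof -
  define c where "c = \<i> * of_real (2 * pi * s)"
  define f where "f t = of_real (triangle R t) * exp (c * of_real t)" for t
  have c: "c \<noteq> 0" using s by (simp add: c_def)
  have fe: "f t = of_real (triangle R t) * cis (2 * pi * s * t)" for t
    by (simp add: f_def cis_conv_exp c_def mult_ac)
  have 1: "(f has_integral (exp (c * of_real R) / (of_real R * c\<^sup>2) - 1 / c - 1 / (of_real R * c\<^sup>2))) {0..R}"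
    by (rule has_integral_eq[OF _ has_integral_linear_times_exp[OF R c]])
      (use R in \<open>auto simp: f_def triangle_def\<close>)
  have "((\<lambda>t. f (- t)) has_integral (exp (- c * of_real R) / (of_real R * (- c)\<^sup>2) - 1 / (- c) - 1 / (of_real R * (- c)\<^sup>2))) {0..R}"
    by (rule has_integral_eq[OF _ has_integral_linear_times_exp[OF R]])
      (use R c in \<open>auto simp: f_def triangle_def\<close>)
  then have 2: "(f has_integral (exp (- c * of_real R) / (of_real R * (- c)\<^sup>2) - 1 / (- c) - 1 / (of_real R * (- c)\<^sup>2))) {-R..0}"
    using has_integral_reflect_real[where f = f and a = "-R" and b = 0] by simp
  define I where "I = (exp (c * of_real R) + exp (- c * of_real R) - 2) / (of_real R * c\<^sup>2)"
  have "(f has_integral I) {-R..R}"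
    using has_integral_combine[OF _ _ 2 1] R c by (simp add: I_def diff_divide_distrib add_divide_distrib algebra_simps)
  then have I: "(f has_integral I) UNIV"
    by (rule has_integral_on_superset) (use R in \<open>auto simp: f_def triangle_eq_0\<close>)
  have "integrable lborel f"
    using integrable_triangle_mult_cis[OF R, of "\<lambda>t. 2 * pi * s * t"] by (simp add: fe[abs_def])
  then have "(f has_integral (integral\<^sup>L lborel f)) UNIV"
    by (rule has_integral_integral_lborel)
  then have "integral\<^sup>L lborel f = I" using I has_integral_unique by blast
  also have "I = of_real ((1 - cos (2 * pi * R * s)) / (2 * pi\<^sup>2 * R * s\<^sup>2))"
  proof -
    have "exp (c * of_real R) + exp (- c * of_real R) = of_real (2 * cos (2 * pi * R * s))"
    proof -
      have "exp (c * of_real R) = cis (2 * pi * R * s)" "exp (- c * of_real R) = cis (- (2 * pi * R * s))"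
        by (simp_all add: cis_conv_exp c_def mult_ac)
      then show ?thesis by (simp add: complex_eq_iff)
    qed
    moreover have "of_real R * c\<^sup>2 = of_real (- (R * (2 * pi * s)\<^sup>2))"
      by (simp add: c_def power2_eq_square)
    ultimately have "I = of_real ((2 * cos (2 * pi * R * s) - 2) / (- (R * (2 * pi * s)\<^sup>2)))"
      by (simp add: I_def)
    also have "(2 * cos (2 * pi * R * s) - 2) / (- (R * (2 * pi * s)\<^sup>2)) = (1 - cos (2 * pi * R * s)) / (2 * pi\<^sup>2 * R * s\<^sup>2)"
      using R s by (simp add: field_simps power2_eq_square)
    finally show ?thesis .
  qed
  finally show ?thesis unfolding fe[abs_def] .
qed

text \<open>For fixed \<open>s\<close> the upper bound is of order 1 / R, which makes Fejer means
  vanish off the support; for fixed \<open>R\<close> it is the quadratic decay in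
  \<open>s\<close>.\<close>

lemma fejer_nonneg_le:
  assumes R: "0 < R" and s: "s \<noteq> 0"
  shows "0 \<le> (1 - cos (2 * pi * R * s)) / (2 * pi\<^sup>2 * R * s\<^sup>2)"
    and "(1 - cos (2 * pi * R * s)) / (2 * pi\<^sup>2 * R * s\<^sup>2) \<le> 1 / (pi\<^sup>2 * R * s\<^sup>2)"
proof -
  show "0 \<le> (1 - cos (2 * pi * R * s)) / (2 * pi\<^sup>2 * R * s\<^sup>2)" using R by simp
  have "(1 - cos (2 * pi * R * s)) / (2 * pi\<^sup>2 * R * s\<^sup>2) \<le> 2 / (2 * pi\<^sup>2 * R * s\<^sup>2)"
  proof (rule divide_right_mono)
    show "1 - cos (2 * pi * R * s) \<le> 2" using cos_ge_minus_one[of "2 * pi * R * s"] by simp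
  qed (use R in auto)
  then show "(1 - cos (2 * pi * R * s)) / (2 * pi\<^sup>2 * R * s\<^sup>2) \<le> 1 / (pi\<^sup>2 * R * s\<^sup>2)" by simp
qed

lemma integrable_pair_mult:
  fixes f g :: "real \<Rightarrow> complex" and h :: "real \<times> real \<Rightarrow> real"
  assumes f: "integrable lborel f" and g: "integrable lborel g"
    and h: "h \<in> borel_measurable (lborel \<Otimes>\<^sub>M lborel)"
  shows "integrable (lborel \<Otimes>\<^sub>M lborel) (\<lambda>(x, y). f x * g y * cis (h (x, y)))"
proof -
  have [measurable]: "f \<in> borel_measurable lborel" "g \<in> borel_measurable lborel" using f g by auto
  note h [measurable]
  have "integrable (lborel \<Otimes>\<^sub>M lborel) (\<lambda>(x, y). norm (f x) * norm (g y))"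
    by (rule lborel_pair.Fubini_integrable) (use f g in auto)
  then show ?thesis
    by (rule Bochner_Integration.integrable_bound) (auto simp: norm_mult)
qed

text \<open>The Fejer means of the inversion integral tend to \<open>0\<close> off the support of \<open>\<psi>\<close>.\<close>

lemma fourier_inversion_off_support:
  assumes \<psi>: "integrable lborel \<psi>"
    and \<theta>: "integrable lborel (\<lambda>t. LINT \<eta>|lborel. cis (- (2 * pi * t * \<eta>)) * \<psi> \<eta>)"
    and d: "0 < d" and off: "\<And>\<eta>. \<bar>\<eta> - \<xi>\<bar> < d \<Longrightarrow> \<psi> \<eta> = 0"
  shows "(LINT t|lborel. (LINT \<eta>|lborel. cis (- (2 * pi * t * \<eta>)) * \<psi> \<eta>) * cis (2 * pi * t * \<xi>)) = 0"
proof -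
  define X where "X t = (LINT \<eta>|lborel. cis (- (2 * pi * t * \<eta>)) * \<psi> \<eta>)" for t
  have [measurable]: "\<psi> \<in> borel_measurable lborel" using \<psi> by auto
  have X: "integrable lborel X" using \<theta> by (simp add: X_def[abs_def])
  have [measurable]: "X \<in> borel_measurable lborel" using X by auto
  \<comment> \<open>Fejer means of the inversion integral with \<open>R = n + 1\<close>. They
    converge to the integral itself by dominated convergence, because the transform \<open>X\<close>
    is integrable.\<close>
  define J where "J n = (LINT t|lborel. of_real (triangle (real (Suc n)) t) * (X t * cis (2 * pi * t * \<xi>)))" for n
  have lim1: "J \<longlonglongrightarrow> (LINT t|lborel. X t * cis (2 * pi * t * \<xi>))"
    unfolding J_def
  proof (rule integral_dominated_convergence[where w = "\<lambda>t. norm (X t)"])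
    show "AE t in lborel. (\<lambda>n. of_real (triangle (real (Suc n)) t) * (X t * cis (2 * pi * t * \<xi>))) \<longlonglongrightarrow> X t * cis (2 * pi * t * \<xi>)"
    proof (rule AE_I2)
      fix t :: real
      have "(\<lambda>n. max 0 (1 - \<bar>t\<bar> / real (Suc n))) \<longlonglongrightarrow> max 0 (1 - 0)"
        by (intro tendsto_max tendsto_diff tendsto_const LIMSEQ_Suc lim_const_over_n)
      then have "(\<lambda>n. triangle (real (Suc n)) t) \<longlonglongrightarrow> 1" by (simp add: triangle_def)
      then have "(\<lambda>n. of_real (triangle (real (Suc n)) t) * (X t * cis (2 * pi * t * \<xi>))) \<longlonglongrightarrow> of_real 1 * (X t * cis (2 * pi * t * \<xi>))"
        by (intro tendsto_mult tendsto_of_real tendsto_const)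
      then show "(\<lambda>n. of_real (triangle (real (Suc n)) t) * (X t * cis (2 * pi * t * \<xi>))) \<longlonglongrightarrow> X t * cis (2 * pi * t * \<xi>)" by simp
    qed
    show "AE t in lborel. norm (of_real (triangle (real (Suc n)) t) * (X t * cis (2 * pi * t * \<xi>))) \<le> norm (X t)" for n
      using triangle_le_1[of "real (Suc n)"] triangle_nonneg[of "real (Suc n)"]
      by (auto simp: norm_mult intro!: mult_left_le_one_le)
  qed (use X in auto)
  define C where "C = (LINT \<eta>|lborel. norm (\<psi> \<eta>))"
  \<comment> \<open>Fubini rewrites the mean as an integral of \<psi> against the Fejer kernel
    centred at \<xi>. Where \<psi> is nonzero the distance to \<xi> is at least \<open>d\<close>, so
    the kernel is O(1 / R) uniformly there.\<close>
  have bound: "norm (J n) \<le> (1 / (pi\<^sup>2 * d\<^sup>2) * C) / real (Suc n)" for n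
  proof -
    define R where "R = real (Suc n)"
    have R: "0 < R" by (simp add: R_def)
    have int: "integrable (lborel \<Otimes>\<^sub>M lborel) (\<lambda>(\<eta>, t). \<psi> \<eta> * of_real (triangle R t) * cis (2 * pi * (\<xi> - \<eta>) * t))"
    proof -
      have "(\<lambda>z. 2 * pi * (\<xi> - fst z) * snd z) \<in> borel_measurable (lborel \<Otimes>\<^sub>M lborel)" by measurable
      from integrable_pair_mult[OF \<psi> integrable_of_real[OF integrable_triangle[OF R]] this]
      show ?thesis by simp
    qed
    have "J n = (LINT t|lborel. (LINT \<eta>|lborel. \<psi> \<eta> * of_real (triangle R t) * cis (2 * pi * (\<xi> - \<eta>) * t)))"
      unfolding J_def R_def[symmetric]
    proof (rule Bochner_Integration.integral_cong[OF refl])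
      fix t
      have "(LINT \<eta>|lborel. \<psi> \<eta> * of_real (triangle R t) * cis (2 * pi * (\<xi> - \<eta>) * t))
        = (LINT \<eta>|lborel. (of_real (triangle R t) * cis (2 * pi * t * \<xi>)) * (cis (- (2 * pi * t * \<eta>)) * \<psi> \<eta>))"
      proof (intro Bochner_Integration.integral_cong refl)
        fix \<eta>
        have "cis (2 * pi * (\<xi> - \<eta>) * t) = cis (2 * pi * t * \<xi>) * cis (- (2 * pi * t * \<eta>))"
          by (simp add: cis_mult algebra_simps)
        then show "\<psi> \<eta> * of_real (triangle R t) * cis (2 * pi * (\<xi> - \<eta>) * t)
          = (of_real (triangle R t) * cis (2 * pi * t * \<xi>)) * (cis (- (2 * pi * t * \<eta>)) * \<psi> \<eta>)"
          by (simp only: mult_ac)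
      qed
      also have "\<dots> = (of_real (triangle R t) * cis (2 * pi * t * \<xi>)) * X t"
        unfolding X_def by (rule integral_mult_right_zero)
      finally show "of_real (triangle R t) * (X t * cis (2 * pi * t * \<xi>)) = (LINT \<eta>|lborel. \<psi> \<eta> * of_real (triangle R t) * cis (2 * pi * (\<xi> - \<eta>) * t))"
        by (simp add: mult_ac)
    qed
    also have "\<dots> = (LINT \<eta>|lborel. (LINT t|lborel. \<psi> \<eta> * of_real (triangle R t) * cis (2 * pi * (\<xi> - \<eta>) * t)))"
      by (rule lborel_pair.Fubini_integral[OF int])
    finally have J: "J n = (LINT \<eta>|lborel. (LINT t|lborel. \<psi> \<eta> * of_real (triangle R t) * cis (2 * pi * (\<xi> - \<eta>) * t)))" .
    have "norm (J n) \<le> (LINT \<eta>|lborel. (1 / (pi\<^sup>2 * R * d\<^sup>2)) * norm (\<psi> \<eta>))"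
      unfolding J
    proof (rule Bochner_Integration.integral_norm_bound_integral)
      show "integrable lborel (\<lambda>\<eta>. LINT t|lborel. \<psi> \<eta> * of_real (triangle R t) * cis (2 * pi * (\<xi> - \<eta>) * t))"
        using lborel_pair.integrable_fst[OF int] .
      show "integrable lborel (\<lambda>\<eta>. 1 / (pi\<^sup>2 * R * d\<^sup>2) * norm (\<psi> \<eta>))" using \<psi> by auto
      fix \<eta> :: real
      show "norm (LINT t|lborel. \<psi> \<eta> * of_real (triangle R t) * cis (2 * pi * (\<xi> - \<eta>) * t)) \<le> 1 / (pi\<^sup>2 * R * d\<^sup>2) * norm (\<psi> \<eta>)"
      proof (cases "\<bar>\<eta> - \<xi>\<bar> < d")
        case True then show ?thesis using off by simp
      next
        case False
        define s where "s = \<xi> - \<eta>"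
        have s: "s \<noteq> 0" "d \<le> \<bar>s\<bar>" using False d by (auto simp: s_def)
        have "(LINT t|lborel. \<psi> \<eta> * of_real (triangle R t) * cis (2 * pi * (\<xi> - \<eta>) * t))
          = \<psi> \<eta> * of_real ((1 - cos (2 * pi * R * s)) / (2 * pi\<^sup>2 * R * s\<^sup>2))"
          using triangle_transform[OF R s(1)]
          by (simp add: s_def mult.assoc integral_mult_right_zero)
        then have "norm (LINT t|lborel. \<psi> \<eta> * of_real (triangle R t) * cis (2 * pi * (\<xi> - \<eta>) * t))
          = norm (\<psi> \<eta>) * ((1 - cos (2 * pi * R * s)) / (2 * pi\<^sup>2 * R * s\<^sup>2))"
          using fejer_nonneg_le(1)[OF R s(1)] by (simp only: norm_mult norm_of_real abs_of_nonneg)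
        also have "\<dots> \<le> norm (\<psi> \<eta>) * (1 / (pi\<^sup>2 * R * s\<^sup>2))"
          by (intro mult_left_mono fejer_nonneg_le(2)[OF R s(1)]) auto
        also have "\<dots> \<le> norm (\<psi> \<eta>) * (1 / (pi\<^sup>2 * R * d\<^sup>2))"
        proof (intro mult_left_mono divide_left_mono)
          show "d\<^sup>2 \<le> s\<^sup>2" using s d by (simp add: abs_le_square_iff[symmetric])
        qed (use R d s in auto)
        finally show ?thesis by (simp add: mult.commute)
      qed
    qed
    also have "\<dots> = (1 / (pi\<^sup>2 * d\<^sup>2) * C) / real (Suc n)"
      by (simp add: C_def R_def)
    finally show ?thesis .
  qed
  have "J \<longlonglongrightarrow> 0"
  proof (rule Lim_null_comparison)
    show "\<forall>\<^sub>F n in sequentially. norm (J n) \<le> (1 / (pi\<^sup>2 * d\<^sup>2) * C) / real (Suc n)" using bound by simp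
    show "(\<lambda>n. (1 / (pi\<^sup>2 * d\<^sup>2) * C) / real (Suc n)) \<longlonglongrightarrow> 0"
      by (intro LIMSEQ_Suc lim_const_over_n)
  qed
  then show ?thesis using lim1 LIMSEQ_unique unfolding X_def by blast
qed

section \<open>Test functions and the spectrum of a bounded function\<close>

lemma integrable_inverse_1_plus_square: "integrable lborel (\<lambda>t::real. C / (1 + t\<^sup>2))"
proof -
  have "integrable lborel (\<lambda>x::real. inverse (1 + x\<^sup>2))"
    \<comment> \<open>The fact cited here is the library lemma of the same name, which speaks of set
      integrability over the extended interval.\<close>
    using integrable_inverse_1_plus_square by (simp add: set_integrable_def einterval_def)
  then have "integrable lborel (\<lambda>x::real. C * inverse (1 + x\<^sup>2))" by (intro integrable_mult_right) auto
  then show ?thesis by (simp add: divide_inverse)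
qed

lemma integrable_decay:
  fixes f :: "real \<Rightarrow> complex"
  assumes "f \<in> borel_measurable borel" "\<And>t. norm (f t) \<le> C / (1 + t\<^sup>2)"
  shows "integrable lborel f"
proof (rule Bochner_Integration.integrable_bound[OF integrable_inverse_1_plus_square[of C]])
  have "0 \<le> C" using order_trans[OF norm_ge_zero assms(2)[of 0]] by simp
  then show "AE t in lborel. norm (f t) \<le> norm (C / (1 + t\<^sup>2))"
    using assms(2) by (auto intro!: AE_I2 simp: abs_of_nonneg)
qed (use assms in auto)

lemma fourier_eq: "fourier \<phi> t = (LINT \<eta>|lborel. cis (- (2 * pi * t * \<eta>)) * \<phi> \<eta>)"
  by (simp add: fourier_def cis_conv_exp mult_ac)

text \<open>Two integrations by parts bound t^2 times the transform by the L1 norm of the second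
  derivative. Together with the L1 bound of the function itself this gives decay of order 1 / (1 +
  t^2), which is integrable.\<close>

lemma schwartz_compact_support:
  assumes "schwartz \<phi>" and "compact (closure {x. \<phi> x \<noteq> 0})"
  shows "integrable lborel \<phi>" and "integrable lborel (fourier \<phi>)"
proof -
  from assms(1) obtain D :: "nat \<Rightarrow> real \<Rightarrow> complex" where D0: "D 0 = \<phi>"
    and D: "\<And>n x. (D n has_vector_derivative D (Suc n) x) (at x)"
    unfolding schwartz_def by blast
  have cont: "continuous_on UNIV (D n)" for n
    unfolding continuous_on_eq_continuous_at[OF open_UNIV]
    using D has_vector_derivative_continuous by blast
  then have [measurable]: "D n \<in> borel_measurable borel" for n
    by (rule borel_measurable_continuous_onI)
  obtain L where L: "\<And>x. x \<in> closure {x. \<phi> x \<noteq> 0} \<Longrightarrow> \<bar>x\<bar> \<le> L" "0 < L"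
    using compact_imp_bounded[OF assms(2)] unfolding bounded_pos by auto
  have z0: "D 0 x = 0" if "L < \<bar>x\<bar>" for x
    using L(1)[of x] that closure_subset[of "{x. \<phi> x \<noteq> 0}"] by (auto simp: D0)
  have z1: "D 1 x = 0" if x: "L < \<bar>x\<bar>" for x
  proof -
    have op: "open {y. L < \<bar>y\<bar>}" by (intro open_Collect_less continuous_intros)
    have "(D 0 has_vector_derivative 0) (at x)"
      by (rule has_vector_derivative_transform_within_open[where f = "\<lambda>_. 0", OF _ op])
        (use x z0 in auto)
    then show ?thesis using D[of 0 x] vector_derivative_unique_at by fastforce
  qed
  \<comment> \<open>The endpoints of [-M, M] lie strictly outside the support, so the function and
    its first derivative vanish there and no boundary terms remain.\<close>
  define M where "M = L + 1"
  have M: "0 < M" "L < M" using L by (auto simp: M_def)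
  have compint: "integrable lborel (\<lambda>x. indicator {-M..M} x *\<^sub>R g x)" if "continuous_on UNIV g" for g :: "real \<Rightarrow> complex"
    using borel_integrable_compact[of "{-M..M}" g] continuous_on_subset[OF that] by auto
  have ind: "indicator {-M..M} x *\<^sub>R \<phi> x = \<phi> x" for x
    using z0[of x] M by (auto simp: indicator_def D0)
  show int0: "integrable lborel \<phi>" using compint[OF cont[of 0]] by (simp add: ind D0)
  define I0 where "I0 = (LINT x|lborel. norm (\<phi> x))"
  define I2 where "I2 = (LINT x|lborel. norm (indicator {-M..M} x *\<^sub>R D 2 x))"
  have meas: "fourier \<phi> \<in> borel_measurable borel"
  proof -
    have [measurable]: "\<phi> \<in> borel_measurable borel" using D0 by auto
    show ?thesis unfolding fourier_eq[abs_def] by measurable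
  qed
  show "integrable lborel (fourier \<phi>)"
  proof (rule integrable_decay[OF meas])
    fix t :: real
    define e where "e x = cis (- (2 * pi * t * x))" for x
    define c where "c = \<i> * of_real (2 * pi * t)"
    have e: "e x = exp (- c * of_real x)" for x by (simp add: e_def cis_conv_exp c_def mult_ac)
    have conte: "continuous_on UNIV e" unfolding e_def by (intro continuous_intros)
    have de: "(e has_vector_derivative (- c * e x)) (at x)" for x
      unfolding e[abs_def]
      by (rule has_vector_derivative_real_field) (auto intro!: derivative_eq_intros)
    have "integral\<^sup>L lborel (\<lambda>x. indicator {-M..M} x *\<^sub>R ((D 2 x - c\<^sup>2 * D 0 x) * e x))
       = (D 1 M + c * D 0 M) * e M - (D 1 (-M) + c * D 0 (-M)) * e (-M)"
    proof (rule integral_FTC_atLeastAtMost)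
      show "- M \<le> M" using M by simp
      show "continuous_on {- M..M} (\<lambda>x. (D 2 x - c\<^sup>2 * D 0 x) * e x)"
        by (intro continuous_intros continuous_on_subset[OF cont] continuous_on_subset[OF conte]) auto
      fix x
      \<comment> \<open>Both integrations by parts in one application of the fundamental theorem:
        with \<open>e' = - c e\<close> the terms in \<open>D 1\<close> cancel and
        \<open>D 2 - c^2 D 0\<close> remains.\<close>
      have "((\<lambda>x. (D 1 x + c * D 0 x) * e x) has_vector_derivative
         ((D 1 x + c * D 0 x) * (- c * e x) + (D 2 x + c * D 1 x) * e x)) (at x)"
        using D[of 1 x] D[of 0 x]
        by (intro has_vector_derivative_mult de has_vector_derivative_add has_vector_derivative_mult_right)
          (auto simp: numeral_2_eq_2)
      then have "((\<lambda>x. (D 1 x + c * D 0 x) * e x) has_vector_derivative ((D 2 x - c\<^sup>2 * D 0 x) * e x)) (at x)"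
        by (simp add: algebra_simps power2_eq_square)
      then show "((\<lambda>x. (D 1 x + c * D 0 x) * e x) has_vector_derivative ((D 2 x - c\<^sup>2 * D 0 x) * e x)) (at x within {- M..M})"
        by (rule has_vector_derivative_at_within)
    qed
    also have "\<dots> = 0" using z0[of M] z0[of "-M"] z1[of M] z1[of "-M"] M by simp
    finally have "integral\<^sup>L lborel (\<lambda>x. e x * (indicator {-M..M} x *\<^sub>R D 2 x) - c\<^sup>2 * (e x * \<phi> x)) = 0"
      by (subst ind[symmetric]) (simp add: D0 algebra_simps scaleR_conv_of_real)
    moreover have i2: "integrable lborel (\<lambda>x. e x * (indicator {-M..M} x *\<^sub>R D 2 x))"
      and i0: "integrable lborel (\<lambda>x. e x * \<phi> x)"
      unfolding e_def by (rule integrable_mult_cis[OF compint[OF cont]] integrable_mult_cis[OF int0]; measurable)+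
    ultimately have eq: "integral\<^sup>L lborel (\<lambda>x. e x * (indicator {-M..M} x *\<^sub>R D 2 x)) = c\<^sup>2 * fourier \<phi> t"
      by (simp add: fourier_eq e_def)
    have "norm (c\<^sup>2 * fourier \<phi> t) \<le> I2"
      unfolding eq[symmetric] I2_def
    proof (rule Bochner_Integration.integral_norm_bound_integral[OF i2])
      show "integrable lborel (\<lambda>x. norm (indicator {-M..M} x *\<^sub>R D 2 x))"
        by (intro integrable_norm compint cont)
    qed (simp add: norm_mult e_def)
    then have b2: "4 * pi\<^sup>2 * t\<^sup>2 * norm (fourier \<phi> t) \<le> I2"
      by (simp add: norm_mult c_def norm_power power_mult_distrib)
    have b0: "norm (fourier \<phi> t) \<le> I0"
      unfolding fourier_eq I0_def
      by (rule Bochner_Integration.integral_norm_bound_integral) (use int0 i0 in \<open>auto simp: norm_mult e_def\<close>)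
    have "1 \<le> 4 * pi\<^sup>2"
      using pi_gt3 one_le_power[of pi 2] by linarith
    then have "t\<^sup>2 * norm (fourier \<phi> t) \<le> 4 * pi\<^sup>2 * t\<^sup>2 * norm (fourier \<phi> t)"
      by (intro mult_right_mono) (auto simp: mult_le_cancel_right1)
    with b2 b0 have "(1 + t\<^sup>2) * norm (fourier \<phi> t) \<le> I0 + I2" by (simp add: distrib_right)
    moreover have "0 < 1 + t\<^sup>2" by (simp add: add_pos_nonneg)
    ultimately show "norm (fourier \<phi> t) \<le> (I0 + I2) / (1 + t\<^sup>2)" by (simp add: field_simps)
  qed
qed

text \<open>That \<open>f\<close> has its spectrum in \<open>I\<close> is expressed by testing against integrable functions whose Fourier
  transform vanishes on \<open>I\<close>; in this form it passes to bounded pointwise limits.\<close>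

definition spectrum_in :: "real set \<Rightarrow> (real \<Rightarrow> complex) \<Rightarrow> bool" where
  "spectrum_in I f \<longleftrightarrow>
     (\<forall>\<theta>. integrable lborel \<theta> \<and> (\<forall>\<xi>\<in>I. (LINT t|lborel. \<theta> t * cis (2 * pi * t * \<xi>)) = 0) \<longrightarrow>
          (LINT t|lborel. f t * \<theta> t) = 0)"

text \<open>For a test function \<phi> supported off \<open>{a..b}\<close>, its transform is
  integrable and inversion shows that the transform of \<open>fourier \<phi>\<close> vanishes on
  \<open>{a..b}\<close>. Hence \<open>fourier \<phi>\<close> is one of the functions against which
  \<open>spectrum_in\<close> tests.\<close>

lemma bandlimited_if_spectrum_in:
  assumes "spectrum_in {a..b} (apply_bcontfun f)"
  shows "f \<in> bandlimited a b"
proof -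
  have "vanishes_on (fourier_distribution (regular_distribution (apply_bcontfun f))) (- {a..b})"
    unfolding vanishes_on_def
  proof (intro allI impI, elim conjE)
    fix \<phi> assume s: "schwartz \<phi>" and c: "compact (closure {x. \<phi> x \<noteq> 0})"
      and sub: "closure {x. \<phi> x \<noteq> 0} \<subseteq> - {a..b}"
    have int: "integrable lborel \<phi>" "integrable lborel (fourier \<phi>)"
      using schwartz_compact_support[OF s c] by auto
    have "(LINT t|lborel. fourier \<phi> t * cis (2 * pi * t * \<xi>)) = 0" if \<xi>: "\<xi> \<in> {a..b}" for \<xi>
    proof -
      have "\<xi> \<in> - closure {x. \<phi> x \<noteq> 0}" using sub \<xi> by auto
      then obtain d where d: "0 < d" "ball \<xi> d \<subseteq> - closure {x. \<phi> x \<noteq> 0}"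
        by (metis closed_closure open_Compl openE)
      have "\<phi> \<eta> = 0" if "\<bar>\<eta> - \<xi>\<bar> < d" for \<eta>
        using that d(2) closure_subset[of "{x. \<phi> x \<noteq> 0}"]
        by (auto simp: subset_iff dist_real_def abs_minus_commute)
      from fourier_inversion_off_support[OF int(1) _ d(1) this] int(2)
      show ?thesis by (simp add: fourier_eq[abs_def])
    qed
    then show "fourier_distribution (regular_distribution (apply_bcontfun f)) \<phi> = 0"
      using assms int(2) unfolding spectrum_in_def fourier_distribution_def regular_distribution_def by blast
  qed
  moreover have "open (- {a..b})" by (intro open_Compl closed_atLeastAtMost)
  ultimately have "distribution_support (fourier_distribution (regular_distribution (apply_bcontfun f))) \<subseteq> {a..b}"
    unfolding distribution_support_def by blast
  then show ?thesis by (simp add: bandlimited_def)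
qed

lemma spectrum_in_mono: "spectrum_in I f \<Longrightarrow> I \<subseteq> J \<Longrightarrow> spectrum_in J f"
  unfolding spectrum_in_def by blast

lemma spectrum_in_0: "spectrum_in I (\<lambda>t. 0)"
  by (simp add: spectrum_in_def)

lemma spectrum_in_cmult: "spectrum_in I f \<Longrightarrow> spectrum_in I (\<lambda>t. c * f t)"
  by (simp add: spectrum_in_def mult.assoc)

lemma integrable_bounded_mult:
  fixes f :: "real \<Rightarrow> complex"
  assumes "f \<in> borel_measurable borel" "\<And>t. norm (f t) \<le> B" "integrable lborel \<theta>"
  shows "integrable lborel (\<lambda>t. f t * \<theta> t :: complex)"
proof (rule Bochner_Integration.integrable_bound[of lborel "\<lambda>t. B * norm (\<theta> t)"])
  show "AE t in lborel. norm (f t * \<theta> t) \<le> norm (B * norm (\<theta> t))"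
    using order_trans[OF assms(2) abs_ge_self] by (auto intro!: AE_I2 mult_right_mono simp: norm_mult abs_mult)
qed (use assms in auto)

lemma spectrum_in_limit:
  assumes "\<And>n. spectrum_in I (f n)" and [measurable]: "\<And>n. f n \<in> borel_measurable borel"
    and B: "\<And>n t. norm (f n t) \<le> B" and lim: "\<And>t. (\<lambda>n. f n t) \<longlonglongrightarrow> g t"
  shows "spectrum_in I g"
  unfolding spectrum_in_def
proof (intro allI impI, elim conjE)
  fix \<theta> assume \<theta>: "integrable lborel \<theta>" and *: "\<forall>\<xi>\<in>I. (LINT t|lborel. \<theta> t * cis (2 * pi * t * \<xi>)) = 0"
  have [measurable]: "g \<in> borel_measurable borel" by (rule borel_measurable_LIMSEQ_metric[OF _ lim]) auto
  have "(\<lambda>n. LINT t|lborel. f n t * \<theta> t) \<longlonglongrightarrow> (LINT t|lborel. g t * \<theta> t)"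
  proof (rule integral_dominated_convergence[where w = "\<lambda>t. B * norm (\<theta> t)"])
    show "AE t in lborel. (\<lambda>n. f n t * \<theta> t) \<longlonglongrightarrow> g t * \<theta> t"
      by (intro AE_I2 tendsto_intros lim)
    show "AE t in lborel. norm (f n t * \<theta> t) \<le> B * norm (\<theta> t)" for n
      using B by (auto intro!: AE_I2 mult_right_mono simp: norm_mult)
  qed (use \<theta> in auto)
  moreover have "(LINT t|lborel. f n t * \<theta> t) = 0" for n
    using assms(1)[of n] \<theta> * unfolding spectrum_in_def by blast
  ultimately show "(LINT t|lborel. g t * \<theta> t) = 0" by (simp add: LIMSEQ_const_iff)
qed

lemma spectrum_in_add:
  assumes "spectrum_in I f" "spectrum_in I g" "f \<in> borel_measurable borel" "g \<in> borel_measurable borel"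
    "\<And>t. norm (f t) \<le> B" "\<And>t. norm (g t) \<le> B"
  shows "spectrum_in I (\<lambda>t. f t + g t)"
  using assms integrable_bounded_mult[of f B] integrable_bounded_mult[of g B]
  by (simp add: spectrum_in_def distrib_right)

text \<open>Translating the test function multiplies its transform by a unimodular factor, so the
  condition of vanishing on \<open>I\<close> is preserved.\<close>

lemma spectrum_in_translate:
  assumes f: "spectrum_in I f"
  shows "spectrum_in I (\<lambda>t. f (t + r))"
  unfolding spectrum_in_def
proof (intro allI impI, elim conjE)
  fix \<theta> assume \<theta>: "integrable lborel \<theta>" and *: "\<forall>\<xi>\<in>I. (LINT t|lborel. \<theta> t * cis (2 * pi * t * \<xi>)) = 0"
  have "integrable lborel (\<lambda>t. \<theta> (t - r))"
    using lborel_integrable_real_affine[OF \<theta>, of 1 "-r"] by (simp add: add.commute)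
  moreover have "(LINT t|lborel. \<theta> (t - r) * cis (2 * pi * t * \<xi>)) = 0" if "\<xi> \<in> I" for \<xi>
  proof -
    have "(LINT t|lborel. \<theta> (t - r) * cis (2 * pi * t * \<xi>))
        = (LINT t|lborel. \<theta> t * cis (2 * pi * (r + t) * \<xi>))"
      using lborel_integral_real_affine[of 1 "\<lambda>t. \<theta> (t - r) * cis (2 * pi * t * \<xi>)" r] by simp
    also have "\<dots> = (LINT t|lborel. cis (2 * pi * r * \<xi>) * (\<theta> t * cis (2 * pi * t * \<xi>)))"
      by (intro Bochner_Integration.integral_cong refl) (simp add: cis_mult algebra_simps mult.left_commute[of "\<theta> _"])
    also have "\<dots> = 0" using * that by simp
    finally show ?thesis .
  qed
  ultimately have "(LINT t|lborel. f t * \<theta> (t - r)) = 0"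
    using f unfolding spectrum_in_def by blast
  then show "(LINT t|lborel. f (t + r) * \<theta> t) = 0"
    using lborel_integral_real_affine[of 1 "\<lambda>t. f t * \<theta> (t - r)" r] by (simp add: add.commute)
qed

lemma spectrum_in_exponential: "\<omega> \<in> I \<Longrightarrow> spectrum_in I (\<lambda>t. cis (2 * pi * t * \<omega>))"
  by (simp add: spectrum_in_def mult.commute)

text \<open>Fubini moves the pairing to the frequency side, where the integrand is \<kappa> times
  the transform of \<theta>: the first factor vanishes off \<open>I\<close>, the second on
  \<open>I\<close>.\<close>

lemma spectrum_in_transform:
  assumes \<kappa>: "integrable lborel \<kappa>" and supp: "\<And>\<xi>. \<xi> \<notin> I \<Longrightarrow> \<kappa> \<xi> = 0"
  shows "spectrum_in I (\<lambda>t. LINT \<xi>|lborel. \<kappa> \<xi> * cis (2 * pi * t * \<xi>))"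
  unfolding spectrum_in_def
proof (intro allI impI, elim conjE)
  fix \<theta> assume \<theta>: "integrable lborel \<theta>" and *: "\<forall>\<xi>\<in>I. (LINT t|lborel. \<theta> t * cis (2 * pi * t * \<xi>)) = 0"
  have int: "integrable (lborel \<Otimes>\<^sub>M lborel) (\<lambda>(\<xi>, t). \<kappa> \<xi> * \<theta> t * cis (2 * pi * t * \<xi>))"
    using integrable_pair_mult[OF \<kappa> \<theta>, of "\<lambda>z. 2 * pi * snd z * fst z"] by simp
  have "(LINT t|lborel. (LINT \<xi>|lborel. \<kappa> \<xi> * cis (2 * pi * t * \<xi>)) * \<theta> t)
      = (LINT t|lborel. LINT \<xi>|lborel. \<kappa> \<xi> * \<theta> t * cis (2 * pi * t * \<xi>))"
    by (subst integral_mult_left_zero[symmetric]) (simp add: mult_ac)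
  also have "\<dots> = (LINT \<xi>|lborel. LINT t|lborel. \<kappa> \<xi> * \<theta> t * cis (2 * pi * t * \<xi>))"
    by (rule lborel_pair.Fubini_integral[OF int])
  also have "\<dots> = (LINT \<xi>|lborel. \<kappa> \<xi> * (LINT t|lborel. \<theta> t * cis (2 * pi * t * \<xi>)))"
    by (simp add: mult.assoc)
  also have "\<dots> = 0"
  proof -
    have "(\<lambda>\<xi>. \<kappa> \<xi> * (LINT t|lborel. \<theta> t * cis (2 * pi * t * \<xi>))) = (\<lambda>\<xi>. 0)"
    proof
      show "\<kappa> \<xi> * (LINT t|lborel. \<theta> t * cis (2 * pi * t * \<xi>)) = 0" for \<xi>
        using * supp by (cases "\<xi> \<in> I") auto
    qed
    then show ?thesis by (simp only: integral_zero)
  qed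
  finally show "(LINT t|lborel. (LINT \<xi>|lborel. \<kappa> \<xi> * cis (2 * pi * t * \<xi>)) * \<theta> t) = 0" .
qed

section \<open>The Fejer kernel and kernels built from it\<close>

text \<open>The Fejer kernel with spectrum in [-R, R]. Taking the integral instead of the closed
  formula as definition covers the removable singularity at 0 and gives continuity by dominated
  convergence.\<close>

definition fejer :: "real \<Rightarrow> real \<Rightarrow> complex" where
  "fejer R t = (LINT \<xi>|lborel. of_real (triangle R \<xi>) * cis (2 * pi * t * \<xi>))"

lemma fejer_formula:
  assumes "0 < R" "t \<noteq> 0"
  shows "fejer R t = of_real ((1 - cos (2 * pi * R * t)) / (2 * pi\<^sup>2 * R * t\<^sup>2))"
  unfolding fejer_def by (rule triangle_transform[OF assms])

lemma fejer_0:
  assumes R: "0 < R"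
  shows "fejer R 0 = of_real R"
proof -
  have 1: "(triangle R has_integral (R - R\<^sup>2 / (2 * R) - (0 - 0\<^sup>2 / (2 * R)))) {0..R}"
  proof (rule fundamental_theorem_of_calculus)
    show "0 \<le> R" using R by simp
    fix x assume "x \<in> {0..R}"
    then show "((\<lambda>x. x - x\<^sup>2 / (2 * R)) has_vector_derivative triangle R x) (at x within {0..R})"
      using R by (auto intro!: derivative_eq_intros simp: triangle_def has_real_derivative_iff_has_vector_derivative[symmetric] field_simps)
  qed
  have eq: "(\<lambda>t. triangle R (- t)) = triangle R" by (simp add: triangle_def fun_eq_iff)
  have 2: "(triangle R has_integral (R - R\<^sup>2 / (2 * R) - (0 - 0\<^sup>2 / (2 * R)))) {-R..0}"
    using has_integral_reflect_real[where f = "triangle R" and a = "-R" and b = 0] 1 by (simp add: eq)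
  have "(triangle R has_integral R) {-R..R}"
    using has_integral_combine[OF _ _ 2 1] R by (simp add: power2_eq_square)
  then have I: "(triangle R has_integral R) UNIV"
    by (rule has_integral_on_superset) (use R in \<open>auto simp: triangle_eq_0\<close>)
  have "(triangle R has_integral (integral\<^sup>L lborel (triangle R))) UNIV"
    by (rule has_integral_integral_lborel[OF integrable_triangle[OF R]])
  then have "integral\<^sup>L lborel (triangle R) = R" using I has_integral_unique by blast
  then show ?thesis by (simp add: fejer_def)
qed

lemma norm_fejer_le:
  assumes R: "0 < R"
  shows "norm (fejer R t) \<le> (R + 1 / (pi\<^sup>2 * R)) / (1 + t\<^sup>2)"
proof -
  have "norm (fejer R t) \<le> (LINT \<xi>|lborel. triangle R \<xi>)"
    unfolding fejer_def
    by (rule Bochner_Integration.integral_norm_bound_integral)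
      (use integrable_triangle_mult_cis[OF R] integrable_triangle[OF R] triangle_nonneg[of R] in \<open>auto simp: norm_mult\<close>)
  also have "of_real (LINT \<xi>|lborel. triangle R \<xi>) = fejer R 0" by (simp add: fejer_def)
  then have "(LINT \<xi>|lborel. triangle R \<xi>) = R" using fejer_0[OF R] by (simp add: of_real_eq_iff)
  finally have 1: "norm (fejer R t) \<le> R" .
  have 2: "t\<^sup>2 * norm (fejer R t) \<le> 1 / (pi\<^sup>2 * R)"
  proof (cases "t = 0")
    case True then show ?thesis using R by simp
  next
    case False
    have "norm (fejer R t) \<le> 1 / (pi\<^sup>2 * R * t\<^sup>2)"
      unfolding fejer_formula[OF R False] norm_of_real using fejer_nonneg_le[OF R False] by (simp only: abs_of_nonneg)
    then have "t\<^sup>2 * norm (fejer R t) \<le> t\<^sup>2 * (1 / (pi\<^sup>2 * R * t\<^sup>2))" by (rule mult_left_mono) simp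
    then show ?thesis using False by simp
  qed
  have "(1 + t\<^sup>2) * norm (fejer R t) \<le> R + 1 / (pi\<^sup>2 * R)" using 1 2 by (simp add: distrib_right)
  moreover have "0 < 1 + t\<^sup>2" by (simp add: add_pos_nonneg)
  ultimately show ?thesis by (simp add: field_simps)
qed

lemma continuous_fejer:
  assumes R: "0 < R"
  shows "continuous_on UNIV (fejer R)"
  unfolding continuous_on_sequentially
proof (intro ballI allI impI, elim conjE)
  fix x :: "nat \<Rightarrow> real" and a :: real
  assume x: "x \<longlonglongrightarrow> a"
  have "(\<lambda>n. fejer R (x n)) \<longlonglongrightarrow> fejer R a"
    unfolding fejer_def
  proof (rule integral_dominated_convergence[where w = "triangle R"])
    show "AE \<xi> in lborel. (\<lambda>n. of_real (triangle R \<xi>) * cis (2 * pi * x n * \<xi>)) \<longlonglongrightarrow> of_real (triangle R \<xi>) * cis (2 * pi * a * \<xi>)"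
      by (intro AE_I2 tendsto_intros tendsto_cis x)
  qed (use integrable_triangle[OF R] triangle_nonneg[of R] in \<open>auto simp: norm_mult\<close>)
  then show "(fejer R \<circ> x) \<longlonglongrightarrow> fejer R a" by (simp add: o_def)
qed

lemma fejer_measurable [measurable]: "0 < R \<Longrightarrow> fejer R \<in> borel_measurable borel"
  by (intro borel_measurable_continuous_onI continuous_fejer)

lemma integrable_fejer: "0 < R \<Longrightarrow> integrable lborel (fejer R)"
  by (rule integrable_decay[OF fejer_measurable norm_fejer_le])

text \<open>The kernel is real and nonnegative, so a vanishing integral would force it to vanish
  almost everywhere; but its zeros are nonzero points with \<open>R * t\<close> an integer, and
  there are none in \<open>(0, 1/R)\<close>.\<close>

lemma integral_fejer_nonzero:
  assumes R: "0 < R"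
  shows "(LINT t|lborel. fejer R t) \<noteq> 0"
proof
  define g where "g t = Re (fejer R t)" for t
  have g0: "0 \<le> g t" for t
    using fejer_nonneg_le(1)[OF R, of t] R by (cases "t = 0") (auto simp: g_def fejer_0 fejer_formula)
  have int: "integrable lborel g" using integrable_fejer[OF R] by (simp add: g_def[abs_def])
  assume "(LINT t|lborel. fejer R t) = 0"
  then have "(LINT t|lborel. g t) = 0" using integrable_fejer[OF R] by (simp add: g_def)
  then have "AE t in lborel. g t = 0"
    using integral_nonneg_eq_0_iff_AE[OF int] g0 by simp
  then have "AE t in lborel. t \<notin> {0<..<1/R}"
  proof (rule AE_mp, intro AE_I2 impI notI)
    fix t assume z: "g t = 0" and t: "t \<in> {0<..<1/R}"
    have "cos (2 * pi * R * t) = 1" using z t R by (auto simp: g_def fejer_formula)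
    then obtain n :: int where n: "2 * pi * R * t = of_int n * (2 * pi)"
      using cos_one_2pi_int by auto
    then have "R * t = of_int n" by simp
    moreover have "0 < R * t" "R * t < 1" using t R by (auto simp: field_simps)
    ultimately show False by simp
  qed
  then have "emeasure lborel {0<..<1/R} = 0"
    by (subst (asm) AE_iff_measurable[OF _ refl]) (auto simp: greaterThanLessThan_def greaterThan_def lessThan_def Int_def)
  then show False using R by simp
qed

text \<open>The witness is the Fejer kernel of radius r / 2. Frequencies with modulus at least
  \<open>r\<close> keep distance r / 2 from the support of its transform, the gap which the
  inversion lemma requires.\<close>

lemma spectral_cutoff:
  assumes r: "0 < r"
  obtains \<theta> where "integrable lborel \<theta>" "(LINT t|lborel. \<theta> t) \<noteq> 0"
    "\<And>\<eta>. r \<le> \<bar>\<eta>\<bar> \<Longrightarrow> (LINT t|lborel. \<theta> t * cis (2 * pi * t * \<eta>)) = 0"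
proof
  have r2: "0 < r / 2" using r by simp
  have eq: "fejer (r / 2) t = (LINT \<eta>|lborel. cis (- (2 * pi * t * \<eta>)) * of_real (triangle (r / 2) \<eta>))" for t
  proof -
    have "(LINT \<eta>|lborel. cis (- (2 * pi * t * \<eta>)) * of_real (triangle (r / 2) \<eta>))
       = (LINT \<eta>|lborel. cis (2 * pi * t * \<eta>) * of_real (triangle (r / 2) \<eta>))"
      using lborel_integral_real_affine[of "-1" "\<lambda>\<eta>. cis (2 * pi * t * \<eta>) * complex_of_real (triangle (r / 2) \<eta>)" 0]
      by (simp add: triangle_def)
    then show ?thesis by (simp add: fejer_def mult.commute)
  qed
  show "integrable lborel (fejer (r / 2))" by (rule integrable_fejer[OF r2])
  show "(LINT t|lborel. fejer (r / 2) t) \<noteq> 0" by (rule integral_fejer_nonzero[OF r2])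
  fix \<eta> assume \<eta>: "r \<le> \<bar>\<eta>\<bar>"
  show "(LINT t|lborel. fejer (r / 2) t * cis (2 * pi * t * \<eta>)) = 0"
    unfolding eq
  proof (rule fourier_inversion_off_support[OF _ _ r2])
    show "integrable lborel (\<lambda>\<xi>. complex_of_real (triangle (r / 2) \<xi>))"
      by (intro integrable_of_real integrable_triangle r2)
    show "complex_integrable lborel (\<lambda>t. CLBINT \<eta>. cis (- (2 * pi * t * \<eta>)) * complex_of_real (triangle (r / 2) \<eta>))"
      using integrable_fejer[OF r2] unfolding eq[abs_def] .
    show "complex_of_real (triangle (r / 2) \<xi>) = 0" if "\<bar>\<xi> - \<eta>\<bar> < r / 2" for \<xi>
    proof -
      have "r / 2 \<le> \<bar>\<xi>\<bar>" using that \<eta> by linarith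
      then show ?thesis using triangle_eq_0[OF r2] by simp
    qed
  qed
qed

text \<open>A de la Vallee-Poussin kernel: A fejer(A) - B fejer(B) equals (cos (2 pi B t) - cos (2
  pi A t)) / (2 pi^2 t^2) for nonzero t, and its transform is a trapezoid supported in [-A, A]. With
  A + B = \<rho> the two cosines agree at every point of the lattice (1/\<rho>)\<int>, so the kernel
  vanishes there except at 0. Modulation by the midpoint \<beta> moves the spectrum into
  [a, b].\<close>

lemma interpolation_kernel:
  assumes "0 < \<rho>" "\<rho> < b - a"
  obtains \<phi> C where "continuous_on UNIV \<phi>" "\<phi> 0 = 1" "\<And>l::int. l \<noteq> 0 \<Longrightarrow> \<phi> (of_int l / \<rho>) = 0"
    "\<And>t. norm (\<phi> t) \<le> C / (1 + t\<^sup>2)" "spectrum_in {a..b} \<phi>"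
proof -
  define \<beta> where "\<beta> = (a + b) / 2"
  \<comment> \<open>The requirements are A \<le> (b - a) / 2 and \<rho> / 2 < A < \<rho>, the latter
    so that 0 < B < A. The bound 3 \<rho> / 4 keeps \<open>B\<close> positive; (b - a) / 2 exceeds
    \<rho> / 2 by hypothesis.\<close>
  define A where "A = min ((b - a) / 2) (3 * \<rho> / 4)"
  define B where "B = \<rho> - A"
  have AB: "0 < A" "0 < B" "B < A" "A + B = \<rho>" "A \<le> (b - a) / 2"
    using assms by (auto simp: A_def B_def min_def)
  \<comment> \<open>The value at 0 of the unnormalised kernel, since \<open>fejer R 0 = R\<close>;
    it is nonzero because \<open>B < A\<close>.\<close>
  define E where "E = A\<^sup>2 - B\<^sup>2"
  have E: "E \<noteq> 0" using AB by (simp add: E_def power2_eq_iff)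
  define \<phi> where "\<phi> t = cis (2 * pi * t * \<beta>) * ((of_real A * fejer A t - of_real B * fejer B t) / of_real E)" for t
  define K where "K R = R + 1 / (pi\<^sup>2 * R)" for R :: real
  define C where "C = (A * K A + B * K B) / \<bar>E\<bar>"
  define \<kappa> where "\<kappa> \<xi> = (of_real (A * triangle A (\<xi> - \<beta>) - B * triangle B (\<xi> - \<beta>)) / of_real E :: complex)" for \<xi>
  show ?thesis
  proof (rule that[of \<phi> C])
    show "continuous_on UNIV \<phi>"
      unfolding \<phi>_def by (intro continuous_intros continuous_fejer AB) (use E in auto)
    show "\<phi> 0 = 1"
    proof -
      have "\<phi> 0 = of_real (A\<^sup>2 - B\<^sup>2) / of_real E"
        using AB by (simp add: \<phi>_def fejer_0 power2_eq_square)
      then show ?thesis using E by (simp only: E_def[symmetric] divide_self_if of_real_eq_0_iff if_False)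
    qed
    show "\<phi> (of_int l / \<rho>) = 0" if "l \<noteq> 0" for l :: int
    proof -
      define t where "t = of_int l / \<rho>"
      have t: "t \<noteq> 0" using that assms by (simp add: t_def)
      have "2 * pi * B * t = of_int l * (2 * pi) - 2 * pi * A * t"
        using assms by (simp add: t_def B_def field_simps)
      then have "cos (2 * pi * B * t) = cos (2 * pi * A * t)"
        by (simp add: cos_diff) (metis cos_int_2pin sin_int_2pin mult.commute mult_1 mult_zero_left add.right_neutral)
      then have "of_real A * fejer A t - of_real B * fejer B t = 0"
        using AB t by (simp add: fejer_formula)
      then show ?thesis by (simp add: \<phi>_def t_def)
    qed
    show "norm (\<phi> t) \<le> C / (1 + t\<^sup>2)" for t
    proof -
      have "norm (of_real A * fejer A t - of_real B * fejer B t) \<le> A * norm (fejer A t) + B * norm (fejer B t)"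
        using norm_triangle_ineq4[of "of_real A * fejer A t" "of_real B * fejer B t"] AB by (simp add: norm_mult)
      also have "\<dots> \<le> A * (K A / (1 + t\<^sup>2)) + B * (K B / (1 + t\<^sup>2))"
        unfolding K_def using AB by (intro add_mono mult_left_mono norm_fejer_le) auto
      finally have "norm (of_real A * fejer A t - of_real B * fejer B t) \<le> (A * K A + B * K B) / (1 + t\<^sup>2)"
        by (simp add: add_divide_distrib)
      then have "norm (of_real A * fejer A t - of_real B * fejer B t) / \<bar>E\<bar> \<le> (A * K A + B * K B) / (1 + t\<^sup>2) / \<bar>E\<bar>"
        by (rule divide_right_mono) simp
      moreover have "norm (\<phi> t) = norm (of_real A * fejer A t - of_real B * fejer B t) / \<bar>E\<bar>"
        unfolding \<phi>_def norm_mult norm_divide norm_of_real norm_cis by simp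
      ultimately show ?thesis by (simp add: C_def mult.commute)
    qed
    have i: "integrable lborel (\<lambda>\<xi>. complex_of_real (R * triangle R \<xi>) * cis (2 * pi * t * \<xi>))" if "0 < R" for R t
      by (intro integrable_cis_mult integrable_of_real integrable_mult_right integrable_triangle that) auto
    have s: "integrable lborel (\<lambda>\<xi>. triangle R (\<xi> - \<beta>))" if "0 < R" for R
      using lborel_integrable_real_affine[OF integrable_triangle[OF that], of 1 "- \<beta>"] by (simp add: add.commute)
    have \<kappa>: "integrable lborel \<kappa>"
      unfolding \<kappa>_def[abs_def]
      by (intro integrable_divide integrable_of_real Bochner_Integration.integrable_diff integrable_mult_right s AB)
    have "(LINT \<xi>|lborel. \<kappa> \<xi> * cis (2 * pi * t * \<xi>)) = \<phi> t" for t
    proof -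
      have "(LINT \<xi>|lborel. \<kappa> \<xi> * cis (2 * pi * t * \<xi>)) = (LINT \<xi>|lborel. \<kappa> (\<beta> + \<xi>) * cis (2 * pi * t * (\<beta> + \<xi>)))"
        using lborel_integral_real_affine[of 1 "\<lambda>\<xi>. \<kappa> \<xi> * cis (2 * pi * t * \<xi>)" \<beta>] by simp
      also have "\<dots> = (LINT \<xi>|lborel. (cis (2 * pi * t * \<beta>) / of_real E) *
          (of_real (A * triangle A \<xi>) * cis (2 * pi * t * \<xi>) - of_real (B * triangle B \<xi>) * cis (2 * pi * t * \<xi>)))"
      proof (intro Bochner_Integration.integral_cong refl)
        fix \<xi>
        have "cis (2 * pi * t * (\<beta> + \<xi>)) = cis (2 * pi * t * \<beta>) * cis (2 * pi * t * \<xi>)"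
          by (simp add: cis_mult distrib_left)
        then show "\<kappa> (\<beta> + \<xi>) * cis (2 * pi * t * (\<beta> + \<xi>)) = (cis (2 * pi * t * \<beta>) / of_real E) *
          (of_real (A * triangle A \<xi>) * cis (2 * pi * t * \<xi>) - of_real (B * triangle B \<xi>) * cis (2 * pi * t * \<xi>))"
          unfolding \<kappa>_def by (simp add: left_diff_distrib diff_divide_distrib algebra_simps)
      qed
      also have "\<dots> = (cis (2 * pi * t * \<beta>) / of_real E) *
          ((LINT \<xi>|lborel. of_real (A * triangle A \<xi>) * cis (2 * pi * t * \<xi>)) - (LINT \<xi>|lborel. of_real (B * triangle B \<xi>) * cis (2 * pi * t * \<xi>)))"
        by (subst integral_mult_right_zero, subst Bochner_Integration.integral_diff) (use i AB in auto)
      also have "\<dots> = \<phi> t"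
        by (simp add: \<phi>_def fejer_def mult.assoc integral_mult_right_zero)
      finally show ?thesis .
    qed
    moreover have "\<kappa> \<xi> = 0" if "\<xi> \<notin> {a..b}" for \<xi>
    proof -
      have "A \<le> \<bar>\<xi> - \<beta>\<bar>" using that AB by (auto simp: \<beta>_def abs_if field_simps)
      then show ?thesis using AB by (simp add: \<kappa>_def triangle_eq_0)
    qed
    ultimately show "spectrum_in {a..b} \<phi>"
      using spectrum_in_transform[OF \<kappa>, of "{a..b}"] by simp
  qed
qed

section \<open>Separation by vectors in general position\<close>

text \<open>Move from \<open>q\<close> along the moment curve (s, s^2, ..., s^n). Along it each
  linear form becomes a nonzero polynomial in \<open>s\<close>, so only finitely many
  \<open>s\<close> are bad and arbitrarily small good ones exist.\<close>

lemma avoid_hyperplanes: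
  fixes q :: "nat \<Rightarrow> real"
  assumes W: "finite W" "\<And>w. w \<in> W \<Longrightarrow> \<exists>i<n. w i \<noteq> 0" and e: "0 < e"
  shows "\<exists>z. (\<forall>i<n. \<bar>z i - q i\<bar> < e) \<and> (\<forall>w\<in>W. (\<Sum>i<n. w i * z i) \<noteq> 0)"
proof -
  define Z where "Z w = {s::real. (\<Sum>i<n. w i * (q i + s ^ Suc i)) = 0}" for w
  have "finite (Z w)" if w: "w \<in> W" for w
  proof -
    \<comment> \<open>Coefficients of that polynomial: the constant term is the value of the form at
      \<open>q\<close>, and the weight \<open>w i\<close> sits at degree
      \<open>i + 1\<close>.\<close>
    define c where "c j = (if j = 0 then \<Sum>i<n. w i * q i else w (j - 1))" for j
    obtain i where i: "i < n" "w i \<noteq> 0" using W(2)[OF w] by blast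
    have "\<exists>j\<le>n. c j \<noteq> 0" using i by (intro exI[of _ "Suc i"]) (auto simp: c_def)
    then have "finite {s. (\<Sum>j\<le>n. c j * s ^ j) = 0}" using polyfun_finite_roots by blast
    moreover have "(\<Sum>j\<le>n. c j * s ^ j) = (\<Sum>i<n. w i * (q i + s ^ Suc i))" for s
    proof -
      have "{..n} = insert 0 (Suc ` {..<n})"
        using less_Suc_eq_0_disj by (auto simp: image_iff less_Suc_eq_le[symmetric])
      then have "(\<Sum>j\<le>n. c j * s ^ j) = c 0 + (\<Sum>i<n. c (Suc i) * s ^ Suc i)"
        by (simp add: sum.reindex)
      then show ?thesis by (simp add: c_def sum.distrib distrib_left)
    qed
    ultimately show ?thesis by (simp add: Z_def)
  qed
  then have "finite (\<Union>w\<in>W. Z w)" using W by blast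
  moreover have "infinite {0<..<min e 1}" using e by simp
  ultimately obtain s where s: "s \<in> {0<..<min e 1}" "s \<notin> (\<Union>w\<in>W. Z w)"
    by (meson finite_subset subsetI)
  have "\<bar>s ^ Suc i\<bar> < e" for i
  proof -
    have "s ^ Suc i \<le> s" using s power_decreasing[of 1 "Suc i" s] by simp
    moreover have "0 \<le> s ^ Suc i" "s < e" using s by auto
    ultimately show ?thesis by linarith
  qed
  with s show ?thesis
    by (intro exI[of _ "\<lambda>i. q i + s ^ Suc i"]) (auto simp: Z_def)
qed

text \<open>The second clause says that any at most \<open>M\<close> of the \<open>n\<close> vectors
  in R^M are linearly independent. Induction on the number of coordinates: a relation with M + 1
  nonzero weights is determined up to a factor by its support once the first \<open>M\<close>
  coordinates are independent in this sense, so the new coordinate has to avoid only finitely many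
  hyperplanes.\<close>

lemma generic_vectors:
  fixes q :: "nat \<Rightarrow> nat \<Rightarrow> real"
  assumes e: "0 < e"
  shows "\<exists>p. (\<forall>i<n. \<forall>k<M. \<bar>p i k - q i k\<bar> < e) \<and>
    (\<forall>w. card {i. i < n \<and> w i \<noteq> 0} \<le> M \<and> (\<forall>k<M. (\<Sum>i<n. w i * p i k) = 0) \<longrightarrow> (\<forall>i<n. w i = 0))"
proof (induction M)
  case 0 then show ?case by (auto simp: card_eq_0_iff)
next
  case (Suc M)
  then obtain p where p: "\<And>i k. i < n \<Longrightarrow> k < M \<Longrightarrow> \<bar>p i k - q i k\<bar> < e"
    and ker: "\<And>w. card {i. i < n \<and> w i \<noteq> 0} \<le> M \<Longrightarrow> (\<forall>k<M. (\<Sum>i<n. w i * p i k) = 0) \<Longrightarrow> \<forall>i<n. w i = 0"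
    by blast
  define P where "P J w \<longleftrightarrow> (\<exists>i<n. w i \<noteq> 0) \<and> {i. i < n \<and> w i \<noteq> 0} \<subseteq> J \<and> (\<forall>k<M. (\<Sum>i<n. w i * p i k) = 0)"
    for J and w :: "nat \<Rightarrow> real"
  \<comment> \<open>One representative nonzero relation for each index set that carries one;
    finitely many conditions on the new coordinate.\<close>
  define W where "W = (\<lambda>J. SOME w. P J w) ` {J. J \<subseteq> {..<n} \<and> (\<exists>w. P J w)}"
  have "finite W" by (simp add: W_def)
  moreover have "\<exists>i<n. w i \<noteq> 0" if w: "w \<in> W" for w
  proof -
    obtain J where "w = (SOME w. P J w)" "\<exists>w. P J w" using w unfolding W_def image_iff mem_Collect_eq by blast
    then have "P J w" using someI_ex[of "P J"] by simp
    then show ?thesis by (simp add: P_def)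
  qed
  ultimately obtain z where z: "\<And>i. i < n \<Longrightarrow> \<bar>z i - q i M\<bar> < e"
    and zW: "\<And>w. w \<in> W \<Longrightarrow> (\<Sum>i<n. w i * z i) \<noteq> 0"
    using avoid_hyperplanes[of W n e "\<lambda>i. q i M"] e by blast
  define p' where "p' i k = (if k = M then z i else p i k)" for i k
  have "\<forall>i<n. w i = 0" if card: "card {i. i < n \<and> w i \<noteq> 0} \<le> Suc M"
    and w: "\<forall>k<Suc M. (\<Sum>i<n. w i * p' i k) = 0" for w
  proof (rule ccontr)
    assume nz: "\<not> (\<forall>i<n. w i = 0)"
    define J where "J = {i. i < n \<and> w i \<noteq> 0}"
    have kw: "(\<Sum>i<n. w i * p i k) = 0" if "k < M" for k
      using w[rule_format, of k] that by (simp add: p'_def)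
    have zw: "(\<Sum>i<n. w i * z i) = 0" using w[rule_format, of M] by (simp add: p'_def)
    have "P J w" using nz kw by (auto simp: P_def J_def)
    define v where "v = (SOME w. P J w)"
    have v: "P J v" unfolding v_def by (rule someI[of "P J", OF \<open>P J w\<close>])
    have "v \<in> W" unfolding W_def v_def using \<open>P J w\<close> by (auto simp: J_def)
    obtain i0 where i0: "i0 < n" "v i0 \<noteq> 0" using v by (auto simp: P_def)
    then have "i0 \<in> J" using v by (auto simp: P_def)
    define c where "c = w i0 / v i0"
    have c: "c \<noteq> 0" using i0 \<open>i0 \<in> J\<close> by (simp add: c_def J_def)
    \<comment> \<open>Subtracting the multiple of \<open>v\<close> that kills the entry
      \<open>i0\<close> leaves at most \<open>M\<close> nonzero weights, so the induction hypothesis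
      yields \<open>w = c v\<close>. Then \<open>z\<close> would annihilate the representative
      \<open>v\<close>.\<close>
    define w' where "w' i = w i - c * v i" for i
    have "{i. i < n \<and> w' i \<noteq> 0} \<subseteq> J - {i0}"
      using v i0 by (auto simp: w'_def c_def P_def J_def)
    then have "card {i. i < n \<and> w' i \<noteq> 0} \<le> card (J - {i0})"
      by (intro card_mono) (auto simp: J_def)
    also have "\<dots> \<le> M" using card \<open>i0 \<in> J\<close> by (simp add: J_def)
    finally have "\<forall>i<n. w' i = 0"
    proof (rule ker)
      show "\<forall>k<M. (\<Sum>i<n. w' i * p i k) = 0"
        using kw v by (simp add: w'_def left_diff_distrib sum_subtractf P_def mult.assoc flip: sum_distrib_left)
    qed
    then have "(\<Sum>i<n. w i * z i) = (\<Sum>i<n. c * (v i * z i))"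
      by (intro sum.cong) (auto simp: w'_def)
    also have "\<dots> = c * (\<Sum>i<n. v i * z i)" by (simp add: sum_distrib_left)
    finally show False using zw zW[OF \<open>v \<in> W\<close>] c by simp
  qed
  moreover have "\<bar>p' i k - q i k\<bar> < e" if "i < n" "k < Suc M" for i k
    using p[of i k] z[of i] that by (cases "k = M") (simp_all add: p'_def)
  ultimately show ?case by blast
qed

text \<open>Real weights make a complex relation the same as two real ones, so \<open>m\<close>
  complex coordinates tolerate supports of size \<open>2 * m\<close>.\<close>

lemma generic_complex_vectors:
  fixes q :: "nat \<Rightarrow> nat \<Rightarrow> complex"
  assumes e: "0 < e"
  obtains p where "\<And>i k. i < n \<Longrightarrow> k < m \<Longrightarrow> norm (p i k - q i k) < e"
    and "\<And>w i. card {i. i < n \<and> w i \<noteq> 0} \<le> 2 * m \<Longrightarrow> (\<And>k. k < m \<Longrightarrow> (\<Sum>i<n. of_real (w i) * p i k) = 0) \<Longrightarrow> i < n \<Longrightarrow> w i = 0"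
proof -
  \<comment> \<open>Even coordinates hold real parts, odd ones imaginary parts; precision e / 2 for
    each gives \<open>e\<close> for the modulus.\<close>
  define Q where "Q i j = (if even j then Re (q i (j div 2)) else Im (q i (j div 2)))" for i j
  obtain P where P: "\<And>i k. i < n \<Longrightarrow> k < 2 * m \<Longrightarrow> \<bar>P i k - Q i k\<bar> < e / 2"
    and ker: "\<And>w. card {i. i < n \<and> w i \<noteq> 0} \<le> 2 * m \<Longrightarrow> (\<forall>k<2 * m. (\<Sum>i<n. w i * P i k) = 0) \<Longrightarrow> \<forall>i<n. w i = 0"
    using generic_vectors[OF half_gt_zero[OF e], of n "2 * m" Q] by blast
  define p where "p i k = Complex (P i (2 * k)) (P i (2 * k + 1))" for i k
  show ?thesis
  proof (rule that[of p])
    fix i k assume ik: "i < n" "k < m"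
    have "norm (p i k - q i k) \<le> \<bar>Re (p i k - q i k)\<bar> + \<bar>Im (p i k - q i k)\<bar>" by (rule cmod_le)
    also have "\<dots> < e / 2 + e / 2"
      using P[of i "2 * k"] P[of i "2 * k + 1"] ik by (intro add_strict_mono) (auto simp: p_def Q_def)
    finally show "norm (p i k - q i k) < e" by simp
  next
    fix w :: "nat \<Rightarrow> real" and i
    assume c: "card {i. i < n \<and> w i \<noteq> 0} \<le> 2 * m" and z: "\<And>k. k < m \<Longrightarrow> (\<Sum>i<n. of_real (w i) * p i k) = 0"
      and i: "i < n"
    have "(\<Sum>i<n. w i * P i j) = 0" if "j < 2 * m" for j
    proof -
      have k: "j div 2 < m" using that by auto
      have "Re (\<Sum>i<n. of_real (w i) * p i (j div 2)) = 0" "Im (\<Sum>i<n. of_real (w i) * p i (j div 2)) = 0"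
        using z[OF k] by auto
      then have "(\<Sum>i<n. w i * P i (2 * (j div 2))) = 0" "(\<Sum>i<n. w i * P i (2 * (j div 2) + 1)) = 0"
        by (simp_all add: p_def)
      then show ?thesis by (cases "even j") (auto elim!: evenE oddE)
    qed
    then show "w i = 0" using ker[OF c] i by blast
  qed
qed

section \<open>Separating maps from the nerve of a cover\<close>

lemma partition_of_unity_on:
  fixes S :: "'a::metric_space set" and U :: "nat \<Rightarrow> 'a set"
  assumes U: "\<And>i. i < n \<Longrightarrow> open (U i)" and cov: "S \<subseteq> (\<Union>i<n. U i)"
  obtains h :: "nat \<Rightarrow> 'a \<Rightarrow> real" where "\<And>i. continuous_on S (h i)" "\<And>i x. 0 \<le> h i x"
    "\<And>i x. i < n \<Longrightarrow> h i x \<noteq> 0 \<Longrightarrow> x \<in> U i" "\<And>x. x \<in> S \<Longrightarrow> (\<Sum>i<n. h i x) = 1"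
proof -
  \<comment> \<open>\<open>infdist\<close> to the empty set is 0, which would be the wrong value for
    a cover member equal to the whole space; hence the value 1.\<close>
  define f where "f i x = (if - U i = {} then 1 else infdist x (- U i))" for i x
  have f: "0 \<le> f i x" for i x by (simp add: f_def infdist_nonneg)
  have pos: "0 < f i x \<longleftrightarrow> x \<in> U i" if "i < n" for i x
  proof (cases "- U i = {}")
    case True then show ?thesis by (auto simp: f_def)
  next
    case False
    have "x \<in> - U i \<longleftrightarrow> infdist x (- U i) = 0"
      using U[OF that] False by (intro in_closed_iff_infdist_zero) (auto simp: closed_def)
    then show ?thesis using False infdist_nonneg[of x "- U i"] by (auto simp: f_def)
  qed
  have cf: "continuous_on S (f i)" for i
    unfolding f_def by (cases "- U i = {}") (auto intro!: continuous_intros)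
  have sp: "0 < (\<Sum>i<n. f i x)" if x: "x \<in> S" for x
  proof -
    obtain i where "i < n" "x \<in> U i" using subsetD[OF cov x] by auto
    then show ?thesis using f pos by (intro sum_pos2[of _ i]) auto
  qed
  show ?thesis
  proof (rule that[of "\<lambda>i x. f i x / (\<Sum>j<n. f j x)"])
    show "continuous_on S (\<lambda>x. f i x / (\<Sum>j<n. f j x))" for i
      using sp by (intro continuous_intros cf) (metis less_irrefl)
    show "0 \<le> f i x / (\<Sum>j<n. f j x)" for i x using f by (simp add: sum_nonneg)
    show "x \<in> U i" if "i < n" "f i x / (\<Sum>j<n. f j x) \<noteq> 0" for i x
      using that pos[of i x] f[of i x] by (auto simp: less_le)
    show "(\<Sum>i<n. f i x / (\<Sum>j<n. f j x)) = 1" if "x \<in> S" for x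
      using sp[OF that] by (simp flip: sum_divide_distrib)
  qed
qed

text \<open>A difference of two points of the nerve has at most \<open>2 m\<close> nonzero barycentric
  coordinates, so \<open>2 m\<close> real coordinates in general position separate them.\<close>

lemma separating_approximation:
  fixes S :: "'a::metric_space set" and U :: "nat \<Rightarrow> 'a set" and u :: "nat \<Rightarrow> 'a \<Rightarrow> complex"
  assumes U: "\<And>i. i < n \<Longrightarrow> open (U i)" and cov: "S \<subseteq> (\<Union>i<n. U i)"
    and ord: "\<And>x. x \<in> S \<Longrightarrow> card {i. i < n \<and> x \<in> U i} \<le> m"
    and osc: "\<And>i k x y. i < n \<Longrightarrow> k < m \<Longrightarrow> x \<in> S \<inter> U i \<Longrightarrow> y \<in> S \<inter> U i \<Longrightarrow> norm (u k x - u k y) < e"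
    and e: "0 < e"
  obtains v :: "nat \<Rightarrow> 'a \<Rightarrow> complex" where "\<And>k. continuous_on S (v k)"
    "\<And>k x. k < m \<Longrightarrow> x \<in> S \<Longrightarrow> norm (v k x - u k x) \<le> 2 * e"
    "\<And>x y. x \<in> S \<Longrightarrow> y \<in> S \<Longrightarrow> (\<And>k. k < m \<Longrightarrow> v k x = v k y) \<Longrightarrow> \<exists>i<n. x \<in> U i \<and> y \<in> U i"
proof -
  obtain h :: "nat \<Rightarrow> 'a \<Rightarrow> real" where ch: "\<And>i. continuous_on S (h i)" and h0: "\<And>i x. 0 \<le> h i x"
    and hU: "\<And>i x. i < n \<Longrightarrow> h i x \<noteq> 0 \<Longrightarrow> x \<in> U i" and h1: "\<And>x. x \<in> S \<Longrightarrow> (\<Sum>i<n. h i x) = 1"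
    using partition_of_unity_on[OF U cov] by blast
  \<comment> \<open>A sample point of the member \<open>U i\<close> in \<open>S\<close>. If there is
    none the choice is arbitrary and harmless, because \<open>h i\<close> then vanishes on
    \<open>S\<close>.\<close>
  define c where "c i = (SOME x. x \<in> S \<inter> U i)" for i
  have c: "c i \<in> S \<inter> U i" if "x \<in> S \<inter> U i" for i x
    unfolding c_def by (rule someI[of "\<lambda>x. x \<in> S \<inter> U i", OF that])
  obtain p :: "nat \<Rightarrow> nat \<Rightarrow> complex" where p: "\<And>i k. i < n \<Longrightarrow> k < m \<Longrightarrow> norm (p i k - u k (c i)) < e"
    and ker: "\<And>w i. card {i. i < n \<and> w i \<noteq> 0} \<le> 2 * m \<Longrightarrow> (\<And>k. k < m \<Longrightarrow> (\<Sum>i<n. of_real (w i) * p i k) = 0) \<Longrightarrow> i < n \<Longrightarrow> w i = 0"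
    using generic_complex_vectors[OF e, of n m "\<lambda>i k. u k (c i)"] by blast
  define v where "v k x = (\<Sum>i<n. of_real (h i x) * p i k)" for k x
  show ?thesis
  proof (rule that[of v])
    show "continuous_on S (v k)" for k unfolding v_def by (intro continuous_intros ch)
    show "norm (v k x - u k x) \<le> 2 * e" if k: "k < m" and x: "x \<in> S" for k x
    proof -
      have "u k x = (\<Sum>i<n. of_real (h i x) * u k x)"
        using h1[OF x] by (simp flip: sum_distrib_right of_real_sum)
      then have "v k x - u k x = (\<Sum>i<n. of_real (h i x) * (p i k - u k x))"
        unfolding v_def by (simp add: right_diff_distrib sum_subtractf)
      also have "norm \<dots> \<le> (\<Sum>i<n. h i x * (2 * e))"
      proof (rule sum_norm_le)
        fix i assume "i \<in> {..<n}"
        then have i: "i < n" by simp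
        show "norm (of_real (h i x) * (p i k - u k x)) \<le> h i x * (2 * e)"
        proof (cases "h i x = 0")
          case False
          then have xi: "x \<in> S \<inter> U i" using hU i x by auto
          \<comment> \<open>One \<open>e\<close> for moving the vertex values into general position,
            one for the oscillation of \<open>u k\<close> on \<open>U i\<close>.\<close>
          have "norm (p i k - u k x) \<le> norm (p i k - u k (c i)) + norm (u k (c i) - u k x)"
            using norm_triangle_ineq[of "p i k - u k (c i)" "u k (c i) - u k x"] by simp
          also have "\<dots> \<le> 2 * e" using p[OF i k] osc[OF i k c[OF xi] xi] by simp
          finally show ?thesis using h0[of i x] by (simp add: norm_mult mult_left_mono)
        qed simp
      qed
      also have "\<dots> = 2 * e" using h1[OF x] by (simp flip: sum_distrib_right)
      finally show ?thesis .
    qed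
    show "\<exists>i<n. x \<in> U i \<and> y \<in> U i" if x: "x \<in> S" and y: "y \<in> S" and eq: "\<And>k. k < m \<Longrightarrow> v k x = v k y" for x y
    proof -
      define w where "w i = h i x - h i y" for i
      have "card {i. i < n \<and> w i \<noteq> 0} \<le> card ({i. i < n \<and> x \<in> U i} \<union> {i. i < n \<and> y \<in> U i})"
        using hU by (intro card_mono) (auto simp: w_def, metis)
      also have "\<dots> \<le> 2 * m"
        using card_Un_le[of "{i. i < n \<and> x \<in> U i}" "{i. i < n \<and> y \<in> U i}"] ord[OF x] ord[OF y] by simp
      finally have "w i = 0" if "i < n" for i
        by (rule ker[OF _ _ that]) (use eq in \<open>simp add: v_def w_def left_diff_distrib sum_subtractf\<close>)
      \<comment> \<open>All barycentric coordinates of \<open>x\<close> and \<open>y\<close> agree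
        and those of \<open>x\<close> sum to 1, so some coordinate is nonzero at both points and
        both lie in that member.\<close>
      moreover obtain i where "i < n" "h i x \<noteq> 0"
        using h1[OF x] by (metis (no_types, lifting) lessThan_iff sum.neutral zero_neq_one)
      ultimately show ?thesis using hU by (metis eq_iff_diff_eq_0 w_def)
    qed
  qed
qed

section \<open>Interpolation and perturbation\<close>

lemma lattice_summable:
  fixes K \<rho> :: real
  assumes "0 < \<rho>"
  shows "(\<lambda>l::int. K / (1 + (of_int l / \<rho>)\<^sup>2)) summable_on UNIV"
proof -
  define f where "f l = K / (1 + (of_int l / \<rho>)\<^sup>2)" for l :: int
  have bound: "norm (f (int n)) \<le> (\<bar>K\<bar> * \<rho>\<^sup>2) * (1 / real n ^ 2)" if "1 \<le> n" for n
  proof -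
    have n: "0 < real n" using that by simp
    have "norm (f (int n)) = \<bar>K\<bar> / (1 + (real n / \<rho>)\<^sup>2)"
      by (simp add: f_def abs_of_nonneg add_nonneg_nonneg)
    also have "\<dots> \<le> \<bar>K\<bar> / (real n / \<rho>)\<^sup>2"
      using n assms by (intro divide_left_mono) (auto simp: add_pos_nonneg)
    also have "\<dots> = (\<bar>K\<bar> * \<rho>\<^sup>2) * (1 / real n ^ 2)" by (simp add: power_divide)
    finally show ?thesis .
  qed
  have "summable (\<lambda>n. 1 / real n ^ 2)"
    using inverse_power_summable[of 2, where 'a = real] by (simp add: inverse_eq_divide)
  then have sq: "summable (\<lambda>n. (\<bar>K\<bar> * \<rho>\<^sup>2) * (1 / real n ^ 2))" by (rule summable_mult)
  have "summable (\<lambda>n. norm (f (int n)))"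
    by (rule summable_comparison_test'[OF sq, of 1]) (use bound in simp)
  then have nat: "(\<lambda>n. f (int n)) summable_on UNIV"
    by (rule norm_summable_imp_summable_on)
  have "f summable_on (range int)"
    using nat by (subst summable_on_reindex) (auto simp: o_def)
  moreover have "f summable_on (range (\<lambda>n. - int n))"
    using nat by (subst summable_on_reindex) (auto simp: o_def inj_on_def f_def)
  then have "f summable_on (range (\<lambda>n. - int n) - range int)"
    by (rule summable_on_subset_banach) auto
  ultimately have "f summable_on (range int \<union> (range (\<lambda>n. - int n) - range int))"
    by (intro summable_on_Un_disjoint) auto
  moreover have "range int \<union> (range (\<lambda>n. - int n) - range int) = UNIV"
  proof -
    have "l \<in> range int \<or> l \<in> range (\<lambda>n. - int n)" for l :: int
      by (cases l rule: int_cases2) auto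
    then show ?thesis by blast
  qed
  ultimately show ?thesis by (simp add: f_def[abs_def])
qed

text \<open>Peetre's inequality. It separates the time \<open>t\<close> from the lattice point
  \<open>s\<close> and so gives one summable majorant for all \<open>t\<close> in a bounded
  interval. The main ingredient is (2 t - s)^2 \<ge> 0.\<close>

lemma peetre:
  fixes s t :: real
  shows "1 / (1 + (t - s)\<^sup>2) \<le> 2 * (1 + t\<^sup>2) / (1 + s\<^sup>2)"
proof -
  have "1 + s\<^sup>2 \<le> 2 * (1 + t\<^sup>2) * (1 + (t - s)\<^sup>2)"
  proof -
    have "s\<^sup>2 \<le> 2 * t\<^sup>2 + 2 * (t - s)\<^sup>2"
      using zero_le_power2[of "2 * t - s"] by (simp add: power2_eq_square algebra_simps)
    moreover have "0 \<le> t\<^sup>2 * (t - s)\<^sup>2" by simp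
    moreover have "2 * (1 + t\<^sup>2) * (1 + (t - s)\<^sup>2) = 2 + 2 * t\<^sup>2 + 2 * (t - s)\<^sup>2 + 2 * (t\<^sup>2 * (t - s)\<^sup>2)"
      by (simp add: algebra_simps)
    ultimately show ?thesis by linarith
  qed
  moreover have "0 < 1 + s\<^sup>2" "0 < 1 + (t - s)\<^sup>2" by (simp_all add: add_pos_nonneg)
  ultimately show ?thesis by (simp add: field_simps)
qed

text \<open>Turns unordered sums over the integers into limits of sequences, the form in which
  \<open>spectrum_in_limit\<close> applies.\<close>

lemma filterlim_symmetric_intervals:
  "filterlim (\<lambda>n. {- int n..int n}) (finite_subsets_at_top UNIV) sequentially"
proof (subst filterlim_finite_subsets_at_top, intro allI impI)
  fix X :: "int set" assume "finite X \<and> X \<subseteq> UNIV"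
  then have X: "finite (abs ` X)" by simp
  obtain n0 :: nat where n0: "\<And>x. x \<in> X \<Longrightarrow> \<bar>x\<bar> \<le> int n0"
  proof -
    have "\<bar>x\<bar> \<le> int (nat (Max (insert 0 (abs ` X))))" if "x \<in> X" for x
      using X that by (simp add: Max_ge_iff)
    then show ?thesis using that by blast
  qed
  show "\<forall>\<^sub>F n in sequentially. finite {- int n..int n} \<and> X \<subseteq> {- int n..int n} \<and> {- int n..int n} \<subseteq> UNIV"
    using eventually_ge_at_top[of n0]
  proof eventually_elim
    case (elim n)
    then show ?case using n0 by (fastforce simp: abs_le_iff)
  qed
qed

lemma spectrum_in_sum:
  assumes "finite A" "\<And>i. i \<in> A \<Longrightarrow> spectrum_in I (f i)" "\<And>i. i \<in> A \<Longrightarrow> f i \<in> borel_measurable borel"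
    "\<And>i t. i \<in> A \<Longrightarrow> norm (f i t) \<le> B"
  shows "spectrum_in I (\<lambda>t. \<Sum>i\<in>A. f i t)"
  unfolding spectrum_in_def
proof (intro allI impI)
  fix \<theta> assume *: "integrable lborel \<theta> \<and> (\<forall>\<xi>\<in>I. (LINT t|lborel. \<theta> t * cis (2 * pi * t * \<xi>)) = 0)"
  have "(LINT t|lborel. (\<Sum>i\<in>A. f i t) * \<theta> t) = (\<Sum>i\<in>A. LINT t|lborel. f i t * \<theta> t)"
    unfolding sum_distrib_right
    by (rule Bochner_Integration.integral_sum) (use assms * integrable_bounded_mult in blast)
  also have "\<dots> = 0" using assms(2) * unfolding spectrum_in_def by (intro sum.neutral) blast
  finally show "(LINT t|lborel. (\<Sum>i\<in>A. f i t) * \<theta> t) = 0" .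
qed

locale interpolation =
  fixes I :: "real set" and \<phi> :: "real \<Rightarrow> complex" and \<rho> C :: real
  assumes \<rho>: "0 < \<rho>"
    and continuous: "continuous_on UNIV \<phi>"
    and at_0: "\<phi> 0 = 1"
    and at_lattice: "\<And>l::int. l \<noteq> 0 \<Longrightarrow> \<phi> (of_int l / \<rho>) = 0"
    and decay: "\<And>t. norm (\<phi> t) \<le> C / (1 + t\<^sup>2)"
    and spectrum: "spectrum_in I \<phi>"
begin

text \<open>A cardinal series: since the kernel is 1 at 0 and vanishes at the other lattice points,
  it interpolates the values \<open>c\<close> on (1/\<rho>)\<int>.\<close>

definition series :: "(int \<Rightarrow> complex) \<Rightarrow> real \<Rightarrow> complex" where
  "series c t = (\<Sum>\<^sub>\<infinity>l. c l * \<phi> (t - of_int l / \<rho>))"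

lemma C_nonneg: "0 \<le> C"
  using order_trans[OF norm_ge_zero decay[of 0]] by simp

lemma kernel_le_C: "norm (\<phi> t) \<le> C"
proof -
  have "C / (1 + t\<^sup>2) \<le> C / 1" using C_nonneg by (intro divide_left_mono) (auto simp: add_pos_nonneg)
  then show ?thesis using decay[of t] by simp
qed

lemma kernel_lattice_le:
  assumes "\<bar>t\<bar> \<le> \<tau>"
  shows "norm (\<phi> (t - of_int l / \<rho>)) \<le> (C * (2 * (1 + \<tau>\<^sup>2))) / (1 + (of_int l / \<rho>)\<^sup>2)"
proof -
  have "norm (\<phi> (t - of_int l / \<rho>)) \<le> C * (1 / (1 + (t - of_int l / \<rho>)\<^sup>2))" using decay by simp
  also have "\<dots> \<le> C * (2 * (1 + t\<^sup>2) / (1 + (of_int l / \<rho>)\<^sup>2))"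
    by (intro mult_left_mono peetre C_nonneg)
  also have "\<dots> \<le> C * (2 * (1 + \<tau>\<^sup>2) / (1 + (of_int l / \<rho>)\<^sup>2))"
  proof (intro mult_left_mono divide_right_mono C_nonneg add_left_mono)
    show "t\<^sup>2 \<le> \<tau>\<^sup>2" using assms by (metis abs_le_square_iff abs_ge_self order_trans)
  qed (auto simp: add_nonneg_nonneg)
  finally show ?thesis by simp
qed

lemma kernel_lattice_summable: "(\<lambda>l. norm (\<phi> (t - of_int l / \<rho>))) summable_on UNIV"
  by (rule Infinite_Sum.abs_summable_on_comparison_test'[OF lattice_summable[OF \<rho>] kernel_lattice_le[of t "\<bar>t\<bar>"]]) simp

text \<open>The sum is periodic in \<open>t\<close> with period 1/\<rho>, so it is enough to bound
  it for times of modulus at most 1/\<rho>. The bound converts the size of the coefficients into the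
  uniform size of the series.\<close>

lemma kernel_lattice_bound: "\<exists>D. \<forall>t. (\<Sum>\<^sub>\<infinity>l. norm (\<phi> (t - of_int l / \<rho>))) \<le> D"
proof (intro exI allI)
  fix t
  define j where "j = \<lfloor>t * \<rho>\<rfloor>"
  define s where "s = t - of_int j / \<rho>"
  have s: "\<bar>s\<bar> \<le> 1 / \<rho>"
  proof -
    have "of_int j \<le> t * \<rho>" "t * \<rho> < of_int j + 1" unfolding j_def by linarith+
    moreover have "s * \<rho> = t * \<rho> - of_int j" using \<rho> by (simp add: s_def left_diff_distrib)
    ultimately have "\<bar>s * \<rho>\<bar> \<le> 1" by linarith
    then show ?thesis using \<rho> by (simp add: abs_mult pos_le_divide_eq)
  qed
  have "(\<Sum>\<^sub>\<infinity>l. norm (\<phi> (t - of_int l / \<rho>))) = (\<Sum>\<^sub>\<infinity>l. norm (\<phi> (s - of_int l / \<rho>)))"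
    by (rule infsum_reindex_bij_witness[of _ "\<lambda>l. l + j" "\<lambda>l. l - j"])
      (auto simp: s_def diff_divide_distrib)
  also have "\<dots> \<le> (\<Sum>\<^sub>\<infinity>l::int. (C * (2 * (1 + (1 / \<rho>)\<^sup>2))) / (1 + (of_int l / \<rho>)\<^sup>2))"
    by (rule infsum_mono[OF kernel_lattice_summable lattice_summable[OF \<rho>]]) (rule kernel_lattice_le[OF s])
  finally show "(\<Sum>\<^sub>\<infinity>l. norm (\<phi> (t - of_int l / \<rho>))) \<le> (\<Sum>\<^sub>\<infinity>l::int. (C * (2 * (1 + (1 / \<rho>)\<^sup>2))) / (1 + (of_int l / \<rho>)\<^sup>2))" .
qed

lemma series_abs_summable:
  assumes "\<And>l. norm (c l) \<le> E"
  shows "(\<lambda>l. norm (c l * \<phi> (t - of_int l / \<rho>))) summable_on UNIV"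
proof (rule Infinite_Sum.abs_summable_on_comparison_test')
  show "(\<lambda>l. E * norm (\<phi> (t - of_int l / \<rho>))) summable_on UNIV"
    by (intro summable_on_cmult_right kernel_lattice_summable)
  show "norm (c l * \<phi> (t - of_int l / \<rho>)) \<le> E * norm (\<phi> (t - of_int l / \<rho>))" for l
    using assms by (auto simp: norm_mult intro: mult_right_mono)
qed

lemma series_le:
  assumes c: "\<And>l. norm (c l) \<le> E" and D: "\<And>t. (\<Sum>\<^sub>\<infinity>l. norm (\<phi> (t - of_int l / \<rho>))) \<le> D"
  shows "norm (series c t) \<le> E * D"
proof -
  have E: "0 \<le> E" using order_trans[OF norm_ge_zero c] .
  have "norm (series c t) \<le> (\<Sum>\<^sub>\<infinity>l. norm (c l * \<phi> (t - of_int l / \<rho>)))"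
    unfolding series_def by (rule norm_infsum_bound[OF series_abs_summable[OF c]])
  also have "\<dots> \<le> (\<Sum>\<^sub>\<infinity>l. E * norm (\<phi> (t - of_int l / \<rho>)))"
    by (intro infsum_mono series_abs_summable[OF c] summable_on_cmult_right kernel_lattice_summable)
      (use c in \<open>auto simp: norm_mult intro: mult_right_mono\<close>)
  also have "\<dots> = E * (\<Sum>\<^sub>\<infinity>l. norm (\<phi> (t - of_int l / \<rho>)))"
    by (intro infsum_cmult_right kernel_lattice_summable)
  also have "\<dots> \<le> E * D" by (intro mult_left_mono D E)
  finally show ?thesis .
qed

lemma series_at_lattice: "series c (of_int j / \<rho>) = c j"
proof -
  have "c l * \<phi> (of_int j / \<rho> - of_int l / \<rho>) = (if l = j then c j else 0)" for l
    using at_lattice[of "j - l"] at_0 by (auto simp: diff_divide_distrib)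
  then have "series c (of_int j / \<rho>) = (\<Sum>\<^sub>\<infinity>l. if l = j then c j else 0)" by (simp add: series_def)
  also have "\<dots> = (\<Sum>\<^sub>\<infinity>l\<in>{j}. c j)" by (rule infsum_cong_neutral) auto
  finally show ?thesis by simp
qed

text \<open>This is what later makes the correction independent of the chosen lift of the circle
  coordinate.\<close>

lemma series_shift: "series (\<lambda>l. c (l + j)) t = series c (t + of_int j / \<rho>)"
  unfolding series_def
  by (rule infsum_reindex_bij_witness[of _ "\<lambda>l. l - j" "\<lambda>l. l + j"]) (auto simp: add_divide_distrib)

lemma series_partial_sums:
  assumes "\<And>l. norm (c l) \<le> E"
  shows "(\<lambda>n. \<Sum>l = - int n..int n. c l * \<phi> (t - of_int l / \<rho>)) \<longlonglongrightarrow> series c t"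
proof -
  have "((\<lambda>l. c l * \<phi> (t - of_int l / \<rho>)) has_sum series c t) UNIV"
    unfolding series_def by (rule has_sum_infsum[OF abs_summable_summable[OF series_abs_summable[OF assms]]])
  then show ?thesis
    unfolding has_sum_def by (rule filterlim_compose[OF _ filterlim_symmetric_intervals])
qed

lemma series_spectrum_measurable:
  assumes c: "\<And>l. norm (c l) \<le> E"
  shows "spectrum_in I (series c)" and "series c \<in> borel_measurable borel"
proof -
  define f where "f = (\<lambda>n t. \<Sum>l = - int n..int n. c l * \<phi> (t - of_int l / \<rho>))"
  have [measurable]: "\<phi> \<in> borel_measurable borel" by (rule borel_measurable_continuous_onI[OF continuous])
  have E: "0 \<le> E" using order_trans[OF norm_ge_zero c] .
  obtain D where D: "\<And>t. (\<Sum>\<^sub>\<infinity>l. norm (\<phi> (t - of_int l / \<rho>))) \<le> D" using kernel_lattice_bound by blast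
  have m: "f n \<in> borel_measurable borel" for n unfolding f_def by measurable
  have lim: "(\<lambda>n. f n t) \<longlonglongrightarrow> series c t" for t unfolding f_def by (rule series_partial_sums[OF c])
  show "series c \<in> borel_measurable borel" by (rule borel_measurable_LIMSEQ_metric[OF m lim])
  show "spectrum_in I (series c)"
  proof (rule spectrum_in_limit[OF _ m _ lim])
    show "spectrum_in I (f n)" for n
      unfolding f_def
    proof (rule spectrum_in_sum)
      show "spectrum_in I (\<lambda>t. c l * \<phi> (t - of_int l / \<rho>))" for l
        using spectrum_in_cmult[OF spectrum_in_translate[OF spectrum, of "- (of_int l / \<rho>)"]] by simp
      show "norm (c l * \<phi> (t - of_int l / \<rho>)) \<le> E * C" for l t
        unfolding norm_mult by (intro mult_mono c kernel_le_C E) auto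
    qed auto
    \<comment> \<open>The partial sums are bounded uniformly in \<open>n\<close> and
      \<open>t\<close>, as the passage to the limit demands.\<close>
    show "norm (f n t) \<le> E * D" for n t
    proof -
      have "norm (f n t) \<le> (\<Sum>l = - int n..int n. E * norm (\<phi> (t - of_int l / \<rho>)))"
        unfolding f_def by (rule sum_norm_le) (use c in \<open>auto simp: norm_mult intro: mult_right_mono\<close>)
      also have "\<dots> = E * (\<Sum>l = - int n..int n. norm (\<phi> (t - of_int l / \<rho>)))" by (simp add: sum_distrib_left)
      also have "\<dots> \<le> E * (\<Sum>\<^sub>\<infinity>l. norm (\<phi> (t - of_int l / \<rho>)))"
        by (intro mult_left_mono E finite_sum_le_infsum kernel_lattice_summable) auto
      also have "\<dots> \<le> E * D" by (intro mult_left_mono D E)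
      finally show ?thesis .
    qed
  qed
qed

text \<open>The Weierstrass test with the Peetre majorant; that majorant depends on \<tau>, so times
  are confined to a bounded interval.\<close>

lemma continuous_on_series:
  fixes K :: "'b::topological_space set"
  assumes cont: "\<And>l. continuous_on K (\<lambda>x. c x l)" and c: "\<And>x l. x \<in> K \<Longrightarrow> norm (c x l) \<le> E"
  shows "continuous_on (K \<times> {-\<tau>..\<tau>}) (\<lambda>z. series (c (fst z)) (snd z))"
  unfolding series_def
proof (rule uniform_limit_theorem[OF _ Weierstrass_m_test_general])
  show "\<forall>\<^sub>F X in finite_subsets_at_top UNIV. continuous_on (K \<times> {-\<tau>..\<tau>})
      (\<lambda>z. \<Sum>l\<in>X. c (fst z) l * \<phi> (snd z - of_int l / \<rho>))"
  proof (intro always_eventually allI continuous_intros)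
    fix l
    show "continuous_on (K \<times> {-\<tau>..\<tau>}) (\<lambda>z. c (fst z) l)"
      by (rule continuous_on_compose2[OF cont]) (auto intro: continuous_intros)
    show "continuous_on (K \<times> {-\<tau>..\<tau>}) (\<lambda>z. \<phi> (snd z - of_int l / \<rho>))"
      by (rule continuous_on_compose2[OF continuous]) (auto intro!: continuous_intros)
  qed
  \<comment> \<open>The absolute value is needed for empty \<open>K\<close>, where nothing fixes the
    sign of \<open>E\<close>.\<close>
  show "(\<lambda>l::int. (\<bar>E\<bar> * (C * (2 * (1 + \<tau>\<^sup>2)))) / (1 + (of_int l / \<rho>)\<^sup>2)) summable_on UNIV"
    by (rule lattice_summable[OF \<rho>])
  show "norm (c (fst z) l * \<phi> (snd z - of_int l / \<rho>)) \<le> (\<bar>E\<bar> * (C * (2 * (1 + \<tau>\<^sup>2)))) / (1 + (of_int l / \<rho>)\<^sup>2)"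
    if "z \<in> K \<times> {-\<tau>..\<tau>}" for l z
  proof -
    have "norm (c (fst z) l * \<phi> (snd z - of_int l / \<rho>)) \<le> \<bar>E\<bar> * ((C * (2 * (1 + \<tau>\<^sup>2))) / (1 + (of_int l / \<rho>)\<^sup>2))"
      unfolding norm_mult
    proof (intro mult_mono)
      show "norm (c (fst z) l) \<le> \<bar>E\<bar>" using c[of "fst z" l] that by auto
      show "norm (\<phi> (snd z - of_int l / \<rho>)) \<le> (C * (2 * (1 + \<tau>\<^sup>2))) / (1 + (of_int l / \<rho>)\<^sup>2)"
        by (rule kernel_lattice_le) (use that in auto)
    qed auto
    then show ?thesis by simp
  qed
qed (auto simp: finite_subsets_at_top_neq_bot)

end

section \<open>Perturbing an observable along a flow\<close>

text \<open>A flow on a compact set in a type of class \<open>metric_space\<close>, where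
  \<open>continuous_on\<close>, uniform limits and sequential compactness are at hand. Abstract
  flows are transported here by an isometry.\<close>

locale compact_flow =
  fixes S :: "'a::metric_space set" and T :: "real \<Rightarrow> 'a \<Rightarrow> 'a"
  assumes compact: "compact S"
    and cont: "continuous_on (UNIV \<times> S) (\<lambda>z. T (fst z) (snd z))"
    and T_in [simp]: "x \<in> S \<Longrightarrow> T r x \<in> S"
    and T_0 [simp]: "x \<in> S \<Longrightarrow> T 0 x = x"
    and T_T [simp]: "x \<in> S \<Longrightarrow> T r (T s x) = T (r + s) x"
begin

lemma continuous_on_T:
  assumes "continuous_on K f" "continuous_on K g" "\<And>x. x \<in> K \<Longrightarrow> g x \<in> S"
  shows "continuous_on K (\<lambda>x. T (f x) (g x))"
  using continuous_on_compose2[OF cont continuous_on_Pair[OF assms(1,2)]] assms(3) by auto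

lemma continuous_on_orbit:
  assumes "continuous_on S u" "x \<in> S"
  shows "continuous_on UNIV (\<lambda>t. u (T t x))"
  by (rule continuous_on_compose2[OF assms(1) continuous_on_T]) (use assms(2) in \<open>auto intro: continuous_intros\<close>)

lemma bounded_obs:
  fixes u :: "'a \<Rightarrow> complex"
  assumes "continuous_on S u"
  obtains B where "\<And>x. x \<in> S \<Longrightarrow> norm (u x) \<le> B"
  using compact_imp_bounded[OF compact_continuous_image[OF assms compact]] by (auto simp: bounded_iff)

text \<open>The circle-valued \<open>e\<close> cuts orbits into blocks of length \<open>N\<close>
  with \<open>m\<close> lattice points each. At these points the values of \<open>u\<close> are
  replaced by those of the separating maps \<open>w k\<close>, evaluated at the start of the block,
  and the series spreads the correction over the orbit within the band. If two points have the same
  phase and the same orbit values, all \<open>w k\<close> agree at their block starts; both starts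
  lie in one member of the cover, and flowing by at most \<open>N\<close> returns to the points
  within \<epsilon>.\<close>

lemma perturbation:
  fixes N :: real and m :: nat and U :: "nat \<Rightarrow> 'a set"
  assumes "interpolation I \<phi> \<rho> C"
    and D: "\<And>t. (\<Sum>\<^sub>\<infinity>l::int. norm (\<phi> (t - of_int l / \<rho>))) \<le> D"
    and m: "0 < m" and N: "0 < N" and Nm: "\<rho> * N = real m"
    and ce: "continuous_on S e" and e1: "\<And>x. x \<in> S \<Longrightarrow> norm (e x) = 1"
    and eT: "\<And>x t. x \<in> S \<Longrightarrow> e (T t x) = cis (2 * pi * t / N) * e x"
    and cu: "continuous_on S u" and su: "\<And>x. x \<in> S \<Longrightarrow> spectrum_in I (\<lambda>t. u (T t x))"
    and U: "\<And>i. i < n \<Longrightarrow> open (U i)" and cov: "S \<subseteq> (\<Union>i<n. U i)"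
    and ord: "\<And>x. x \<in> S \<Longrightarrow> card {i. i < n \<and> x \<in> U i} \<le> m"
    and small: "\<And>i x y r. i < n \<Longrightarrow> x \<in> S \<inter> U i \<Longrightarrow> y \<in> S \<inter> U i \<Longrightarrow> 0 \<le> r \<Longrightarrow> r \<le> N \<Longrightarrow> dist (T r x) (T r y) < \<epsilon>"
    and osc: "\<And>x y. x \<in> S \<Longrightarrow> y \<in> S \<Longrightarrow> dist x y < \<epsilon> \<Longrightarrow> norm (u x - u y) < \<eta>" and \<eta>: "0 < \<eta>"
  obtains v where "continuous_on S v" "\<And>x. x \<in> S \<Longrightarrow> norm (v x - u x) \<le> 2 * \<eta> * D"
    "\<And>x. x \<in> S \<Longrightarrow> spectrum_in I (\<lambda>t. v (T t x))"
    "\<And>x y. x \<in> S \<Longrightarrow> y \<in> S \<Longrightarrow> e x = e y \<Longrightarrow> (\<And>t. v (T t x) = v (T t y)) \<Longrightarrow> dist x y < \<epsilon>"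
proof -
  interpret interpolation I \<phi> \<rho> C by fact
  have mN: "real m / \<rho> = N" using Nm \<rho> by (simp add: field_simps)
  have kN: "0 \<le> real k / \<rho>" "real k / \<rho> \<le> N" if "k < m" for k
    using that \<rho> by (simp_all add: mN[symmetric] divide_right_mono)
  define us where "us k x = u (T (real k / \<rho>) x)" for k x
  have cus: "continuous_on S (us k)" for k
    unfolding us_def by (rule continuous_on_compose2[OF cu continuous_on_T]) (auto intro: continuous_intros)
  obtain w :: "nat \<Rightarrow> 'a \<Rightarrow> complex" where cw: "\<And>k. continuous_on S (w k)"
    and wu: "\<And>k x. k < m \<Longrightarrow> x \<in> S \<Longrightarrow> norm (w k x - us k x) \<le> 2 * \<eta>"
    and sep: "\<And>x y. x \<in> S \<Longrightarrow> y \<in> S \<Longrightarrow> (\<And>k. k < m \<Longrightarrow> w k x = w k y) \<Longrightarrow> \<exists>i<n. x \<in> U i \<and> y \<in> U i"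
  proof (rule separating_approximation[OF U cov ord _ \<eta>])
    show "norm (us k x - us k y) < \<eta>" if "i < n" "k < m" "x \<in> S \<inter> U i" "y \<in> S \<inter> U i" for i k x y
      unfolding us_def using small[OF that(1,3,4) kN[OF that(2)]] that by (intro osc) auto
  qed auto
  \<comment> \<open>For \<open>x\<close> at a block start, lattice index \<open>l\<close> lies in
    block \<open>l div m\<close> at position \<open>l mod m\<close>. The coefficient is the
    correction for that position, taken at the start of that block.\<close>
  define c where "c x l = (\<lambda>k y. w k y - us k y) (nat (l mod int m)) (T (of_int (l div int m) * N) x)" for x l
  have cE: "norm (c x l) \<le> 2 * \<eta>" if "x \<in> S" for x l
    unfolding c_def using that m by (intro wu) (auto simp: nat_less_iff)
  have cc: "continuous_on S (\<lambda>x. c x l)" for l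
    unfolding c_def
    by (intro continuous_intros continuous_on_compose2[OF cw continuous_on_T] continuous_on_compose2[OF cus continuous_on_T]) auto
  \<comment> \<open>Here \<open>p\<close> is the time elapsed since the start of a block, so
    \<open>T (- p) x\<close> is that start and the series is read at time \<open>p\<close>.\<close>
  define G where "G x p = series (c (T (- p) x)) p" for x p
  have shift: "series (c (T (of_int j * N) x)) t = series (c x) (t + of_int j * N)" if "x \<in> S" for x t and j :: int
  proof -
    have "c (T (of_int j * N) x) = (\<lambda>l. c x (l + j * int m))"
    proof
      fix l
      have "of_int (l div int m) * N + of_int j * N = of_int ((l + j * int m) div int m) * N"
        using m by (simp add: distrib_right)
      then show "c (T (of_int j * N) x) l = c x (l + j * int m)"
        using that by (simp add: c_def)
    qed
    then have "series (c (T (of_int j * N) x)) t = series (\<lambda>l. c x (l + j * int m)) t" by simp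
    also have "\<dots> = series (c x) (t + of_int j * N)"
      unfolding series_shift by (simp add: mN[symmetric])
    finally show ?thesis .
  qed
  \<comment> \<open>Two lifts \<open>p\<close>, \<open>q\<close> of one phase differ by a multiple
    of \<open>N\<close>; moving the start by \<open>j\<close> blocks shifts the coefficients by
    \<open>j * m\<close> indices, which the time shift \<open>j * N\<close> compensates.\<close>
  have G_eq: "G x p = G x q" if x: "x \<in> S" and pq: "cis (2 * pi * p / N) = cis (2 * pi * q / N)" for x p q
  proof -
    obtain j :: int where j: "2 * pi * p / N = 2 * pi * q / N + 2 * pi * of_int j"
    proof -
      have "sin (2 * pi * p / N) = sin (2 * pi * q / N) \<and> cos (2 * pi * p / N) = cos (2 * pi * q / N)"
        using pq by (simp add: complex_eq_iff)
      then show ?thesis using that unfolding sin_cos_eq_iff by blast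
    qed
    have "p = q + of_int j * N"
    proof -
      have "2 * pi * p = 2 * pi * (q + of_int j * N)"
        using j N by (simp add: field_simps)
      then show ?thesis by simp
    qed
    then have "T (- q) x = T (of_int j * N) (T (- p) x)" and q: "p = q + of_int j * N" using x by simp_all
    then have "G x q = series (c (T (- p) x)) (q + of_int j * N)"
      using shift[of "T (- p) x" j q] x by (simp add: G_def)
    then show ?thesis by (simp add: G_def q[symmetric])
  qed
  \<comment> \<open>A lift of the phase; it jumps where \<open>e x\<close> is a negative real,
    although \<open>v\<close> does not.\<close>
  define p where "p x = N / (2 * pi) * Arg (e x)" for x
  have p: "e x = cis (2 * pi * p x / N)" if "x \<in> S" for x
    using N rcis_cmod_Arg[of "e x"] e1[OF that] by (simp add: p_def rcis_def)
  define v where "v x = u x + G x (p x)" for x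
  have v: "v x = u x + G x q" if "x \<in> S" "e x = cis (2 * pi * q / N)" for x q
    using G_eq[of x "p x" q] p[of x] that by (simp add: v_def)
  have contG: "continuous_on K (\<lambda>x. u x + G x (q x))" if K: "K \<subseteq> S" and q: "continuous_on K q" "\<And>x. x \<in> K \<Longrightarrow> \<bar>q x\<bar> \<le> N" for K q
  proof (rule continuous_on_add)
    show "continuous_on K u" using cu K by (rule continuous_on_subset)
    have q1: "continuous_on K (\<lambda>x. (T (- q x) x, q x))"
      using K by (intro continuous_on_Pair q(1) continuous_on_T continuous_on_minus continuous_on_id) auto
    have q2: "(\<lambda>x. (T (- q x) x, q x)) ` K \<subseteq> S \<times> {- N..N}"
      proof
      fix z assume "z \<in> (\<lambda>x. (T (- q x) x, q x)) ` K"
      then obtain x where x: "x \<in> K" "z = (T (- q x) x, q x)" by blast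
      then show "z \<in> S \<times> {- N..N}" using K q(2)[of x] by (auto simp: abs_le_iff)
    qed
    show "continuous_on K (\<lambda>x. G x (q x))"
      using continuous_on_compose2[OF continuous_on_series[of S c, OF cc cE, of N] q1 q2] by (simp add: G_def)
  qed
  have cv: "continuous_on S v"
  proof -
    \<comment> \<open>Continuity is local: where \<open>e x\<close> is not a negative real the lift
      by \<open>Arg (e x)\<close> is continuous, and where it is not a positive real the lift by
      \<open>Arg (- e x)\<close> shifted by \<open>N / 2\<close> is. The two relatively open sets
      cover \<open>S\<close>, and \<open>G_eq\<close> makes the two formulas agree.\<close>
    define S1 where "S1 = S \<inter> e -` (- \<real>\<^sub>\<le>\<^sub>0)"
    define S2 where "S2 = S \<inter> (\<lambda>x. - e x) -` (- \<real>\<^sub>\<le>\<^sub>0)"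
    have op: "open (- \<real>\<^sub>\<le>\<^sub>0 :: complex set)" by (intro open_Compl closed_nonpos_Reals_complex)
    have o1: "openin (top_of_set S) S1"
      unfolding S1_def by (rule continuous_openin_preimage_gen[OF ce op])
    have o2: "openin (top_of_set S) S2"
      unfolding S2_def by (rule continuous_openin_preimage_gen[OF continuous_on_minus[OF ce] op])
    have S12: "S1 \<union> S2 = S"
    proof -
      have "x \<in> S1 \<union> S2" if x: "x \<in> S" for x
      proof (rule ccontr)
        assume "x \<notin> S1 \<union> S2"
        then have "e x \<in> \<real>\<^sub>\<le>\<^sub>0" "- e x \<in> \<real>\<^sub>\<le>\<^sub>0" using x by (auto simp: S1_def S2_def)
        then have "e x = 0" by (auto simp: complex_nonpos_Reals_iff complex_eq_iff)
        then show False using e1[OF x] by simp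
      qed
      then show ?thesis by (auto simp: S1_def S2_def)
    qed
    have Arg: "continuous_on K (\<lambda>x. Arg (f x))" if "continuous_on K f" "\<And>x. x \<in> K \<Longrightarrow> f x \<in> - \<real>\<^sub>\<le>\<^sub>0" for K and f :: "'a \<Rightarrow> complex"
      by (rule continuous_on_compose2[OF _ that(1), of "- \<real>\<^sub>\<le>\<^sub>0"])
        (use that(2) in \<open>auto intro!: continuous_at_imp_continuous_on continuous_at_Arg\<close>)
    have Arg_le: "\<bar>N / (2 * pi) * Arg z\<bar> \<le> N / 2" for z
    proof -
      have "\<bar>Arg z\<bar> \<le> pi" using mpi_less_Arg[of z] Arg_le_pi[of z] by (simp add: abs_le_iff)
      then have "N / (2 * pi) * \<bar>Arg z\<bar> \<le> N / (2 * pi) * pi" using N by (intro mult_left_mono) auto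
      then show ?thesis using N by (simp add: abs_mult)
    qed
    have "continuous_on S1 (\<lambda>x. u x + G x (p x))"
    proof (rule contG)
      show "continuous_on S1 p" unfolding p_def
        by (intro continuous_on_mult_left Arg continuous_on_subset[OF ce]) (auto simp: S1_def)
      show "\<bar>p x\<bar> \<le> N" for x using Arg_le[of "e x"] N by (simp add: p_def)
    qed (auto simp: S1_def)
    then have 1: "continuous_on S1 v" by (simp add: v_def[abs_def])
    define p2 where "p2 x = N / (2 * pi) * Arg (- e x) + N / 2" for x
    have p2: "e x = cis (2 * pi * p2 x / N)" if "x \<in> S" for x
    proof -
      have "2 * pi * p2 x / N = Arg (- e x) + pi" using N by (simp add: p2_def field_simps)
      then have "cis (2 * pi * p2 x / N) = cis (Arg (- e x)) * cis pi" by (simp only: cis_mult)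
      then show ?thesis using rcis_cmod_Arg[of "- e x"] e1[OF that] by (simp add: rcis_def)
    qed
    have "continuous_on S2 (\<lambda>x. u x + G x (p2 x))"
    proof (rule contG)
      show "continuous_on S2 p2" unfolding p2_def
        by (intro continuous_on_add continuous_on_const continuous_on_mult_left Arg continuous_on_minus continuous_on_subset[OF ce])
          (auto simp: S2_def)
      show "\<bar>p2 x\<bar> \<le> N" for x
        using Arg_le[of "- e x"] N unfolding p2_def by linarith
    qed (auto simp: S2_def)
    then have 2: "continuous_on S2 v"
    proof (rule continuous_on_eq)
      show "u x + G x (p2 x) = v x" if "x \<in> S2" for x
        using v[OF _ p2] that by (simp add: S2_def)
    qed
    show ?thesis
      using continuous_on_Un_local_open[OF _ _ 1 2] o1 o2 by (simp add: S12)
  qed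
  \<comment> \<open>Along one orbit the block start stays fixed and only the time moves, so the
    correction is a translate of a single series and has its spectrum in \<open>I\<close>.\<close>
  have orbit: "v (T t x) = u (T t x) + series (c (T (- p x) x)) (t + p x)" if "x \<in> S" for t x
  proof -
    have "e (T t x) = cis (2 * pi * (t + p x) / N)"
      using eT[OF that, of t] p[OF that] by (simp add: cis_mult distrib_left add_divide_distrib)
    then have "v (T t x) = u (T t x) + G (T t x) (t + p x)" using v that by simp
    then show ?thesis using that by (simp add: G_def)
  qed
  obtain Bu where Bu: "\<And>x. x \<in> S \<Longrightarrow> norm (u x) \<le> Bu" using bounded_obs[OF cu] by blast
  show ?thesis
  proof (rule that[of v])
    show "continuous_on S v" by (rule cv)
    show "norm (v x - u x) \<le> 2 * \<eta> * D" if "x \<in> S" for x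
      using series_le[OF cE D] that by (simp add: v_def G_def)
    show "spectrum_in I (\<lambda>t. v (T t x))" if x: "x \<in> S" for x
      unfolding orbit[OF x]
    proof (rule spectrum_in_add)
      have cE': "\<And>l. norm (c (T (- p x) x) l) \<le> 2 * \<eta>" using cE x by simp
      show "spectrum_in I (\<lambda>t. u (T t x))" by (rule su[OF x])
      show "spectrum_in I (\<lambda>t. series (c (T (- p x) x)) (t + p x))"
        by (intro spectrum_in_translate series_spectrum_measurable(1)[OF cE'])
      show "(\<lambda>t. u (T t x)) \<in> borel_measurable borel"
        by (intro borel_measurable_continuous_onI continuous_on_orbit cu x)
      have [measurable]: "series (c (T (- p x) x)) \<in> borel_measurable borel"
        by (rule series_spectrum_measurable(2)[OF cE'])
      show "(\<lambda>t. series (c (T (- p x) x)) (t + p x)) \<in> borel_measurable borel" by measurable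
      show "norm (u (T t x)) \<le> max Bu (2 * \<eta> * D)" for t using Bu x by (simp add: le_max_iff_disj)
      show "norm (series (c (T (- p x) x)) (t + p x)) \<le> max Bu (2 * \<eta> * D)" for t
        using series_le[OF cE' D] by (simp add: le_max_iff_disj)
    qed
    show "dist x y < \<epsilon>" if x: "x \<in> S" and y: "y \<in> S" and exy: "e x = e y" and eq: "\<And>t. v (T t x) = v (T t y)" for x y
    proof -
      \<comment> \<open>A lift in [0, N], because smallness of the cover is known only for times in
        that interval.\<close>
      define q where "q = (if 0 \<le> p x then p x else p x + N)"
      have "\<bar>p x\<bar> \<le> N"
      proof -
        have "\<bar>Arg (e x)\<bar> \<le> pi" using mpi_less_Arg[of "e x"] Arg_le_pi[of "e x"] by (simp add: abs_le_iff)
        then have "N / (2 * pi) * \<bar>Arg (e x)\<bar> \<le> N / (2 * pi) * (2 * pi)" using N by (intro mult_left_mono) auto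
        then show ?thesis using N by (simp add: p_def abs_mult)
      qed
      then have q: "0 \<le> q" "q \<le> N" by (auto simp: q_def)
      have "cis (2 * pi * q / N) = cis (2 * pi * p x / N)"
        using N by (simp add: q_def distrib_left add_divide_distrib cis_mult[symmetric])
      then have eq': "e x = cis (2 * pi * q / N)" "e y = cis (2 * pi * q / N)" using p[OF x] exy by simp_all
      \<comment> \<open>At time k/\<rho> after the block start the series equals its own
        coefficient, so the old sample cancels and the value \<open>w k\<close> remains.\<close>
      have val: "v (T (real k / \<rho> - q) z) = w k (T (- q) z)" if z: "z \<in> S" "e z = cis (2 * pi * q / N)" and k: "k < m" for z k
      proof -
        define r where "r = real k / \<rho> - q"
        have "e (T r z) = cis (2 * pi * (r + q) / N)"
          using eT[OF z(1), of r] z(2) by (simp add: cis_mult distrib_left add_divide_distrib)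
        then have "v (T r z) = u (T r z) + G (T r z) (r + q)" using v z by simp
        also have "\<dots> = us k (T (- q) z) + series (c (T (- q) z)) (of_int (int k) / \<rho>)"
          using z by (simp add: G_def us_def r_def)
        also have "\<dots> = us k (T (- q) z) + c (T (- q) z) (int k)"
          by (simp only: series_at_lattice)
        also have "\<dots> = w k (T (- q) z)"
        proof -
          have "int k mod int m = int k" "int k div int m = 0" using k by simp_all
          then show ?thesis using z by (simp add: c_def)
        qed
        finally show ?thesis by (simp add: r_def)
      qed
      have "w k (T (- q) x) = w k (T (- q) y)" if "k < m" for k
        using val[OF x eq'(1) that] val[OF y eq'(2) that] eq by simp
      then obtain i where i: "i < n" "T (- q) x \<in> U i" "T (- q) y \<in> U i"
        using sep[of "T (- q) x" "T (- q) y"] x y by auto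
      have "dist (T q (T (- q) x)) (T q (T (- q) y)) < \<epsilon>"
        using i x y q by (intro small[of i]) auto
      then show ?thesis using x y by simp
    qed
  qed
qed

end

section \<open>Equivariant maps\<close>

context compact_flow
begin

text \<open>Separation at scale \<open>d\<close> is an open condition in the uniform norm. Otherwise
  functions converging to \<open>v\<close> would fail on pairs at distance at least
  \<open>d\<close>; by compactness the pairs accumulate at a pair with the same property for
  \<open>v\<close>.\<close>

lemma separation_margin:
  fixes v :: "'a \<Rightarrow> complex" and e :: "'i \<Rightarrow> 'a \<Rightarrow> complex"
  assumes cv: "continuous_on S v" and ce: "\<And>i. continuous_on S (e i)" and d: "0 < d"
    and sep: "\<And>x y. x \<in> S \<Longrightarrow> y \<in> S \<Longrightarrow> (\<And>i. e i x = e i y) \<Longrightarrow> (\<And>t. v (T t x) = v (T t y)) \<Longrightarrow> dist x y < d"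
  shows "\<exists>\<gamma>>0. \<forall>w x y. (\<forall>z\<in>S. norm (w z - v z) \<le> \<gamma>) \<longrightarrow> x \<in> S \<longrightarrow> y \<in> S \<longrightarrow> (\<forall>i. e i x = e i y)
            \<longrightarrow> (\<forall>t. w (T t x) = w (T t y)) \<longrightarrow> dist x y < d"
proof (rule ccontr)
  assume neg: "\<not> ?thesis"
  define P where "P \<gamma> w x y \<longleftrightarrow> (\<forall>z\<in>S. norm (w z - v z) \<le> \<gamma>) \<and> x \<in> S \<and> y \<in> S \<and> (\<forall>i. e i x = e i y)
            \<and> (\<forall>t. w (T t x) = w (T t y)) \<and> d \<le> dist x y" for \<gamma> and w :: "'a \<Rightarrow> complex" and x y
  have "\<exists>w x y. P \<gamma> w x y" if "0 < \<gamma>" for \<gamma>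
    using neg that unfolding P_def not_less[symmetric] by blast
  then have "\<forall>n. \<exists>w x y. P (1 / real (Suc n)) w x y" by simp
  then obtain w x y where P: "\<And>n. P (1 / real (Suc n)) (w n) (x n) (y n)" by metis
  then have w: "\<And>n z. z \<in> S \<Longrightarrow> norm (w n z - v z) \<le> 1 / real (Suc n)"
    and xy: "\<And>n. x n \<in> S" "\<And>n. y n \<in> S" and exy: "\<And>n i. e i (x n) = e i (y n)"
    and wT: "\<And>n t. w n (T t (x n)) = w n (T t (y n))" and far: "\<And>n. d \<le> dist (x n) (y n)"
    unfolding P_def by blast+
  have "seq_compact (S \<times> S)" by (intro compact_imp_seq_compact compact_Times compact)
  then obtain l r where l: "l \<in> S \<times> S" and r: "strict_mono (r :: nat \<Rightarrow> nat)"
    and lim: "((\<lambda>n. (x n, y n)) \<circ> r) \<longlonglongrightarrow> l"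
    by (rule seq_compactE[of _ "\<lambda>n. (x n, y n)"]) (use xy in auto)
  obtain a b where ab: "l = (a, b)" by (cases l)
  then have aS: "a \<in> S" and bS: "b \<in> S" using l by auto
  have xa: "(\<lambda>n. x (r n)) \<longlonglongrightarrow> a" using tendsto_fst[OF lim] by (simp add: ab o_def)
  have yb: "(\<lambda>n. y (r n)) \<longlonglongrightarrow> b" using tendsto_snd[OF lim] by (simp add: ab o_def)
  have at: "(\<lambda>n. f (z (r n))) \<longlonglongrightarrow> f c" if "continuous_on S f" "(\<lambda>n. z (r n)) \<longlonglongrightarrow> c" "c \<in> S" "\<And>n. z n \<in> S"
    for f :: "'a \<Rightarrow> complex" and z c
    using continuous_on_tendsto_compose[OF that(1,2,3)] that(4) by simp
  have "e i a = e i b" for i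
  proof -
    have "(\<lambda>n. e i (x (r n))) \<longlonglongrightarrow> e i a" by (rule at[OF ce xa aS xy(1)])
    moreover have "(\<lambda>n. e i (x (r n))) \<longlonglongrightarrow> e i b" unfolding exy by (rule at[OF ce yb bS xy(2)])
    ultimately show ?thesis by (rule LIMSEQ_unique)
  qed
  moreover have "v (T t a) = v (T t b)" for t
  proof -
    have cvt: "continuous_on S (\<lambda>x. v (T t x))"
      by (rule continuous_on_compose2[OF cv continuous_on_T]) (auto intro: continuous_intros)
    have "(\<lambda>n. v (T t (x (r n))) - v (T t (y (r n)))) \<longlonglongrightarrow> v (T t a) - v (T t b)"
      by (intro tendsto_diff at[OF cvt xa aS xy(1)] at[OF cvt yb bS xy(2)])
    moreover have "(\<lambda>n. v (T t (x (r n))) - v (T t (y (r n)))) \<longlonglongrightarrow> 0"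
    proof (rule Lim_null_comparison)
      show "\<forall>\<^sub>F n in sequentially. norm (v (T t (x (r n))) - v (T t (y (r n)))) \<le> 2 / real (Suc n)"
      proof (intro always_eventually allI)
        fix n
        have "norm (v (T t (x (r n))) - v (T t (y (r n)))) \<le> norm (w (r n) (T t (x (r n))) - v (T t (x (r n)))) + norm (w (r n) (T t (y (r n))) - v (T t (y (r n))))"
          using norm_triangle_ineq4[of "w (r n) (T t (y (r n))) - v (T t (y (r n)))" "w (r n) (T t (x (r n))) - v (T t (x (r n)))"] wT[of "r n" t]
          by (simp add: add.commute)
        also have "\<dots> \<le> 1 / real (Suc (r n)) + 1 / real (Suc (r n))"
          by (intro add_mono w) (auto simp: xy)
        also have "\<dots> = 2 / real (Suc (r n))" by simp
        also have "\<dots> \<le> 2 / real (Suc n)"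
          using seq_suble[OF r, of n] by (intro divide_left_mono) auto
        finally show "norm (v (T t (x (r n))) - v (T t (y (r n)))) \<le> 2 / real (Suc n)" .
      qed
      show "(\<lambda>n. 2 / real (Suc n)) \<longlonglongrightarrow> 0" by (intro LIMSEQ_Suc lim_const_over_n)
    qed
    ultimately show ?thesis using LIMSEQ_unique by fastforce
  qed
  ultimately have "dist a b < d" using sep[OF aS bS] by blast
  moreover have "d \<le> dist a b"
    by (rule LIMSEQ_le_const[OF tendsto_dist[OF xa yb]]) (use far in blast)
  ultimately show False by simp
qed

text \<open>The Baire category argument with explicit radii: each step separates at scale 1 / (n +
  1) and fixes a radius within which this survives; later steps are so small that the limit remains
  inside all these radii.\<close>

lemma separating_limit:
  fixes e :: "'i \<Rightarrow> 'a \<Rightarrow> complex" and W :: "('a \<Rightarrow> complex) set"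
  assumes W0: "u0 \<in> W" and Wc: "\<And>u. u \<in> W \<Longrightarrow> continuous_on S u"
    and Wlim: "\<And>u v. (\<And>n::nat. u n \<in> W) \<Longrightarrow> uniform_limit S u v sequentially \<Longrightarrow> v \<in> W"
    and ce: "\<And>i. continuous_on S (e i)"
    and pert: "\<And>u \<eta> d. u \<in> W \<Longrightarrow> 0 < \<eta> \<Longrightarrow> 0 < d \<Longrightarrow> \<exists>v\<in>W. (\<forall>x\<in>S. norm (v x - u x) \<le> \<eta>) \<and>
       (\<forall>x y. x \<in> S \<longrightarrow> y \<in> S \<longrightarrow> (\<forall>i. e i x = e i y) \<longrightarrow> (\<forall>t. v (T t x) = v (T t y)) \<longrightarrow> dist x y < d)"
  obtains v where "v \<in> W"
    "\<And>x y. x \<in> S \<Longrightarrow> y \<in> S \<Longrightarrow> (\<And>i. e i x = e i y) \<Longrightarrow> (\<And>t. v (T t x) = v (T t y)) \<Longrightarrow> x = y"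
proof -
  define R where "R d v \<longleftrightarrow> (\<forall>x y. x \<in> S \<longrightarrow> y \<in> S \<longrightarrow> (\<forall>i. e i x = e i y) \<longrightarrow> (\<forall>t. v (T t x) = v (T t y)) \<longrightarrow> dist x y < d)"
    for d and v :: "'a \<Rightarrow> complex"
  define near where "near \<eta> v u \<longleftrightarrow> (\<forall>x\<in>S. norm (v x - u x) \<le> \<eta>)" for \<eta> and v u :: "'a \<Rightarrow> complex"
  \<comment> \<open>A state is a function with a radius. The factor 2 covers all later steps
    together, since radii at least halve; state 0 carries no separation requirement.\<close>
  define Q where "Q n p \<longleftrightarrow> fst p \<in> W \<and> 0 < snd p \<and> (\<forall>w. near (2 * snd p) w (fst p) \<longrightarrow> n = 0 \<or> R (1 / real n) w)"
    for n and p :: "('a \<Rightarrow> complex) \<times> real"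
  have step: "\<exists>q. Q (Suc n) q \<and> near (snd p) (fst q) (fst p) \<and> snd q \<le> snd p / 2" if p: "Q n p" for n p
  proof -
    obtain v where v: "v \<in> W" "near (snd p) v (fst p)" "R (1 / real (Suc n)) v"
      using pert[of "fst p" "snd p" "1 / real (Suc n)"] p by (auto simp: Q_def R_def near_def)
    have sep: "dist x y < 1 / real (Suc n)" if "x \<in> S" "y \<in> S" "\<And>i. e i x = e i y" "\<And>t. v (T t x) = v (T t y)" for x y
      using v(3) that unfolding R_def by blast
    have pos: "0 < 1 / real (Suc n)" by simp
    obtain \<gamma> where \<gamma>: "0 < \<gamma>" "\<And>w. near \<gamma> w v \<Longrightarrow> R (1 / real (Suc n)) w"
      using separation_margin[where e = e, OF Wc[OF v(1)] ce pos sep] unfolding R_def near_def by blast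
    define \<eta> where "\<eta> = min (snd p / 2) (\<gamma> / 2)"
    have "near \<gamma> w v" if "near (2 * \<eta>) w v" for w
    proof -
      have "2 * \<eta> \<le> \<gamma>" by (auto simp: \<eta>_def min_def)
      then show ?thesis using that unfolding near_def by (meson order_trans)
    qed
    moreover have "0 < \<eta>" using p \<gamma> by (auto simp: \<eta>_def Q_def)
    ultimately have "Q (Suc n) (v, \<eta>)" using v \<gamma> by (auto simp: Q_def)
    then show ?thesis using v by (intro exI[of _ "(v, \<eta>)"]) (auto simp: \<eta>_def)
  qed
  have "\<exists>p. \<forall>n. Q n (p n) \<and> (near (snd (p n)) (fst (p (Suc n))) (fst (p n)) \<and> snd (p (Suc n)) \<le> snd (p n) / 2)"
  proof (rule dependent_nat_choice)
    show "\<exists>p. Q 0 p" using W0 by (intro exI[of _ "(u0, 1)"]) (simp add: Q_def)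
  qed (rule step)
  then obtain p where p: "\<And>n. Q n (p n)" "\<And>n. near (snd (p n)) (fst (p (Suc n))) (fst (p n))" "\<And>n. snd (p (Suc n)) \<le> snd (p n) / 2"
    by blast
  define u where "u n = fst (p n)" for n
  define \<eta> where "\<eta> n = snd (p n)" for n
  have \<eta>pos: "0 < \<eta> n" for n using p(1)[of n] by (simp add: Q_def \<eta>_def)
  have \<eta>2: "\<eta> (Suc n) \<le> \<eta> n / 2" for n using p(3) by (simp add: \<eta>_def)
  have uW: "u n \<in> W" for n using p(1)[of n] by (simp add: Q_def u_def)
  have us: "norm (u (Suc n) x - u n x) \<le> \<eta> n" if "x \<in> S" for n x
    using p(2)[of n] that by (simp add: near_def u_def \<eta>_def)
  \<comment> \<open>The subtracted term makes the induction telescope, since each step is at most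
    the current radius and the next radius is at most half of it.\<close>
  have uu: "norm (u (n + k) x - u n x) \<le> 2 * \<eta> n - 2 * \<eta> (n + k)" if x: "x \<in> S" for n k x
  proof (induction k)
    case (Suc k)
    have "norm (u (n + Suc k) x - u n x) \<le> norm (u (Suc (n + k)) x - u (n + k) x) + norm (u (n + k) x - u n x)"
      using norm_triangle_ineq[of "u (Suc (n + k)) x - u (n + k) x" "u (n + k) x - u n x"] by simp
    also have "\<dots> \<le> \<eta> (n + k) + (2 * \<eta> n - 2 * \<eta> (n + k))" by (intro add_mono us x Suc)
    also have "\<dots> \<le> 2 * \<eta> n - 2 * \<eta> (n + Suc k)" using \<eta>2[of "n + k"] by simp
    finally show ?case .
  qed simp
  have uu': "norm (u m x - u n x) \<le> 2 * \<eta> n" if "x \<in> S" "n \<le> m" for n m x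
    using uu[OF that(1), of n "m - n"] that(2) \<eta>pos[of m] by simp
  have \<eta>0: "\<eta> n \<le> \<eta> 0 * (1/2) ^ n" for n
  proof (induction n)
    case (Suc n) then show ?case using \<eta>2[of n] by simp
  qed simp
  have "(\<lambda>n. \<eta> 0 * (1/2) ^ n) \<longlonglongrightarrow> 0" by (intro tendsto_mult_right_zero LIMSEQ_realpow_zero) auto
  then have \<eta>lim: "\<eta> \<longlonglongrightarrow> 0"
    by (rule Lim_null_comparison[rotated]) (use \<eta>0 \<eta>pos in \<open>auto simp: abs_of_pos\<close>)
  have "Cauchy (\<lambda>n. u n x)" if x: "x \<in> S" for x
  proof (rule CauchyI')
    fix \<epsilon> :: real assume "0 < \<epsilon>"
    then obtain M where M: "\<eta> M < \<epsilon> / 4"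
      using order_tendstoD(2)[OF \<eta>lim, of "\<epsilon> / 4"] eventually_happens'[OF sequentially_bot] by (metis (no_types, lifting) zero_less_divide_iff zero_less_numeral)
    have "norm (u m x - u n x) < \<epsilon>" if "M \<le> m" "M \<le> n" for m n
    proof -
      have "norm (u m x - u n x) \<le> norm (u m x - u M x) + norm (u n x - u M x)"
        using norm_triangle_ineq4[of "u m x - u M x" "u n x - u M x"] by simp
      then show ?thesis using uu'[OF x that(1)] uu'[OF x that(2)] M by simp
    qed
    then show "\<exists>M. \<forall>m\<ge>M. \<forall>n>m. dist (u m x) (u n x) < \<epsilon>"
      by (intro exI[of _ M]) (auto simp: dist_norm)
  qed
  then have lim: "(\<lambda>n. u n x) \<longlonglongrightarrow> lim (\<lambda>n. u n x)" if "x \<in> S" for x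
    using that Cauchy_convergent convergent_LIMSEQ_iff by blast
  define v where "v x = lim (\<lambda>n. u n x)" for x
  have vu: "norm (v x - u n x) \<le> 2 * \<eta> n" if x: "x \<in> S" for x n
  proof (rule LIMSEQ_le_const2)
    show "(\<lambda>m. norm (u m x - u n x)) \<longlonglongrightarrow> norm (v x - u n x)"
      unfolding v_def by (intro tendsto_intros lim x)
    show "\<exists>N. \<forall>m\<ge>N. norm (u m x - u n x) \<le> 2 * \<eta> n" using uu'[OF x] by blast
  qed
  have "uniform_limit S u v sequentially"
  proof (rule uniform_limitI)
    fix \<epsilon> :: real assume "0 < \<epsilon>"
    then have "\<forall>\<^sub>F n in sequentially. \<eta> n < \<epsilon> / 2" using order_tendstoD(2)[OF \<eta>lim, of "\<epsilon> / 2"] by simp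
    then show "\<forall>\<^sub>F n in sequentially. \<forall>x\<in>S. dist (u n x) (v x) < \<epsilon>"
    proof eventually_elim
      case (elim n)
      show ?case using vu[of _ n] elim by (force simp: dist_norm norm_minus_commute)
    qed
  qed
  then have "v \<in> W" by (rule Wlim[OF uW])
  moreover have "x = y" if x: "x \<in> S" and y: "y \<in> S" and eq: "\<And>i. e i x = e i y" "\<And>t. v (T t x) = v (T t y)" for x y
  proof (rule ccontr)
    assume "x \<noteq> y"
    then obtain n where n: "1 / real (Suc n) < dist x y" using nat_approx_posE[of "dist x y"] by auto
    have "near (2 * snd (p (Suc n))) v (fst (p (Suc n)))"
      using vu by (simp add: near_def u_def \<eta>_def)
    then have "R (1 / real (Suc n)) v" using p(1)[of "Suc n"] by (simp add: Q_def)
    then have "dist x y < 1 / real (Suc n)" using x y eq by (simp add: R_def)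
    then show False using n by simp
  qed
  ultimately show ?thesis by (rule that)
qed

text \<open>The combinatorial form in which an upper bound on Widim is used: a finite open cover of
  multiplicity at most \<open>m\<close>, small for the orbit distance over \<open>[0, N]\<close>.
  Multiplicity \<open>m\<close> means that the nerve has dimension at most m - 1.\<close>

definition fine_cover :: "real \<Rightarrow> nat \<Rightarrow> real \<Rightarrow> bool" where
  "fine_cover N m \<epsilon> \<longleftrightarrow>
     (\<exists>(k::nat) U. (\<forall>i<k. open (U i)) \<and> S \<subseteq> (\<Union>i<k. U i) \<and> (\<forall>x\<in>S. card {i. i < k \<and> x \<in> U i} \<le> m) \<and>
        (\<forall>i<k. \<forall>x\<in>S \<inter> U i. \<forall>y\<in>S \<inter> U i. \<forall>r\<in>{0..N}. dist (T r x) (T r y) < \<epsilon>))"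

lemma separating_observable:
  fixes e :: "nat \<Rightarrow> 'a \<Rightarrow> complex"
  assumes \<rho>: "0 < \<rho>" "\<rho> < b - a" and int: "\<And>n. n0 \<le> n \<Longrightarrow> \<exists>m::nat. \<rho> * fact n = real m"
    and ce: "\<And>n. continuous_on S (e n)" and e1: "\<And>n x. x \<in> S \<Longrightarrow> norm (e n x) = 1"
    and eT: "\<And>n x t. x \<in> S \<Longrightarrow> e n (T t x) = cis (2 * pi * t / fact n) * e n x"
    and cover: "\<And>\<epsilon>. 0 < \<epsilon> \<Longrightarrow> \<exists>n1. \<forall>n\<ge>n1. \<forall>m. real m = \<rho> * fact n \<longrightarrow> fine_cover (fact n) m \<epsilon>"
  obtains u where "continuous_on S u" "\<And>x. x \<in> S \<Longrightarrow> spectrum_in {a..b} (\<lambda>t. u (T t x))"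
    "\<And>x y. x \<in> S \<Longrightarrow> y \<in> S \<Longrightarrow> (\<And>n. e n x = e n y) \<Longrightarrow> (\<And>t. u (T t x) = u (T t y)) \<Longrightarrow> x = y"
proof -
  obtain \<phi> C where \<phi>: "continuous_on UNIV \<phi>" "\<phi> 0 = 1" "\<And>l::int. l \<noteq> 0 \<Longrightarrow> \<phi> (of_int l / \<rho>) = 0"
    "\<And>t. norm (\<phi> t) \<le> C / (1 + t\<^sup>2)" "spectrum_in {a..b} \<phi>"
    using interpolation_kernel[OF \<rho>] by blast
  then have ip: "interpolation {a..b} \<phi> \<rho> C" using \<rho>(1) by unfold_locales auto
  obtain D where D: "\<And>t. (\<Sum>\<^sub>\<infinity>l::int. norm (\<phi> (t - of_int l / \<rho>))) \<le> D"
    using interpolation.kernel_lattice_bound[OF ip] by blast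
  have D0: "0 \<le> D" using order_trans[OF infsum_nonneg D] by force
  define W where "W = {u. continuous_on S u \<and> (\<forall>x\<in>S. spectrum_in {a..b} (\<lambda>t. u (T t x)))}"
  obtain u where u: "u \<in> W"
    and sep: "\<And>x y. x \<in> S \<Longrightarrow> y \<in> S \<Longrightarrow> (\<And>n. e n x = e n y) \<Longrightarrow> (\<And>t. u (T t x) = u (T t y)) \<Longrightarrow> x = y"
  proof (rule separating_limit[where W = W and e = e])
    show "(\<lambda>_. 0) \<in> W" by (simp add: W_def spectrum_in_0)
    show "continuous_on S u" if "u \<in> W" for u using that by (simp add: W_def)
    show "v \<in> W" if u: "\<And>n. u n \<in> W" and lim: "uniform_limit S u v sequentially" for u v
      unfolding W_def mem_Collect_eq
    proof (intro conjI ballI)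
      show cv: "continuous_on S v"
        by (rule uniform_limit_theorem[OF _ lim]) (use u in \<open>auto simp: W_def\<close>)
      obtain B where B: "\<And>x. x \<in> S \<Longrightarrow> norm (v x) \<le> B" using bounded_obs[OF cv] by blast
      have "\<forall>\<^sub>F n in sequentially. \<forall>x\<in>S. dist (u n x) (v x) < 1" by (rule uniform_limitD[OF lim]) simp
      then obtain n1 where n1: "\<And>n x. n1 \<le> n \<Longrightarrow> x \<in> S \<Longrightarrow> dist (u n x) (v x) < 1"
        unfolding eventually_sequentially by blast
      fix x assume x: "x \<in> S"
      show "spectrum_in {a..b} (\<lambda>t. v (T t x))"
      proof (rule spectrum_in_limit[where f = "\<lambda>n t. u (n + n1) (T t x)"])
        show "spectrum_in {a..b} (\<lambda>t. u (n + n1) (T t x))" for n using u x by (simp add: W_def)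
        show "(\<lambda>t. u (n + n1) (T t x)) \<in> borel_measurable borel" for n
          by (intro borel_measurable_continuous_onI continuous_on_orbit x) (use u in \<open>simp add: W_def\<close>)
        show "norm (u (n + n1) (T t x)) \<le> B + 1" for n t
        proof -
          have "norm (u (n + n1) (T t x)) \<le> norm (v (T t x)) + dist (u (n + n1) (T t x)) (v (T t x))"
            by (metis dist_norm norm_triangle_sub)
          then show ?thesis using B[of "T t x"] n1[of "n + n1" "T t x"] x by simp
        qed
        show "(\<lambda>n. u (n + n1) (T t x)) \<longlonglongrightarrow> v (T t x)" for t
          by (intro LIMSEQ_ignore_initial_segment tendsto_uniform_limitI[OF lim]) (simp add: x)
      qed
    qed
    show "continuous_on S (e n)" for n by (rule ce)
    fix u and \<eta> d :: real assume u: "u \<in> W" and \<eta>: "0 < \<eta>" and d: "0 < d"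
    have cu: "continuous_on S u" using u by (simp add: W_def)
    \<comment> \<open>Chosen so that \<open>2 * \<eta>' * D \<le> \<eta>\<close>; the added 1 avoids
      a division by zero.\<close>
    define \<eta>' where "\<eta>' = \<eta> / (2 * (D + 1))"
    have \<eta>': "0 < \<eta>'" "2 * \<eta>' * D \<le> \<eta>"
    proof -
      show pos: "0 < \<eta>'" using \<eta> D0 by (simp add: \<eta>'_def)
      then have "2 * \<eta>' * D \<le> 2 * \<eta>' * (D + 1)" by simp
      also have "\<dots> = 2 * (D + 1) * (\<eta> / (2 * (D + 1)))" by (simp only: \<eta>'_def mult_ac)
      also have "\<dots> = \<eta>" using D0 by (intro nonzero_mult_div_cancel_left[THEN trans[OF times_divide_eq_right]]) simp
      finally show "2 * \<eta>' * D \<le> \<eta>" .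
    qed
    obtain d' where d': "0 < d'" "\<And>x y. x \<in> S \<Longrightarrow> y \<in> S \<Longrightarrow> dist x y < d' \<Longrightarrow> norm (u x - u y) < \<eta>'"
    proof -
      have "\<exists>d'>0. \<forall>x\<in>S. \<forall>y\<in>S. dist y x < d' \<longrightarrow> dist (u y) (u x) < \<eta>'"
        using compact_uniformly_continuous[OF cu compact] \<eta>'(1) unfolding uniformly_continuous_on_def by (elim allE impE)
      then obtain d' where d': "0 < d'" "\<And>x y. x \<in> S \<Longrightarrow> y \<in> S \<Longrightarrow> dist y x < d' \<Longrightarrow> dist (u y) (u x) < \<eta>'"
        by blast
      show ?thesis
      proof (rule that[OF d'(1)])
        show "norm (u x - u y) < \<eta>'" if "x \<in> S" "y \<in> S" "dist x y < d'" for x y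
          using d'(2)[OF that(2,1,3)] by (simp add: dist_norm)
      qed
    qed
    \<comment> \<open>\<open>d\<close> is the scale at which points are to be separated,
      \<open>d'\<close> the scale at which \<open>u\<close> oscillates by less than \<eta>'.\<close>
    define \<epsilon> where "\<epsilon> = min d d'"
    have \<epsilon>: "0 < \<epsilon>" using d d' by (simp add: \<epsilon>_def)
    from cover[OF \<epsilon>] obtain n1 where n1: "\<forall>n\<ge>n1. \<forall>m. real m = \<rho> * fact n \<longrightarrow> fine_cover (fact n) m \<epsilon>" ..
    define n where "n = max n0 n1"
    have "n0 \<le> n" "n1 \<le> n" by (simp_all add: n_def)
    obtain m :: nat where m: "\<rho> * fact n = real m" using int[OF \<open>n0 \<le> n\<close>] by blast
    have "fine_cover (fact n) m \<epsilon>" using n1 \<open>n1 \<le> n\<close> m by simp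
    then obtain k :: nat and U where U: "\<forall>i<k. open (U i)" "S \<subseteq> (\<Union>i<k. U i)" "\<forall>x\<in>S. card {i. i < k \<and> x \<in> U i} \<le> m"
      "\<forall>i<k. \<forall>x\<in>S \<inter> U i. \<forall>y\<in>S \<inter> U i. \<forall>r\<in>{0..fact n}. dist (T r x) (T r y) < \<epsilon>"
      unfolding fine_cover_def by (elim exE conjE) (rule that, assumption+)
    have m0: "0 < m"
    proof -
      have "0 < \<rho> * fact n" using \<rho> by simp
      then show ?thesis unfolding m by simp
    qed
    obtain v where v: "continuous_on S v" "\<And>x. x \<in> S \<Longrightarrow> norm (v x - u x) \<le> 2 * \<eta>' * D"
      "\<And>x. x \<in> S \<Longrightarrow> spectrum_in {a..b} (\<lambda>t. v (T t x))"
      "\<And>x y. x \<in> S \<Longrightarrow> y \<in> S \<Longrightarrow> e n x = e n y \<Longrightarrow> (\<And>t. v (T t x) = v (T t y)) \<Longrightarrow> dist x y < \<epsilon>"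
    proof (rule perturbation[where U = U and n = k and \<epsilon> = \<epsilon> and \<eta> = \<eta>', OF ip D m0 _ m ce e1 eT cu])
      show "(0::real) < fact n" by simp
      show "norm (u x - u y) < \<eta>'" if "x \<in> S" "y \<in> S" "dist x y < \<epsilon>" for x y
        using d'(2)[OF that(1,2)] that(3) by (simp add: \<epsilon>_def)
      show "spectrum_in {a..b} (\<lambda>t. u (T t x))" if "x \<in> S" for x using u that by (simp add: W_def)
      show "open (U i)" if "i < k" for i using U(1) that by blast
      show "S \<subseteq> (\<Union>i<k. U i)" by (rule U(2))
      show "card {i. i < k \<and> x \<in> U i} \<le> m" if "x \<in> S" for x using U(3) that by blast
      show "dist (T r x) (T r y) < \<epsilon>" if "i < k" "x \<in> S \<inter> U i" "y \<in> S \<inter> U i" "0 \<le> r" "r \<le> fact n" for i x y r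
      proof -
        have "r \<in> {0..fact n}" using that by simp
        then show ?thesis using U(4) that(1-3) by blast
      qed
      show "0 < \<eta>'" by (rule \<eta>'(1))
      fix v assume v: "continuous_on S v" "\<And>x. x \<in> S \<Longrightarrow> norm (v x - u x) \<le> 2 * \<eta>' * D"
        "\<And>x. x \<in> S \<Longrightarrow> spectrum_in {a..b} (\<lambda>t. v (T t x))"
        "\<And>x y. x \<in> S \<Longrightarrow> y \<in> S \<Longrightarrow> e n x = e n y \<Longrightarrow> (\<And>t. v (T t x) = v (T t y)) \<Longrightarrow> dist x y < \<epsilon>"
      show thesis by (rule that[OF v])
    qed
    show "\<exists>v\<in>W. (\<forall>x\<in>S. norm (v x - u x) \<le> \<eta>) \<and>
       (\<forall>x y. x \<in> S \<longrightarrow> y \<in> S \<longrightarrow> (\<forall>i. e i x = e i y) \<longrightarrow> (\<forall>t. v (T t x) = v (T t y)) \<longrightarrow> dist x y < d)"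
    proof (intro bexI[of _ v] conjI allI impI ballI)
      show "v \<in> W" using v by (simp add: W_def)
      show "norm (v x - u x) \<le> \<eta>" if "x \<in> S" for x using v(2)[OF that] \<eta>'(2) by simp
      show "dist x y < d" if "x \<in> S" "y \<in> S" "\<forall>i. e i x = e i y" "\<forall>t. v (T t x) = v (T t y)" for x y
        using v(4)[of x y] that by (simp add: \<epsilon>_def)
    qed
  qed blast
  show ?thesis
  proof (rule that[of u])
    show "continuous_on S u" "\<And>x. x \<in> S \<Longrightarrow> spectrum_in {a..b} (\<lambda>t. u (T t x))" using u by (simp_all add: W_def)
  qed (rule sep)
qed

end

section \<open>Encoding the solenoid in isolated frequencies\<close>

text \<open>Frequencies count for the spectrum only where the coefficient is nonzero; this allows
  one term to be removed and its frequency to be dropped from \<open>J\<close>.\<close>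

lemma exponential_series:
  fixes c :: "nat \<Rightarrow> complex"
  assumes c: "\<And>j. norm (c j) \<le> M j" and M: "summable M"
  shows "summable (\<lambda>j. c j * cis (2 * pi * t * \<omega> j))"
    and "norm (\<Sum>j. c j * cis (2 * pi * t * \<omega> j)) \<le> suminf M"
    and "(\<lambda>t. \<Sum>j. c j * cis (2 * pi * t * \<omega> j)) \<in> borel_measurable borel"
    and "(\<And>j. c j \<noteq> 0 \<Longrightarrow> \<omega> j \<in> J) \<Longrightarrow> spectrum_in J (\<lambda>t. \<Sum>j. c j * cis (2 * pi * t * \<omega> j))"
proof -
  have s: "summable (\<lambda>j. norm (c j * cis (2 * pi * t * \<omega> j)))" for t
    by (rule summable_comparison_test'[OF M]) (use c in \<open>simp add: norm_mult\<close>)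
  then show "summable (\<lambda>j. c j * cis (2 * pi * t * \<omega> j))" for t by (rule summable_norm_cancel)
  then have lim: "(\<lambda>n. \<Sum>j<n. c j * cis (2 * pi * t * \<omega> j)) \<longlonglongrightarrow> (\<Sum>j. c j * cis (2 * pi * t * \<omega> j))" for t
    by (rule summable_LIMSEQ)
  show "norm (\<Sum>j. c j * cis (2 * pi * t * \<omega> j)) \<le> suminf M"
    by (rule order_trans[OF summable_norm[OF s]]) (use c s M in \<open>auto intro!: suminf_le simp: norm_mult\<close>)
  have m: "(\<lambda>t. \<Sum>j<n. c j * cis (2 * pi * t * \<omega> j)) \<in> borel_measurable borel" for n by measurable
  show "(\<lambda>t. \<Sum>j. c j * cis (2 * pi * t * \<omega> j)) \<in> borel_measurable borel"
    by (rule borel_measurable_LIMSEQ_metric[OF m lim])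
  have M0: "0 \<le> M j" for j using order_trans[OF norm_ge_zero c] .
  show "spectrum_in J (\<lambda>t. \<Sum>j. c j * cis (2 * pi * t * \<omega> j))" if J: "\<And>j. c j \<noteq> 0 \<Longrightarrow> \<omega> j \<in> J"
  proof (rule spectrum_in_limit[OF _ m _ lim])
    show "spectrum_in J (\<lambda>t. \<Sum>j<n. c j * cis (2 * pi * t * \<omega> j))" for n
    proof (rule spectrum_in_sum)
      show "spectrum_in J (\<lambda>t. c j * cis (2 * pi * t * \<omega> j))" for j
        using J[of j] by (cases "c j = 0") (auto simp: spectrum_in_0 intro!: spectrum_in_cmult spectrum_in_exponential)
      show "norm (c j * cis (2 * pi * t * \<omega> j)) \<le> suminf M" for j t
        using c[of j] sum_le_suminf[OF M, of "{j}"] M0 by (auto simp: norm_mult)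
    qed auto
    show "norm (\<Sum>j<n. c j * cis (2 * pi * t * \<omega> j)) \<le> suminf M" for n t
    proof -
      have "norm (\<Sum>j<n. c j * cis (2 * pi * t * \<omega> j)) \<le> (\<Sum>j<n. M j)"
        by (rule sum_norm_le) (use c in \<open>simp add: norm_mult\<close>)
      also have "\<dots> \<le> suminf M" by (rule sum_le_suminf[OF M]) (use M0 in auto)
      finally show ?thesis .
    qed
  qed
qed

lemma isolated_in_decreasing_sequence:
  fixes \<omega> :: "nat \<Rightarrow> real"
  assumes dec: "\<And>j. \<omega> (Suc j) < \<omega> j" and c: "c < \<omega> i"
  obtains r where "0 < r" "c \<le> \<omega> i - r" "\<And>j. j \<noteq> i \<Longrightarrow> r \<le> \<bar>\<omega> j - \<omega> i\<bar>"
proof -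
  have mono: "\<omega> k \<le> \<omega> j" if "j \<le> k" for j k
    using that by (induction k rule: dec_induct) (auto intro: order_trans[OF less_imp_le[OF dec]])
  \<comment> \<open>The gap to the preceding term. The first term has none, and \<open>i - 1\<close>
    would then be \<open>i\<close> itself, so the distance to \<open>c\<close> is repeated
    instead.\<close>
  define r1 where "r1 = (if i = 0 then \<omega> i - c else \<omega> (i - 1) - \<omega> i)"
  have r1: "0 < r1" using dec[of "i - 1"] c by (auto simp: r1_def)
  define r where "r = min (\<omega> i - c) (min (\<omega> i - \<omega> (Suc i)) r1)"
  show ?thesis
  proof (rule that[of r])
    show "0 < r" using r1 dec[of i] c by (simp add: r_def)
    show "c \<le> \<omega> i - r" by (auto simp: r_def)
    fix j assume "j \<noteq> i"
    then consider "Suc i \<le> j" | "j \<le> i - 1" "i \<noteq> 0" by linarith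
    then show "r \<le> \<bar>\<omega> j - \<omega> i\<bar>"
    proof cases
      case 1 then show ?thesis using mono[OF 1] dec[of i] by (auto simp: r_def)
    next
      case 2 then show ?thesis using mono[OF 2(1)] dec[of "i - 1"] by (auto simp: r_def r1_def)
    qed
  qed
qed

context compact_flow
begin

text \<open>The factor of circles is encoded in the frequencies \<open>\<alpha> + 1 / n!\<close>, which lie above the
  spectral interval of \<open>u\<close> and are isolated from each other, so that each coefficient can be
  read off with a spectral cutoff.\<close>

lemma bandlimited_observable:
  fixes e :: "nat \<Rightarrow> 'a \<Rightarrow> complex"
  assumes \<rho>: "0 < \<rho>" "\<rho> < b - a" and int: "\<And>n. n0 \<le> n \<Longrightarrow> \<exists>m::nat. \<rho> * fact n = real m"
    and ce: "\<And>n. continuous_on S (e n)" and e1: "\<And>n x. x \<in> S \<Longrightarrow> norm (e n x) = 1"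
    and eT: "\<And>n x t. x \<in> S \<Longrightarrow> e n (T t x) = cis (2 * pi * t / fact n) * e n x"
    and tower: "\<And>n x. x \<in> S \<Longrightarrow> e n x = e (Suc n) x ^ Suc n"
    and cover: "\<And>\<epsilon>. 0 < \<epsilon> \<Longrightarrow> \<exists>n1. \<forall>n\<ge>n1. \<forall>m. real m = \<rho> * fact n \<longrightarrow> fine_cover (fact n) m \<epsilon>"
  obtains v where "continuous_on S v" "\<And>x. x \<in> S \<Longrightarrow> norm (v x) \<le> 1"
    "\<And>x. x \<in> S \<Longrightarrow> spectrum_in {a..b} (\<lambda>t. v (T t x))"
    "\<And>x y. x \<in> S \<Longrightarrow> y \<in> S \<Longrightarrow> (\<And>t. v (T t x) = v (T t y)) \<Longrightarrow> x = y"
proof -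
  \<comment> \<open>Splits the band: [a, c] is still wider than \<rho> and carries \<open>u\<close>,
    while the space up to \<open>b\<close> carries the solenoid.\<close>
  obtain c where c: "a + \<rho> < c" "c < b" using \<rho> dense[of "a + \<rho>" b] by auto
  obtain u where cu: "continuous_on S u" and su: "\<And>x. x \<in> S \<Longrightarrow> spectrum_in {a..c} (\<lambda>t. u (T t x))"
    and sep: "\<And>x y. x \<in> S \<Longrightarrow> y \<in> S \<Longrightarrow> (\<And>n. e n x = e n y) \<Longrightarrow> (\<And>t. u (T t x) = u (T t y)) \<Longrightarrow> x = y"
  proof (rule separating_observable[OF \<rho>(1) _ int ce e1 eT cover])
    show "\<rho> < c - a" using c by simp
  qed blast+
  obtain B where B: "\<And>x. x \<in> S \<Longrightarrow> norm (u x) \<le> B" using bounded_obs[OF cu] by blast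
  define s where "s = 1 / (2 * (\<bar>B\<bar> + 1))"
  have s: "0 < s" by (simp add: s_def)
  have su2: "norm (of_real s * u x) \<le> 1 / 2" if "x \<in> S" for x
  proof -
    have "norm (of_real s * u x) = s * norm (u x)" using s by (simp add: norm_mult)
    also have "\<dots> \<le> s * (\<bar>B\<bar> + 1)" using B[OF that] s by (intro mult_left_mono) auto
    also have "\<dots> = 1 / 2" by (simp add: s_def)
    finally show ?thesis .
  qed
  \<comment> \<open>Makes 1 / k! smaller than b - c, so that a multiple \<alpha> of 1 / k! lies
    strictly between. An eigenfunction of frequency \<alpha> is then an integer power of
    \<open>e k\<close>.\<close>
  obtain k :: nat where k: "1 / (b - c) < real k" using reals_Archimedean2 by blast
  define \<alpha> where "\<alpha> = (of_int (\<lfloor>c * fact k\<rfloor> + 1) / fact k :: real)"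
  have \<alpha>: "c < \<alpha>" "\<alpha> < b"
  proof -
    have "c * fact k < of_int (\<lfloor>c * fact k\<rfloor> + 1)" by linarith
    then show "c < \<alpha>" by (simp add: \<alpha>_def pos_less_divide_eq)
    have "real k \<le> fact k" using fact_ge_self[of k] by (metis of_nat_fact of_nat_mono)
    then have "1 / (b - c) < fact k" using k by linarith
    then have "1 < (b - c) * fact k" using c by (simp add: pos_divide_less_eq mult.commute)
    then have "of_int (\<lfloor>c * fact k\<rfloor> + 1) < b * fact k" by (simp add: left_diff_distrib) linarith
    then show "\<alpha> < b" by (simp add: \<alpha>_def pos_divide_less_eq)
  qed
  obtain n1' :: nat where n1': "1 / (b - \<alpha>) < real n1'" using reals_Archimedean2 by blast
  \<comment> \<open>The successor excludes 0, where 0! = 1! would make two frequencies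
    coincide.\<close>
  define n1 where "n1 = Suc n1'"
  define \<omega> where "\<omega> j = \<alpha> + 1 / fact (n1 + j)" for j
  have \<omega>c: "c < \<omega> j" for j
  proof -
    have "0 < 1 / (fact (n1 + j) :: real)" by simp
    then show ?thesis using \<alpha> unfolding \<omega>_def by linarith
  qed
  have \<omega>dec: "\<omega> (Suc j) < \<omega> j" for j
  proof -
    have "fact (n1 + j) < (fact (n1 + Suc j) :: real)" by (rule fact_less_mono) (auto simp: n1_def)
    then show ?thesis by (simp add: \<omega>_def divide_strict_left_mono)
  qed
  have \<omega>b: "\<omega> j \<le> b" for j
  proof -
    have "real n1' \<le> real (n1 + j)" by (simp add: n1_def)
    also have "\<dots> \<le> fact (n1 + j)" using fact_ge_self[of "n1 + j"] by (metis of_nat_fact of_nat_mono)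
    finally have "1 / (b - \<alpha>) < fact (n1 + j)" using n1' by linarith
    then have "1 < (b - \<alpha>) * fact (n1 + j)" using \<alpha> by (simp add: pos_divide_less_eq mult.commute)
    then have "1 / fact (n1 + j) < b - \<alpha>" by (simp add: pos_divide_less_eq)
    then show ?thesis by (simp add: \<omega>_def)
  qed
  define P where "P x = e k x powi (\<lfloor>c * fact k\<rfloor> + 1)" for x
  have P1: "norm (P x) = 1" if "x \<in> S" for x using e1[OF that] by (simp add: P_def norm_power_int)
  have PT: "P (T t x) = cis (2 * pi * t * \<alpha>) * P x" if "x \<in> S" for x t
    using eT[OF that] by (simp add: P_def power_int_mult_distrib cis_power_int \<alpha>_def mult_ac)
  have cP: "continuous_on S P"
  proof -
    have "e k x \<noteq> 0" if "x \<in> S" for x using e1[OF that, of k] by auto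
    then show ?thesis unfolding P_def by (intro continuous_on_power_int ce) blast
  qed
  define G where "G j x = P x * e (n1 + j) x" for j x
  have G1: "norm (G j x) = 1" if "x \<in> S" for j x using P1[OF that] e1[OF that] by (simp add: G_def norm_mult)
  have GT: "G j (T t x) = G j x * cis (2 * pi * t * \<omega> j)" if "x \<in> S" for j x t
    using PT[OF that, of t] eT[OF that, of "n1 + j" t] by (simp add: G_def \<omega>_def distrib_left cis_mult[symmetric])
  have cG: "continuous_on S (G j)" for j unfolding G_def by (intro continuous_intros cP ce)
  \<comment> \<open>Weights with sum 1/2, matching the bound 1/2 for the scaled \<open>u\<close>, so
    that the sum stays in the unit ball.\<close>
  define M where "M j = (1/2 :: real) ^ Suc (Suc j)" for j
  have Ms: "M sums (1 / 2)"
    using sums_mult[OF geometric_sums[of "1/2 :: real"], of "1/4"] by (simp add: M_def[abs_def])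
  have sM: "summable M" "suminf M = 1 / 2" using Ms by (auto simp: sums_iff)
  have M0: "0 < M j" for j by (simp add: M_def)
  define h where "h x = (\<Sum>j. of_real (M j) * G j x)" for x
  have normMG: "norm (of_real (M j) * G j x) \<le> M j" if "x \<in> S" for j x
    using G1[OF that] M0[of j] by (simp add: norm_mult)
  have hT: "h (T t x) = (\<Sum>j. (of_real (M j) * G j x) * cis (2 * pi * t * \<omega> j))" if "x \<in> S" for t x
    using GT[OF that] by (simp add: h_def mult.assoc)
  have hle: "norm (h x) \<le> 1 / 2" if "x \<in> S" for x
    using exponential_series(2)[where t = 0 and \<omega> = \<omega>, OF normMG[OF that] sM(1)] sM(2) hT[OF that, of 0] that by simp
  have ch: "continuous_on S h"
    unfolding h_def
  proof (rule uniform_limit_theorem[OF _ Weierstrass_m_test[OF normMG sM(1)]])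
    show "\<forall>\<^sub>F n in sequentially. continuous_on S (\<lambda>x. \<Sum>j<n. of_real (M j) * G j x)"
      by (intro always_eventually allI continuous_intros cG)
  qed auto
  define v where "v x = of_real s * u x + h x" for x
  have mu: "(\<lambda>t. of_real s * u (T t x)) \<in> borel_measurable borel" if "x \<in> S" for x
  proof -
    have [measurable]: "(\<lambda>t. u (T t x)) \<in> borel_measurable borel"
      by (intro borel_measurable_continuous_onI continuous_on_orbit cu that)
    show ?thesis by measurable
  qed
  show ?thesis
  proof (rule that[of v])
    show "continuous_on S v" unfolding v_def by (intro continuous_intros cu ch)
    show "norm (v x) \<le> 1" if "x \<in> S" for x
      using norm_triangle_ineq[of "of_real s * u x" "h x"] su2[OF that] hle[OF that] by (simp add: v_def)
    show "spectrum_in {a..b} (\<lambda>t. v (T t x))" if x: "x \<in> S" for x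
      unfolding v_def
    proof (rule spectrum_in_add)
      show "spectrum_in {a..b} (\<lambda>t. of_real s * u (T t x))"
        using c \<rho> by (intro spectrum_in_cmult spectrum_in_mono[OF su[OF x]]) auto
      show "spectrum_in {a..b} (\<lambda>t. h (T t x))"
        unfolding hT[OF x]
      proof (rule exponential_series(4)[OF normMG[OF x] sM(1)])
        show "\<omega> j \<in> {a..b}" for j using \<omega>b[of j] \<omega>c[of j] c \<rho> by auto
      qed
      show "(\<lambda>t. h (T t x)) \<in> borel_measurable borel"
        unfolding hT[OF x] by (rule exponential_series(3)[OF normMG[OF x] sM(1)])
      show "norm (of_real s * u (T t x)) \<le> 1 / 2" "norm (h (T t x)) \<le> 1 / 2" for t
        using su2 hle x by simp_all
    qed (rule mu[OF x])
    show "x = y" if x: "x \<in> S" and y: "y \<in> S" and eq: "\<And>t. v (T t x) = v (T t y)" for x y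
    proof -
      have Geq: "G i x = G i y" for i
      proof -
        obtain r where r: "0 < r" "c \<le> \<omega> i - r" "\<And>j. j \<noteq> i \<Longrightarrow> r \<le> \<bar>\<omega> j - \<omega> i\<bar>"
          using isolated_in_decreasing_sequence[where \<omega> = \<omega> and i = i, OF \<omega>dec \<omega>c] by blast
        obtain \<theta> where \<theta>: "integrable lborel \<theta>" "(LINT t|lborel. \<theta> t) \<noteq> 0"
          "\<And>\<eta>. r \<le> \<bar>\<eta>\<bar> \<Longrightarrow> (LINT t|lborel. \<theta> t * cis (2 * pi * t * \<eta>)) = 0"
          using spectral_cutoff[OF r(1)] by blast
        \<comment> \<open>The cutoff modulated to frequency \<open>\<omega> i\<close>: integration
          against it annihilates the interval \<open>{a..c}\<close> and every other frequency,
          leaving a nonzero multiple of \<open>G i\<close>.\<close>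
        define \<theta>' where "\<theta>' t = \<theta> t * cis (- (2 * pi * t * \<omega> i))" for t
        have int\<theta>: "integrable lborel \<theta>'" unfolding \<theta>'_def by (rule integrable_cis_mult[OF \<theta>(1)]) measurable
        define J where "J = {a..c} \<union> \<omega> ` (- {i})"
        have kill: "(LINT t|lborel. \<theta>' t * cis (2 * pi * t * \<xi>)) = 0" if "\<xi> \<in> J" for \<xi>
        proof -
          have "\<theta>' t * cis (2 * pi * t * \<xi>) = \<theta> t * cis (2 * pi * t * (\<xi> - \<omega> i))" for t
            by (simp add: \<theta>'_def mult.assoc cis_mult right_diff_distrib)
          moreover have "r \<le> \<bar>\<xi> - \<omega> i\<bar>" using that r(2,3) by (auto simp: J_def)
          ultimately show ?thesis using \<theta>(3) by simp
        qed
        have val: "(LINT t|lborel. v (T t z) * \<theta>' t) = of_real (M i) * G i z * (LINT t|lborel. \<theta> t)" if z: "z \<in> S" for z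
        proof -
          define d where "d j = (if j = i then 0 else of_real (M j) * G j z)" for j
          have dM: "norm (d j) \<le> M j" for j using normMG[OF z, of j] less_imp_le[OF M0[of j]] by (cases "j = i") (simp_all add: d_def)
          define E where "E t = (\<Sum>j. d j * cis (2 * pi * t * \<omega> j))" for t
          have hE: "h (T t z) = E t + of_real (M i) * G i z * cis (2 * pi * t * \<omega> i)" for t
          proof -
            define f where "f j = (if j = i then of_real (M i) * G i z * cis (2 * pi * t * \<omega> i) else 0)" for j
            have f: "f sums (of_real (M i) * G i z * cis (2 * pi * t * \<omega> i))"
              unfolding f_def by (rule sums_single)
            have "(\<lambda>j. d j * cis (2 * pi * t * \<omega> j)) sums E t"
              unfolding E_def by (rule summable_sums[OF exponential_series(1)[where c = d, OF dM sM(1)]])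
            from sums_add[OF this f] have "(\<lambda>j. (of_real (M j) * G j z) * cis (2 * pi * t * \<omega> j)) sums (E t + of_real (M i) * G i z * cis (2 * pi * t * \<omega> i))"
              by (rule sums_cong[THEN iffD1, rotated]) (simp add: d_def f_def)
            then show ?thesis unfolding hT[OF z] by (simp add: sums_iff)
          qed
          have mE: "E \<in> borel_measurable borel" unfolding E_def by (rule exponential_series(3)[where c = d, OF dM sM(1)])
          have leE: "norm (E t) \<le> 1 / 2" for t
            using exponential_series(2)[where c = d, OF dM sM(1)] sM(2) by (simp add: E_def)
          have spE: "spectrum_in J E" unfolding E_def
            by (rule exponential_series(4)[where c = d, OF dM sM(1)]) (auto simp: J_def d_def)
          have "spectrum_in J (\<lambda>t. of_real s * u (T t z) + E t)"
          proof (rule spectrum_in_add[OF _ spE mu[OF z] mE _ leE])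
            show "spectrum_in J (\<lambda>t. of_real s * u (T t z))"
              by (intro spectrum_in_cmult spectrum_in_mono[OF su[OF z]]) (auto simp: J_def)
            show "norm (of_real s * u (T t z)) \<le> 1 / 2" for t using su2 z by simp
          qed
          then have 0: "(LINT t|lborel. (of_real s * u (T t z) + E t) * \<theta>' t) = 0"
            using int\<theta> kill unfolding spectrum_in_def by blast
          have i1: "integrable lborel (\<lambda>t. (of_real s * u (T t z) + E t) * \<theta>' t)"
          proof (rule integrable_bounded_mult[OF _ _ int\<theta>])
            show "(\<lambda>t. of_real s * u (T t z) + E t) \<in> borel_measurable borel"
              by (intro borel_measurable_add mu[OF z] mE)
            show "norm (of_real s * u (T t z) + E t) \<le> 1" for t
              using norm_triangle_ineq[of "of_real s * u (T t z)" "E t"] su2[of "T t z"] leE[of t] z by simp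
          qed
          have "v (T t z) * \<theta>' t = (of_real s * u (T t z) + E t) * \<theta>' t + of_real (M i) * G i z * \<theta> t" for t
          proof -
            have "cis (2 * pi * t * \<omega> i) * \<theta>' t = \<theta> t" by (simp add: \<theta>'_def mult.left_commute cis_mult)
            then show ?thesis by (simp add: v_def hE distrib_right mult.assoc)
          qed
          then have "(LINT t|lborel. v (T t z) * \<theta>' t) = (LINT t|lborel. (of_real s * u (T t z) + E t) * \<theta>' t + of_real (M i) * G i z * \<theta> t)"
            by simp
          also have "\<dots> = 0 + of_real (M i) * G i z * (LINT t|lborel. \<theta> t)"
            unfolding 0[symmetric]
            by (subst Bochner_Integration.integral_add[OF i1 integrable_mult_right[OF \<theta>(1)]]) simp
          finally show ?thesis by simp
        qed
        have "of_real (M i) * G i x * (LINT t|lborel. \<theta> t) = of_real (M i) * G i y * (LINT t|lborel. \<theta> t)"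
          using val[OF x, symmetric] val[OF y] by (simp only: eq)
        then show ?thesis using \<theta>(2) M0[of i] by simp
      qed
      have ne: "e n z \<noteq> 0" "P z \<noteq> 0" if "z \<in> S" for n z
        using e1[OF that, of n] P1[OF that] by auto
      \<comment> \<open>Equality of the \<open>G j\<close> determines the characters only up to the
        common factor \<open>P\<close>; the compatibility of the tower must show that this ambiguity
        \<open>w\<close> is 1.\<close>
      define w where "w = P y / P x"
      have w0: "w \<noteq> 0" using ne x y by (simp add: w_def)
      have ew: "e (n1 + j) x = w * e (n1 + j) y" for j
        using Geq[of j] ne(2)[OF x] by (simp add: G_def w_def field_simps)
      have "w ^ (n1 + j) = 1" for j
      proof -
        have "w * e (n1 + j) y = e (n1 + j) x" by (rule ew[symmetric])
        also have "\<dots> = e (n1 + Suc j) x ^ Suc (n1 + j)" using tower[OF x, of "n1 + j"] by (simp only: add_Suc_right)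
        also have "\<dots> = w ^ Suc (n1 + j) * e (n1 + Suc j) y ^ Suc (n1 + j)" by (simp only: ew power_mult_distrib)
        also have "\<dots> = w ^ Suc (n1 + j) * e (n1 + j) y"
          using tower[OF y, of "n1 + j"] by (simp only: add_Suc_right)
        finally have "w * e (n1 + j) y = w * w ^ (n1 + j) * e (n1 + j) y" by simp
        then show ?thesis using w0 ne(1)[OF y] by simp
      qed
      \<comment> \<open>Two consecutive powers of \<open>w\<close> equal 1. The tower then carries
        equality of the characters down to small indices.\<close>
      from this[of 0] this[of 1] have "w = 1" by simp
      then have large: "e n x = e n y" if "n1 \<le> n" for n
        using ew[of "n - n1"] that by simp
      have en: "e n x = e n y" for n
      proof (cases "n1 \<le> n")
        case False
        then have "n \<le> n1" by simp
        then show ?thesis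
        proof (induction n rule: inc_induct)
          case base show ?case by (rule large) simp
        next
          case (step n)
          then show ?case using tower[OF x, of n] tower[OF y, of n] by (simp only:)
        qed
      qed (rule large)
      have "u (T t x) = u (T t y)" for t
      proof -
        have "h (T t x) = h (T t y)" unfolding h_def GT[OF x] GT[OF y] Geq ..
        then show ?thesis using eq[of t] s by (simp add: v_def)
      qed
      then show ?thesis using sep[OF x y en] by blast
    qed
  qed
qed

end

section \<open>Covering dimension of products\<close>

text \<open>Lets a target space move between the type of real sequences and a metric type in which
  products are treated.\<close>

lemma covering_dim_le_homeomorphic:
  assumes "X homeomorphic_space Y" and dim: "covering_dim_le X n"
  shows "covering_dim_le Y n"
proof -
  obtain f g where fg: "homeomorphic_maps X Y f g" using assms(1) unfolding homeomorphic_space_def by blast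
  have cf: "continuous_map X Y f" and cg: "continuous_map Y X g"
    and gf: "\<And>x. x \<in> topspace X \<Longrightarrow> g (f x) = x" and fg': "\<And>y. y \<in> topspace Y \<Longrightarrow> f (g y) = y"
    using fg unfolding homeomorphic_maps_def by blast+
  have fX: "\<And>x. x \<in> topspace X \<Longrightarrow> f x \<in> topspace Y" and gY: "\<And>y. y \<in> topspace Y \<Longrightarrow> g y \<in> topspace X"
    using continuous_map_image_subset_topspace[OF cf] continuous_map_image_subset_topspace[OF cg] by blast+
  show ?thesis
    unfolding covering_dim_le_def
  proof (intro allI impI, elim conjE)
    fix \<U> assume op: "\<forall>U\<in>\<U>. openin Y U" and cov: "\<Union>\<U> = topspace Y"
    define pull where "pull U = {x \<in> topspace X. f x \<in> U}" for U
    define push where "push V = {y \<in> topspace Y. g y \<in> V}" for V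
    have opull: "openin X (pull U)" if "U \<in> \<U>" for U
      unfolding pull_def using op that by (intro openin_continuous_map_preimage[OF cf]) blast
    have opush: "openin Y (push V)" if "openin X V" for V
      unfolding push_def by (rule openin_continuous_map_preimage[OF cg that])
    have cpull: "\<Union>(pull ` \<U>) = topspace X"
    proof -
      have "x \<in> \<Union>(pull ` \<U>)" if "x \<in> topspace X" for x
      proof -
        have "f x \<in> \<Union>\<U>" using fX[OF that] cov by simp
        then show ?thesis using that by (auto simp: pull_def)
      qed
      then show ?thesis by (auto simp: pull_def)
    qed
    have "(\<forall>U\<in>pull ` \<U>. openin X U) \<and> \<Union>(pull ` \<U>) = topspace X" using opull cpull by simp
    then obtain \<V> where V: "\<forall>V\<in>\<V>. openin X V \<and> (\<exists>U\<in>pull ` \<U>. V \<subseteq> U)" "\<Union>\<V> = topspace X"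
      "\<forall>x\<in>topspace X. finite {V\<in>\<V>. x \<in> V} \<and> int (card {V\<in>\<V>. x \<in> V}) \<le> n + 1"
      using dim[unfolded covering_dim_le_def, THEN spec, of "pull ` \<U>"] by (elim impE) auto
    show "\<exists>\<V>. (\<forall>V\<in>\<V>. openin Y V \<and> (\<exists>U\<in>\<U>. V \<subseteq> U)) \<and> \<Union>\<V> = topspace Y \<and>
             (\<forall>x\<in>topspace Y. finite {V\<in>\<V>. x \<in> V} \<and> int (card {V\<in>\<V>. x \<in> V}) \<le> n + 1)"
    proof (intro exI[of _ "push ` \<V>"] conjI ballI)
      fix W assume "W \<in> push ` \<V>"
      then obtain V where VW: "V \<in> \<V>" "W = push V" by blast
      show "openin Y W" using opush V(1) VW by simp
      obtain U where U: "U \<in> \<U>" "V \<subseteq> pull U" using V(1) VW(1) by blast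
      have "push V \<subseteq> U" using U(2) fg' by (force simp: push_def pull_def)
      then show "\<exists>U\<in>\<U>. W \<subseteq> U" using U(1) VW(2) by blast
    next
      have "y \<in> \<Union>(push ` \<V>)" if "y \<in> topspace Y" for y
      proof -
        have "g y \<in> \<Union>\<V>" using gY[OF that] V(2) by simp
        then show ?thesis using that by (auto simp: push_def)
      qed
      then show "\<Union>(push ` \<V>) = topspace Y" by (auto simp: push_def)
    next
      fix y assume y: "y \<in> topspace Y"
      have eq: "{W \<in> push ` \<V>. y \<in> W} = push ` {V \<in> \<V>. g y \<in> V}" using y by (auto simp: push_def)
      have fin: "finite {V \<in> \<V>. g y \<in> V}" "int (card {V \<in> \<V>. g y \<in> V}) \<le> n + 1" using V(3) gY[OF y] by auto
      show "finite {W \<in> push ` \<V>. y \<in> W}" unfolding eq using fin by simp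
      show "int (card {W \<in> push ` \<V>. y \<in> W}) \<le> n + 1"
        unfolding eq using card_image_le[OF fin(1), of push] fin(2) by linarith
    qed
  qed
qed

text \<open>A finite subcover of a refinement has no larger multiplicity.\<close>

lemma finite_refinement:
  fixes S :: "'a::metric_space set"
  assumes S: "compact S" and dim: "covering_dim_le (top_of_set S) n"
    and op: "\<And>U. U \<in> \<U> \<Longrightarrow> openin (top_of_set S) U" and cov: "\<Union>\<U> = S"
  obtains \<V> where "finite \<V>" "\<And>V. V \<in> \<V> \<Longrightarrow> openin (top_of_set S) V" "\<And>V. V \<in> \<V> \<Longrightarrow> \<exists>U\<in>\<U>. V \<subseteq> U"
    "\<Union>\<V> = S" "\<And>x. x \<in> S \<Longrightarrow> int (card {V\<in>\<V>. x \<in> V}) \<le> n + 1"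
proof -
  obtain \<V> where V: "\<forall>V\<in>\<V>. openin (top_of_set S) V \<and> (\<exists>U\<in>\<U>. V \<subseteq> U)" "\<Union>\<V> = S"
      "\<forall>x\<in>S. finite {V\<in>\<V>. x \<in> V} \<and> int (card {V\<in>\<V>. x \<in> V}) \<le> n + 1"
    using dim[unfolded covering_dim_le_def, rule_format, of \<U>] op cov by auto
  obtain \<D> where D: "\<D> \<subseteq> \<V>" "finite \<D>" "S \<subseteq> \<Union>\<D>"
    using S[unfolded compact_eq_openin_cover, rule_format, of \<V>] V by auto
  show ?thesis
  proof (rule that[of \<D>])
    show "\<Union>\<D> = S" using D V by blast
    show "int (card {V\<in>\<D>. x \<in> V}) \<le> n + 1" if "x \<in> S" for x
    proof -
      have "card {V\<in>\<D>. x \<in> V} \<le> card {V\<in>\<V>. x \<in> V}" using V(3) that D(1) by (intro card_mono) auto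
      moreover have "int (card {V\<in>\<V>. x \<in> V}) \<le> n + 1" using V(3) that by blast
      ultimately show ?thesis by linarith
    qed
  qed (use D V in auto)
qed

section \<open>Ostrand's families and the product theorem\<close>

text \<open>Such a family contributes at most 1 to the multiplicity at any point, so dimension can
  be counted in families instead of sets. It need not cover \<open>S\<close>.\<close>

definition disjoint_refinement :: "'a::metric_space set \<Rightarrow> 'a set set \<Rightarrow> 'a set set \<Rightarrow> bool" where
  "disjoint_refinement S \<U> \<F> \<longleftrightarrow> disjoint \<F> \<and> (\<forall>V\<in>\<F>. openin (top_of_set S) V \<and> (\<exists>U\<in>\<U>. V \<subseteq> U))"

text \<open>The member \<open>i\<close> of the family consists of the open barycentric stars of the \<open>i\<close>-simplices
  of the nerve.\<close>

lemma disjoint_refinements_base: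
  fixes S :: "'a::metric_space set" and n :: nat
  assumes S: "compact S" and dim: "covering_dim_le (top_of_set S) (int n)"
    and op: "\<And>U. U \<in> \<U> \<Longrightarrow> openin (top_of_set S) U" and cov: "\<Union>\<U> = S"
  obtains \<F> where "\<And>i. i < Suc n \<Longrightarrow> disjoint_refinement S \<U> (\<F> i)"
    "\<And>x. x \<in> S \<Longrightarrow> \<exists>i<Suc n. x \<in> \<Union>(\<F> i)"
proof -
  obtain \<V> where V: "finite \<V>" "\<And>V. V \<in> \<V> \<Longrightarrow> openin (top_of_set S) V" "\<And>V. V \<in> \<V> \<Longrightarrow> \<exists>U\<in>\<U>. V \<subseteq> U"
    "\<Union>\<V> = S" "\<And>x. x \<in> S \<Longrightarrow> int (card {V\<in>\<V>. x \<in> V}) \<le> int n + 1"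
    using finite_refinement[OF S dim op cov] by blast
  \<comment> \<open>Positive exactly on \<open>V\<close>; the value 1 replaces
    \<open>infdist\<close> to the empty set, which would be 0.\<close>
  define f where "f V x = (if S - V = {} then 1 else infdist x (S - V))" for V x
  have fpos: "0 < f V x \<longleftrightarrow> x \<in> V" if "V \<in> \<V>" "x \<in> S" for V x
  proof (cases "S - V = {}")
    case True then show ?thesis using that by (auto simp: f_def)
  next
    case False
    have "closedin (top_of_set S) (topspace (top_of_set S) - V)"
      by (intro closedin_diff closedin_topspace V(2) that)
    then have "closed (S - V)" using closedin_closed_trans[OF _ compact_imp_closed[OF S]] by simp
    then have "x \<in> S - V \<longleftrightarrow> infdist x (S - V) = 0"
      using False by (intro in_closed_iff_infdist_zero) auto
    then show ?thesis using False that infdist_nonneg[of x "S - V"] by (auto simp: f_def)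
  qed
  have cf: "continuous_on S (f V)" for V
    unfolding f_def by (cases "S - V = {}") (auto intro!: continuous_intros)
  \<comment> \<open>The points at which the coordinates in \<open>A\<close> are positive and exceed
    all others. Two distinct sets \<open>A\<close>, \<open>B\<close> of equal size each have an
    element outside the other, which yields contradictory strict inequalities.\<close>
  define W where "W A = S \<inter> (\<Inter>P\<in>A. {x\<in>S. 0 < f P x}) \<inter> (\<Inter>P\<in>A. \<Inter>Q\<in>\<V> - A. {x\<in>S. f Q x < f P x})" for A
  have Wiff: "x \<in> W A \<longleftrightarrow> x \<in> S \<and> (\<forall>P\<in>A. 0 < f P x) \<and> (\<forall>P\<in>A. \<forall>Q\<in>\<V> - A. f Q x < f P x)" for x A
    by (auto simp: W_def)
  have Wop: "openin (top_of_set S) (W A)" if A: "A \<subseteq> \<V>" for A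
  proof -
    have o1: "openin (top_of_set S) {x\<in>S. g x < h x}" if "continuous_on S g" "continuous_on S h" for g h :: "'a \<Rightarrow> real"
    proof -
      have "openin (top_of_set S) (S \<inter> (\<lambda>x. h x - g x) -` {0<..})"
        by (rule continuous_openin_preimage_gen) (use that in \<open>auto intro!: continuous_intros\<close>)
      moreover have "S \<inter> (\<lambda>x. h x - g x) -` {0<..} = {x\<in>S. g x < h x}" by auto
      ultimately show ?thesis by simp
    qed
    have fin: "finite A" "finite (\<V> - A)" using A V(1) finite_subset by auto
    have "openin (top_of_set S) (S \<inter> (\<Inter>P\<in>A. {x\<in>S. 0 < f P x}))"
      using openin_INT[OF fin(1), of "top_of_set S" "\<lambda>P. {x\<in>S. 0 < f P x}"] o1[OF continuous_on_const cf] by (simp add: Int_commute)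
    moreover have "openin (top_of_set S) (S \<inter> (\<Inter>Q\<in>\<V> - A. {x\<in>S. f Q x < f P x}))" for P
      using openin_INT[OF fin(2), of "top_of_set S" "\<lambda>Q. {x\<in>S. f Q x < f P x}"] o1[OF cf cf] by (simp add: Int_commute)
    then have "openin (top_of_set S) (S \<inter> (\<Inter>P\<in>A. S \<inter> (\<Inter>Q\<in>\<V> - A. {x\<in>S. f Q x < f P x})))"
      using openin_INT[OF fin(1), of "top_of_set S" "\<lambda>P. S \<inter> (\<Inter>Q\<in>\<V> - A. {x\<in>S. f Q x < f P x})"] by (simp add: Int_commute)
    ultimately have "openin (top_of_set S) ((S \<inter> (\<Inter>P\<in>A. {x\<in>S. 0 < f P x})) \<inter> (S \<inter> (\<Inter>P\<in>A. S \<inter> (\<Inter>Q\<in>\<V> - A. {x\<in>S. f Q x < f P x}))))"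
      by (rule openin_Int)
    also have "\<dots> = W A" by (auto simp: W_def)
    finally show ?thesis .
  qed
  define \<F> where "\<F> i = W ` {A. A \<subseteq> \<V> \<and> card A = Suc i}" for i
  show ?thesis
  proof (rule that[of \<F>])
    fix i assume "i < Suc n"
    show "disjoint_refinement S \<U> (\<F> i)"
      unfolding disjoint_refinement_def
    proof (intro conjI ballI)
      show "disjoint (\<F> i)"
        unfolding pairwise_def \<F>_def
      proof (intro ballI impI, elim imageE, clarify)
        fix A B assume A: "A \<subseteq> \<V>" "card A = Suc i" and B: "B \<subseteq> \<V>" "card B = Suc i" and ne: "W A \<noteq> W B"
        have fin: "finite A" "finite B" using A B V(1) finite_subset by auto
        have "A \<noteq> B" using ne by blast
        then have "\<not> A \<subseteq> B" "\<not> B \<subseteq> A"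
          using card_subset_eq[OF fin(2), of A] card_subset_eq[OF fin(1), of B] A(2) B(2) by auto
        then obtain P Q where P: "P \<in> A - B" and Q: "Q \<in> B - A" by blast
        have "False" if "x \<in> W A" "x \<in> W B" for x
        proof -
          have "f Q x < f P x" using that(1) P Q B(1) unfolding Wiff by blast
          moreover have "f P x < f Q x" using that(2) P Q A(1) unfolding Wiff by blast
          ultimately show False by simp
        qed
        then show "disjnt (W A) (W B)" unfolding disjnt_def by blast
      qed
      fix X assume "X \<in> \<F> i"
      then obtain A where A: "A \<subseteq> \<V>" "card A = Suc i" "X = W A" by (auto simp: \<F>_def)
      show "openin (top_of_set S) X" using Wop A by simp
      obtain P where P: "P \<in> A" using A(2) by (metis card.empty ex_in_conv nat.distinct(1))
      then obtain U where U: "U \<in> \<U>" "P \<subseteq> U" using V(3) A(1) by blast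
      have "W A \<subseteq> P"
      proof
        fix x assume "x \<in> W A"
        then have "x \<in> S" "0 < f P x" using P by (simp_all add: Wiff)
        then show "x \<in> P" using fpos[of P x] P A(1) by blast
      qed
      then show "\<exists>U\<in>\<U>. X \<subseteq> U" using U A(3) by blast
    qed
  next
    fix x assume x: "x \<in> S"
    \<comment> \<open>The members containing \<open>x\<close> have the positive coordinates, so
      \<open>x\<close> lies in the star of exactly this simplex; its size minus one is the index of
      the family.\<close>
    define A where "A = {V \<in> \<V>. x \<in> V}"
    have "A \<noteq> {}" using x V(4) by (auto simp: A_def)
    moreover have "finite A" using V(1) by (simp add: A_def)
    ultimately have "0 < card A" by (simp add: card_gt_0_iff)
    moreover have "card A \<le> Suc n" using V(5)[OF x] by (simp add: A_def)
    moreover obtain i where "card A = Suc i" using \<open>0 < card A\<close> gr0_implies_Suc by blast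
    ultimately have i: "card A = Suc i" "i < Suc n" by simp_all
    have "x \<in> W A"
      unfolding Wiff
    proof (intro conjI ballI)
      show "x \<in> S" by (rule x)
      show "0 < f P x" if "P \<in> A" for P using fpos[of P x] that x by (simp add: A_def)
      fix P Q assume P: "P \<in> A" and Q: "Q \<in> \<V> - A"
      have "\<not> 0 < f Q x" using fpos[of Q x] Q x by (simp add: A_def)
      moreover have "0 < f P x" using fpos[of P x] P x by (simp add: A_def)
      ultimately show "f Q x < f P x" by linarith
    qed
    moreover have "A \<subseteq> \<V>" by (auto simp: A_def)
    ultimately have "x \<in> \<Union>(\<F> i)" using i unfolding \<F>_def by blast
    then show "\<exists>i<Suc n. x \<in> \<Union>(\<F> i)" using i by blast
  qed
qed

text \<open>Points missed by \<open>n\<close> of the families form disjoint closed sets, one for each choice of the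
  \<open>n\<close> families, and around each of them a family that covers it is copied.\<close>

lemma disjoint_refinements:
  fixes S :: "'a::metric_space set" and n k :: nat
  assumes S: "compact S" and dim: "covering_dim_le (top_of_set S) (int n)"
    and op: "\<And>U. U \<in> \<U> \<Longrightarrow> openin (top_of_set S) U" and cov: "\<Union>\<U> = S" and k: "Suc n \<le> k"
  shows "\<exists>\<F>. (\<forall>i<k. disjoint_refinement S \<U> (\<F> i)) \<and> (\<forall>x\<in>S. card {i. i < k \<and> x \<notin> \<Union>(\<F> i)} \<le> n)"
  using k
proof (induction k rule: dec_induct)
  case base
  obtain \<F> where F: "\<And>i. i < Suc n \<Longrightarrow> disjoint_refinement S \<U> (\<F> i)" "\<And>x. x \<in> S \<Longrightarrow> \<exists>i<Suc n. x \<in> \<Union>(\<F> i)"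
    using disjoint_refinements_base[OF S dim op cov] by blast
  have "card {i. i < Suc n \<and> x \<notin> \<Union>(\<F> i)} \<le> n" if x: "x \<in> S" for x
  proof -
    obtain i where i: "i < Suc n" "x \<in> \<Union>(\<F> i)" using F(2)[OF x] by blast
    have "card {i. i < Suc n \<and> x \<notin> \<Union>(\<F> i)} \<le> card ({..<Suc n} - {i})"
      using i(2) by (intro card_mono) auto
    then show ?thesis using i(1) by simp
  qed
  then show ?case using F(1) by blast
next
  case (step k)
  then obtain \<F> where F: "\<forall>i<k. disjoint_refinement S \<U> (\<F> i)" and miss: "\<forall>x\<in>S. card {i. i < k \<and> x \<notin> \<Union>(\<F> i)} \<le> n"
    by blast
  have dj: "disjoint (\<F> i)" and opF: "\<And>V. V \<in> \<F> i \<Longrightarrow> openin (top_of_set S) V"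
    and refF: "\<And>V. V \<in> \<F> i \<Longrightarrow> \<exists>U\<in>\<U>. V \<subseteq> U" if "i < k" for i
    using F that unfolding disjoint_refinement_def by blast+
  define I where "I = {A. A \<subseteq> {..<k} \<and> card A = n}"
  have "finite I" by (simp add: I_def)
  \<comment> \<open>The points missed by all families with index in \<open>A\<close>. A point in two
    of these sets would be missed by more than \<open>n\<close> families.\<close>
  define C where "C A = S - (\<Union>i\<in>A. \<Union>(\<F> i))" for A
  have Cclosed: "closedin (top_of_set S) (C A)" if "A \<in> I" for A
  proof -
    have "openin (top_of_set S) (\<Union>i\<in>A. \<Union>(\<F> i))"
      using that opF by (intro openin_Union) (auto simp: I_def)
    from closedin_diff[OF closedin_topspace this] show ?thesis by (simp add: C_def)
  qed
  have Cdisj: "disjnt (C A) (C B)" if A: "A \<in> I" and B: "B \<in> I" and "A \<noteq> B" for A B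
  proof -
    have fin: "finite A" "finite B" using A B finite_subset by (auto simp: I_def)
    have "\<not> B \<subseteq> A" using card_subset_eq[OF fin(1), of B] that by (auto simp: I_def)
    then obtain j where j: "j \<in> B" "j \<notin> A" by blast
    have False if "x \<in> C A" "x \<in> C B" for x
    proof -
      have "insert j A \<subseteq> {i. i < k \<and> x \<notin> \<Union>(\<F> i)}" using that j A B by (auto simp: C_def I_def)
      then have "card (insert j A) \<le> card {i. i < k \<and> x \<notin> \<Union>(\<F> i)}" by (intro card_mono) auto
      then have "Suc n \<le> card {i. i < k \<and> x \<notin> \<Union>(\<F> i)}" using j fin A by (simp add: I_def)
      moreover have "x \<in> S" using that(1) by (simp add: C_def)
      ultimately show False using miss[rule_format, of x] by linarith
    qed
    then show ?thesis unfolding disjnt_def by blast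
  qed
  define R where "R A B Z \<longleftrightarrow> openin (top_of_set S) (fst Z) \<and> openin (top_of_set S) (snd Z) \<and> C A \<subseteq> fst Z \<and> C B \<subseteq> snd Z \<and> disjnt (fst Z) (snd Z)"
    for A B and Z :: "'a set \<times> 'a set"
  define Z where "Z A B = (SOME Z. R A B Z)" for A B
  have Z: "R A B (Z A B)" if AB: "A \<in> I" "B \<in> I" "A \<noteq> B" for A B
  proof -
    have "normal_space (top_of_set S)"
      by (intro metrizable_imp_normal_space metrizable_space_subtopology metrizable_space_euclidean)
    then have "\<exists>P Q. openin (top_of_set S) P \<and> openin (top_of_set S) Q \<and> C A \<subseteq> P \<and> C B \<subseteq> Q \<and> disjnt P Q"
      using conjI[OF Cclosed[OF AB(1)] conjI[OF Cclosed[OF AB(2)] Cdisj[OF AB]]]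
      unfolding normal_space_def by (elim allE impE)
    then obtain P Q where "openin (top_of_set S) P" "openin (top_of_set S) Q" "C A \<subseteq> P" "C B \<subseteq> Q" "disjnt P Q"
      by (elim exE conjE)
    then have "R A B (P, Q)" by (simp add: R_def)
    then show ?thesis unfolding Z_def by (rule someI)
  qed
  define P where "P A B = fst (Z A B)" for A B
  define Q where "Q A B = snd (Z A B)" for A B
  have P: "openin (top_of_set S) (P A B)" and Q: "openin (top_of_set S) (Q A B)"
    and CP: "C A \<subseteq> P A B" and CQ: "C B \<subseteq> Q A B" and PQ: "disjnt (P A B) (Q A B)"
    if "A \<in> I" "B \<in> I" "A \<noteq> B" for A B
    using Z[OF that] unfolding R_def P_def Q_def by blast+
  \<comment> \<open>Normality separates the closed sets pairwise; as there are finitely many,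
    intersecting the neighbourhoods gives pairwise disjoint open \<open>N A\<close> around the
    \<open>C A\<close>.\<close>
  define N where "N A = (\<Inter>B\<in>I - {A}. P A B \<inter> Q B A) \<inter> S" for A
  have Nopen: "openin (top_of_set S) (N A)" if "A \<in> I" for A
  proof -
    have "openin (top_of_set S) ((\<Inter>B\<in>I - {A}. P A B \<inter> Q B A) \<inter> topspace (top_of_set S))"
    proof (rule openin_INT)
      show "openin (top_of_set S) (P A B \<inter> Q B A)" if "B \<in> I - {A}" for B
        using P[of A B] Q[of B A] \<open>A \<in> I\<close> that by (intro openin_Int) auto
    qed (simp add: \<open>finite I\<close>)
    then show ?thesis by (simp add: N_def)
  qed
  have CN: "C A \<subseteq> N A" if "A \<in> I" for A
  proof
    fix x assume x: "x \<in> C A"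
    then have "x \<in> S" by (simp add: C_def)
    moreover have "x \<in> P A B \<inter> Q B A" if B: "B \<in> I - {A}" for B
    proof -
      have "x \<in> P A B" using CP[of A B] \<open>A \<in> I\<close> B x by blast
      moreover have "x \<in> Q B A" using CQ[of B A] \<open>A \<in> I\<close> B x by blast
      ultimately show ?thesis by blast
    qed
    ultimately show "x \<in> N A" by (simp add: N_def)
  qed
  have Ndisj: "disjnt (N A) (N B)" if "A \<in> I" "B \<in> I" "A \<noteq> B" for A B
  proof -
    have "N A \<subseteq> P A B \<inter> Q B A" unfolding N_def using that by blast
    moreover have "N B \<subseteq> P B A \<inter> Q A B" unfolding N_def using that by blast
    ultimately have "N A \<subseteq> P A B" "N B \<subseteq> Q A B" by blast+
    then show ?thesis using PQ[OF that] unfolding disjnt_def by blast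
  qed
  \<comment> \<open>A family outside \<open>A\<close>, available because \<open>n < k\<close>. It
    covers every point of \<open>C A\<close>, since such a point is missed by no further
    family.\<close>
  define j where "j A = (SOME i. i < k \<and> i \<notin> A)" for A
  have j: "j A < k \<and> j A \<notin> A" if "A \<in> I" for A
  proof -
    have A: "A \<subseteq> {..<k}" "card A = n" using that by (simp_all add: I_def)
    have "\<not> {..<k} \<subseteq> A"
    proof
      assume "{..<k} \<subseteq> A"
      then have "card {..<k} \<le> card A" by (rule card_mono[OF finite_subset[OF A(1) finite_lessThan]])
      then show False using A(2) step.hyps(1) by simp
    qed
    then have "\<exists>i. i < k \<and> i \<notin> A" by blast
    then show ?thesis unfolding j_def by (rule someI_ex)
  qed
  define G where "G = {N A \<inter> V |A V. A \<in> I \<and> V \<in> \<F> (j A)}"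
  define \<F>' where "\<F>' i = (if i < k then \<F> i else G)" for i
  have "disjoint_refinement S \<U> G"
    unfolding disjoint_refinement_def
  proof (intro conjI ballI)
    show "disjoint G"
      unfolding pairwise_def
    proof (intro ballI impI)
      fix X Y assume "X \<in> G" "Y \<in> G" "X \<noteq> Y"
      then obtain A V B W where X: "X = N A \<inter> V" "A \<in> I" "V \<in> \<F> (j A)" and Y: "Y = N B \<inter> W" "B \<in> I" "W \<in> \<F> (j B)"
        unfolding G_def by blast
      show "disjnt X Y"
      proof (cases "A = B")
        case True
        then have "V \<noteq> W" using \<open>X \<noteq> Y\<close> X Y by blast
        then have "disjnt V W" using dj[of "j A"] j[OF X(2)] X(3) Y(3) True unfolding pairwise_def by blast
        then show ?thesis using X Y unfolding disjnt_def by blast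
      next
        case False
        then show ?thesis using Ndisj[OF X(2) Y(2)] X(1) Y(1) unfolding disjnt_def by blast
      qed
    qed
    fix X assume "X \<in> G"
    then obtain A V where X: "X = N A \<inter> V" "A \<in> I" "V \<in> \<F> (j A)" unfolding G_def by blast
    show "openin (top_of_set S) X" using Nopen[OF X(2)] opF[OF _ X(3)] j[OF X(2)] X(1) by (simp add: openin_Int)
    show "\<exists>U\<in>\<U>. X \<subseteq> U" using refF[OF _ X(3)] j[OF X(2)] X(1) by blast
  qed
  then have "\<forall>i<Suc k. disjoint_refinement S \<U> (\<F>' i)" using F by (simp add: \<F>'_def)
  moreover have "card {i. i < Suc k \<and> x \<notin> \<Union>(\<F>' i)} \<le> n" if x: "x \<in> S" for x
  proof -
    define A where "A = {i. i < k \<and> x \<notin> \<Union>(\<F> i)}"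
    have "finite A" by (simp add: A_def)
    have An: "card A \<le> n" using miss x by (simp add: A_def)
    show ?thesis
    proof (cases "card A = n")
      case True
      then have AI: "A \<in> I" by (auto simp: I_def A_def)
      have "x \<in> C A" using x by (auto simp: C_def A_def)
      then have "x \<in> N A" using CN[OF AI] by blast
      moreover have "x \<in> \<Union>(\<F> (j A))" using j[OF AI] by (auto simp: A_def)
      ultimately have "x \<in> \<Union>G" unfolding G_def using AI by blast
      then have "{i. i < Suc k \<and> x \<notin> \<Union>(\<F>' i)} \<subseteq> A" by (auto simp: \<F>'_def A_def less_Suc_eq)
      then have "card {i. i < Suc k \<and> x \<notin> \<Union>(\<F>' i)} \<le> card A" by (rule card_mono[OF \<open>finite A\<close>])
      then show ?thesis using An by simp
    next
      case False
      \<comment> \<open>Fewer than \<open>n\<close> families missed \<open>x\<close> so far, so the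
        new one may miss it as well.\<close>
      have "{i. i < Suc k \<and> x \<notin> \<Union>(\<F>' i)} \<subseteq> insert k A" by (auto simp: \<F>'_def A_def less_Suc_eq)
      then have "card {i. i < Suc k \<and> x \<notin> \<Union>(\<F>' i)} \<le> card (insert k A)" by (rule card_mono[rotated]) (simp add: \<open>finite A\<close>)
      also have "\<dots> \<le> Suc (card A)" by (rule card_insert_le_m1) auto
      finally show ?thesis using An False by simp
    qed
  qed
  ultimately show ?case by blast
qed

lemma disjoint_card_le_1:
  assumes "disjoint \<F>"
  shows "finite {V \<in> \<F>. x \<in> V} \<and> card {V \<in> \<F>. x \<in> V} \<le> 1"
proof (cases "{V \<in> \<F>. x \<in> V} = {}")
  case True
  then show ?thesis by (simp only: finite.emptyI card.empty) simp
next
  case False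
  then obtain V where V: "V \<in> \<F>" "x \<in> V" by blast
  have "{V \<in> \<F>. x \<in> V} = {V}"
    using assms V unfolding pairwise_def disjnt_def by blast
  then show ?thesis by simp
qed

text \<open>Take n + m + 1 families on each factor. A point \<open>(x, y)\<close> loses at most
  \<open>n\<close> indices for \<open>x\<close> and \<open>m\<close> for \<open>y\<close>, so some
  index serves both. Products of members with the same index form a disjoint family, and n + m + 1
  disjoint families have multiplicity at most n + m + 1.\<close>

lemma covering_dim_le_Times:
  fixes S :: "'a::metric_space set" and T :: "'b::metric_space set"
  assumes S: "compact S" "covering_dim_le (top_of_set S) (int n)"
    and T: "compact T" "covering_dim_le (top_of_set T) (int m)"
  shows "covering_dim_le (top_of_set (S \<times> T)) (int (n + m))"
  unfolding covering_dim_le_def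
proof (intro allI impI, elim conjE)
  fix \<W> assume op: "\<forall>W\<in>\<W>. openin (top_of_set (S \<times> T)) W" and cov: "\<Union>\<W> = topspace (top_of_set (S \<times> T))"
  \<comment> \<open>A Lebesgue number of the cover; balls of radius \<delta> / 2 in the factors have
    products inside a ball of radius \<delta>.\<close>
  obtain \<delta> where \<delta>: "0 < \<delta>" "\<And>x y. x \<in> S \<Longrightarrow> y \<in> T \<Longrightarrow> \<exists>W\<in>\<W>. (S \<times> T) \<inter> ball (x, y) \<delta> \<subseteq> W"
  proof -
    define \<O> where "\<O> = {U. open U \<and> (\<exists>W\<in>\<W>. (S \<times> T) \<inter> U \<subseteq> W)}"
    have "S \<times> T \<subseteq> \<Union>\<O>"
    proof
      fix z assume "z \<in> S \<times> T"
      then have "z \<in> \<Union>\<W>" unfolding cov by simp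
      then obtain W where W: "W \<in> \<W>" "z \<in> W" by blast
      obtain U where "open U" "W = (S \<times> T) \<inter> U" using op W(1) unfolding openin_open by blast
      then show "z \<in> \<Union>\<O>" using W unfolding \<O>_def by blast
    qed
    then obtain \<delta> where \<delta>: "0 < \<delta>" "\<And>z. z \<in> S \<times> T \<Longrightarrow> \<exists>U\<in>\<O>. ball z \<delta> \<subseteq> U"
    proof (rule Heine_Borel_lemma[OF compact_Times[OF S(1) T(1)]])
      show "open U" if "U \<in> \<O>" for U using that by (simp add: \<O>_def)
      fix \<delta> assume "0 < \<delta>" "\<And>z. z \<in> S \<times> T \<Longrightarrow> \<exists>U\<in>\<O>. ball z \<delta> \<subseteq> U"
      then show thesis by (rule that)
    qed
    show ?thesis
    proof (rule that[OF \<delta>(1)])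
      fix x y assume "x \<in> S" "y \<in> T"
      then obtain U where "U \<in> \<O>" "ball (x, y) \<delta> \<subseteq> U" using \<delta>(2)[of "(x, y)"] by blast
      then show "\<exists>W\<in>\<W>. (S \<times> T) \<inter> ball (x, y) \<delta> \<subseteq> W" unfolding \<O>_def by blast
    qed
  qed
  define \<U> where "\<U> = (\<lambda>x. S \<inter> ball x (\<delta> / 2)) ` S"
  define \<V> where "\<V> = (\<lambda>x. T \<inter> ball x (\<delta> / 2)) ` T"
  define k where "k = Suc (n + m)"
  have "\<exists>\<F>. (\<forall>i<k. disjoint_refinement S \<U> (\<F> i)) \<and> (\<forall>x\<in>S. card {i. i < k \<and> x \<notin> \<Union>(\<F> i)} \<le> n)"
  proof (rule disjoint_refinements[OF S])
    show "openin (top_of_set S) U" if "U \<in> \<U>" for U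
      using that unfolding \<U>_def by (elim imageE) (simp add: openin_open_Int)
    show "\<Union>\<U> = S" using \<delta>(1) by (force simp: \<U>_def)
  qed (simp add: k_def)
  then obtain \<F> where F: "\<forall>i<k. disjoint_refinement S \<U> (\<F> i)" "\<forall>x\<in>S. card {i. i < k \<and> x \<notin> \<Union>(\<F> i)} \<le> n" by blast
  have "\<exists>\<G>. (\<forall>i<k. disjoint_refinement T \<V> (\<G> i)) \<and> (\<forall>x\<in>T. card {i. i < k \<and> x \<notin> \<Union>(\<G> i)} \<le> m)"
  proof (rule disjoint_refinements[OF T])
    show "openin (top_of_set T) U" if "U \<in> \<V>" for U
      using that unfolding \<V>_def by (elim imageE) (simp add: openin_open_Int)
    show "\<Union>\<V> = T" using \<delta>(1) by (force simp: \<V>_def)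
  qed (simp add: k_def)
  then obtain \<G> where G: "\<forall>i<k. disjoint_refinement T \<V> (\<G> i)" "\<forall>x\<in>T. card {i. i < k \<and> x \<notin> \<Union>(\<G> i)} \<le> m" by blast
  define \<H> where "\<H> i = {A \<times> B |A B. A \<in> \<F> i \<and> B \<in> \<G> i}" for i
  have Hdisj: "disjoint (\<H> i)" if i: "i < k" for i
    unfolding pairwise_def
  proof (intro ballI impI)
    fix X Y assume "X \<in> \<H> i" "Y \<in> \<H> i" and ne: "X \<noteq> Y"
    then obtain A B A' B' where X: "X = A \<times> B" "A \<in> \<F> i" "B \<in> \<G> i" and Y: "Y = A' \<times> B'" "A' \<in> \<F> i" "B' \<in> \<G> i"
      unfolding \<H>_def by blast
    have dF: "disjoint (\<F> i)" and dG: "disjoint (\<G> i)"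
      using F(1)[rule_format, OF i] G(1)[rule_format, OF i] by (simp_all add: disjoint_refinement_def)
    have "A \<noteq> A' \<or> B \<noteq> B'" using ne X(1) Y(1) by blast
    then have "disjnt A A' \<or> disjnt B B'"
      using pairwiseD[OF dF X(2) Y(2)] pairwiseD[OF dG X(3) Y(3)] by blast
    then show "disjnt X Y" unfolding X(1) Y(1) disjnt_def by blast
  qed
  show "\<exists>\<V>. (\<forall>V\<in>\<V>. openin (top_of_set (S \<times> T)) V \<and> (\<exists>U\<in>\<W>. V \<subseteq> U)) \<and> \<Union>\<V> = topspace (top_of_set (S \<times> T)) \<and>
     (\<forall>x\<in>topspace (top_of_set (S \<times> T)). finite {V\<in>\<V>. x \<in> V} \<and> int (card {V\<in>\<V>. x \<in> V}) \<le> int (n + m) + 1)"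
  proof (intro exI[of _ "\<Union>i<k. \<H> i"] conjI ballI)
    fix X assume "X \<in> (\<Union>i<k. \<H> i)"
    then obtain i A B where X: "i < k" "X = A \<times> B" "A \<in> \<F> i" "B \<in> \<G> i" unfolding \<H>_def by blast
    have A: "openin (top_of_set S) A" "\<exists>U\<in>\<U>. A \<subseteq> U"
      using F(1)[rule_format, OF X(1)] X(3) by (simp_all add: disjoint_refinement_def)
    have B: "openin (top_of_set T) B" "\<exists>V\<in>\<V>. B \<subseteq> V"
      using G(1)[rule_format, OF X(1)] X(4) by (simp_all add: disjoint_refinement_def)
    show "openin (top_of_set (S \<times> T)) X" unfolding X(2) by (rule openin_Times[OF A(1) B(1)])
    obtain x where x: "x \<in> S" "A \<subseteq> S \<inter> ball x (\<delta> / 2)" using A(2) by (auto simp: \<U>_def)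
    obtain y where y: "y \<in> T" "B \<subseteq> T \<inter> ball y (\<delta> / 2)" using B(2) by (auto simp: \<V>_def)
    obtain W where W: "W \<in> \<W>" "(S \<times> T) \<inter> ball (x, y) \<delta> \<subseteq> W" using \<delta>(2)[OF x(1) y(1)] by blast
    have "(a, b) \<in> ball (x, y) \<delta>" if "a \<in> A" "b \<in> B" for a b
    proof -
      have "dist x a < \<delta> / 2" "dist y b < \<delta> / 2" using x(2) y(2) that by auto
      moreover have "dist (x, y) (a, b) \<le> dist x a + dist y b"
        unfolding dist_Pair_Pair by (rule sqrt_sum_squares_le_sum) auto
      ultimately show ?thesis by simp
    qed
    moreover have "A \<subseteq> S" "B \<subseteq> T" using x(2) y(2) by blast+
    ultimately have "A \<times> B \<subseteq> (S \<times> T) \<inter> ball (x, y) \<delta>" by blast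
    then have "X \<subseteq> W" using W(2) unfolding X(2) by (rule order_trans)
    then show "\<exists>U\<in>\<W>. X \<subseteq> U" using W(1) by blast
  next
    have "\<Union>(\<Union>i<k. \<H> i) \<subseteq> S \<times> T"
    proof
      fix z assume "z \<in> \<Union>(\<Union>i<k. \<H> i)"
      then obtain i A B where z: "i < k" "A \<in> \<F> i" "B \<in> \<G> i" "z \<in> A \<times> B" unfolding \<H>_def by blast
      have "openin (top_of_set S) A" "openin (top_of_set T) B"
        using F(1)[rule_format, OF z(1)] G(1)[rule_format, OF z(1)] z(2,3) by (simp_all add: disjoint_refinement_def)
      then have "A \<subseteq> S" "B \<subseteq> T" by (simp_all add: openin_imp_subset)
      then show "z \<in> S \<times> T" using z(4) by blast
    qed
    moreover have "(x, y) \<in> \<Union>(\<Union>i<k. \<H> i)" if x: "x \<in> S" and y: "y \<in> T" for x y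
    proof -
      have le: "card ({i. i < k \<and> x \<notin> \<Union>(\<F> i)} \<union> {i. i < k \<and> y \<notin> \<Union>(\<G> i)}) \<le> n + m"
        using card_Un_le[of "{i. i < k \<and> x \<notin> \<Union>(\<F> i)}" "{i. i < k \<and> y \<notin> \<Union>(\<G> i)}"] F(2)[rule_format, OF x] G(2)[rule_format, OF y] by linarith
      have "\<not> {..<k} \<subseteq> {i. i < k \<and> x \<notin> \<Union>(\<F> i)} \<union> {i. i < k \<and> y \<notin> \<Union>(\<G> i)}"
      proof
        assume "{..<k} \<subseteq> {i. i < k \<and> x \<notin> \<Union>(\<F> i)} \<union> {i. i < k \<and> y \<notin> \<Union>(\<G> i)}"
        then have "card {..<k} \<le> card ({i. i < k \<and> x \<notin> \<Union>(\<F> i)} \<union> {i. i < k \<and> y \<notin> \<Union>(\<G> i)})"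
          by (rule card_mono[rotated]) simp
        then have "k \<le> n + m" using le by simp
        then show False by (simp add: k_def)
      qed
      then obtain i where "i < k" "x \<in> \<Union>(\<F> i)" "y \<in> \<Union>(\<G> i)" by blast
      then show ?thesis unfolding \<H>_def by blast
    qed
    ultimately show "\<Union>(\<Union>i<k. \<H> i) = topspace (top_of_set (S \<times> T))" by auto
  next
    fix z
    have eq: "{V \<in> (\<Union>i<k. \<H> i). z \<in> V} = (\<Union>i<k. {V \<in> \<H> i. z \<in> V})" by blast
    have fin: "finite {V \<in> \<H> i. z \<in> V}" and le: "card {V \<in> \<H> i. z \<in> V} \<le> 1" if "i < k" for i
      using disjoint_card_le_1[OF Hdisj[OF that], of z] by auto
    show "finite {V \<in> (\<Union>i<k. \<H> i). z \<in> V}" unfolding eq using fin by blast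
    have "card (\<Union>i<k. {V \<in> \<H> i. z \<in> V}) \<le> (\<Sum>i<k. card {V \<in> \<H> i. z \<in> V})" by (rule card_UN_le) simp
    also have "\<dots> \<le> (\<Sum>i<k. 1)" using le by (intro sum_mono) auto
    finally show "int (card {V \<in> (\<Union>i<k. \<H> i). z \<in> V}) \<le> int (n + m) + 1" unfolding eq by (simp add: k_def)
  qed
qed

section \<open>Mean dimension\<close>

text \<open>The Frechet embedding by distances to a dense sequence. Every function on the discrete
  type \<open>nat\<close> is continuous, so \<open>nat \<Rightarrow>\<^sub>C real\<close> is the
  space of bounded real sequences with the supremum metric.\<close>

lemma isometric_embedding:
  fixes m :: "'a metric"
  assumes cs: "compact_space (mtopology_of m)"
  obtains h :: "'a \<Rightarrow> (nat \<Rightarrow>\<^sub>C real)" where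
    "\<And>x y. x \<in> mspace m \<Longrightarrow> y \<in> mspace m \<Longrightarrow> dist (h x) (h y) = mdist m x y"
proof -
  interpret M: Metric_space "mspace m" "mdist m" by (rule Metric_space_mspace_mdist)
  have "M.mtotally_bounded (mspace m)"
    using cs unfolding mtopology_of_def M.compact_space_eq_mcomplete_mtotally_bounded by blast
  then have "\<forall>n. \<exists>F. finite F \<and> F \<subseteq> mspace m \<and> mspace m \<subseteq> (\<Union>x\<in>F. M.mball x (1 / real (Suc n)))"
    unfolding M.mtotally_bounded_def by simp
  then obtain F where F: "\<And>n. finite (F n)" "\<And>n. F n \<subseteq> mspace m"
      "\<And>n. mspace m \<subseteq> (\<Union>x\<in>F n. M.mball x (1 / real (Suc n)))"
    by metis
  define Q where "Q = (\<Union>n. F n)"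
  have Qc: "countable Q" unfolding Q_def using F(1) by (auto intro: countable_finite)
  define q where "q = from_nat_into Q"
  have "M.mbounded (mspace m)"
    using cs M.compactin_imp_mbounded
    unfolding compact_space_def mtopology_of_def M.topspace_mtopology by blast
  then obtain B where B: "\<And>x y. x \<in> mspace m \<Longrightarrow> y \<in> mspace m \<Longrightarrow> mdist m x y \<le> B"
    unfolding M.mbounded_alt by auto
  have qM: "q n \<in> mspace m" if "x \<in> mspace m" for x n
  proof -
    have "\<exists>p. p \<in> F 0" using subsetD[OF F(3)[of 0] that] by auto
    then have "Q \<noteq> {}" by (auto simp: Q_def)
    then have "q n \<in> Q" unfolding q_def by (rule from_nat_into)
    then show ?thesis using F(2) by (auto simp: Q_def)
  qed
  define h where "h x = Bcontfun (\<lambda>n. mdist m (q n) x)" for x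
  have h: "apply_bcontfun (h x) n = mdist m (q n) x" if x: "x \<in> mspace m" for x n
  proof -
    have "(\<lambda>n. mdist m (q n) x) \<in> bcontfun"
      unfolding bcontfun_def
    proof (intro CollectI conjI)
      show "continuous_on UNIV (\<lambda>n. mdist m (q n) x)" by (simp add: continuous_on_open_vimage open_discrete)
      show "bounded (range (\<lambda>n. mdist m (q n) x))"
        by (rule boundedI[of _ B]) (use B qM[OF x] x in auto)
    qed
    then show ?thesis by (simp add: h_def Bcontfun_inverse)
  qed
  show ?thesis
  proof (rule that[of h])
    fix x y assume x: "x \<in> mspace m" and y: "y \<in> mspace m"
    show "dist (h x) (h y) = mdist m x y"
    proof (rule antisym)
      show "dist (h x) (h y) \<le> mdist m x y"
      proof (rule dist_bound)
        fix n
        have "mdist m (q n) x \<le> mdist m (q n) y + mdist m x y" "mdist m (q n) y \<le> mdist m (q n) x + mdist m x y"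
          using mdist_triangle[OF qM[OF x, of n] y x] mdist_triangle[OF qM[OF x, of n] x y] by (simp_all add: mdist_commute)
        then show "dist (h x n) (h y n) \<le> mdist m x y"
          by (simp add: h x y dist_real_def abs_le_iff)
      qed
      show "mdist m x y \<le> dist (h x) (h y)"
      proof (rule field_le_epsilon)
        fix e :: real assume "0 < e"
        then obtain n where n: "1 / real (Suc n) < e / 2" using nat_approx_posE half_gt_zero by blast
        obtain p where p: "p \<in> F n" "mdist m p x < 1 / real (Suc n)" using subsetD[OF F(3) x, of n] by auto
        have "p \<in> Q" using p(1) by (auto simp: Q_def)
        then obtain k where k: "q k = p" unfolding q_def using from_nat_into_surj[OF Qc] by blast
        have pM: "p \<in> mspace m" using p(1) F(2) by blast
        have "mdist m x y \<le> mdist m p x + mdist m p y"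
          using mdist_triangle[OF x pM y] by (simp add: mdist_commute)
        moreover have "mdist m p y - mdist m p x \<le> dist (h x) (h y)"
          using dist_bounded[of "h x" k "h y"] by (simp add: h x y k dist_real_def abs_le_iff)
        ultimately show "mdist m x y \<le> dist (h x) (h y) + e" using p(2) n by linarith
      qed
    qed
  qed
qed

lemma compact_model:
  fixes m :: "'a metric"
  assumes cs: "compact_space (mtopology_of m)"
  shows "\<exists>(h :: 'a \<Rightarrow> (nat \<Rightarrow>\<^sub>C real)) k S. compact S \<and> h ` mspace m = S \<and>
    homeomorphic_maps (mtopology_of m) (top_of_set S) h k \<and>
    (\<forall>x\<in>mspace m. \<forall>y\<in>mspace m. dist (h x) (h y) = mdist m x y)"
proof -
  obtain h :: "'a \<Rightarrow> (nat \<Rightarrow>\<^sub>C real)" where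
    iso: "\<And>x y. x \<in> mspace m \<Longrightarrow> y \<in> mspace m \<Longrightarrow> dist (h x) (h y) = mdist m x y"
    using isometric_embedding[OF cs] by blast
  define S where "S = h ` mspace m"
  define k where "k = inv_into (mspace m) h"
  have inj: "inj_on h (mspace m)"
  proof (rule inj_onI)
    fix x y assume "x \<in> mspace m" "y \<in> mspace m" "h x = h y"
    then show "x = y" using iso[of x y] by simp
  qed
  have kM: "k y \<in> mspace m" "h (k y) = y" if "y \<in> S" for y
    using that unfolding S_def k_def by (auto intro: inv_into_into f_inv_into_f)
  have kh: "k (h x) = x" if "x \<in> mspace m" for x
    unfolding k_def by (rule inv_into_f_f[OF inj that])
  have "Lipschitz_continuous_map m (submetric euclidean_metric S) h"
    unfolding Lipschitz_continuous_map_def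
    by (intro conjI exI[of _ 1]) (auto simp: S_def iso)
  from Lipschitz_continuous_imp_continuous_map[OF this]
  have ch: "continuous_map (mtopology_of m) (top_of_set S) h" by (simp add: mtopology_of_submetric)
  have "Lipschitz_continuous_map (submetric euclidean_metric S) m k"
    unfolding Lipschitz_continuous_map_def
  proof (intro conjI exI[of _ 1] ballI)
    show "k \<in> mspace (submetric euclidean_metric S) \<rightarrow> mspace m" using kM by auto
    fix x y assume "x \<in> mspace (submetric euclidean_metric S)" "y \<in> mspace (submetric euclidean_metric S)"
    then have "x \<in> S" "y \<in> S" by auto
    then show "mdist m (k x) (k y) \<le> 1 * mdist (submetric euclidean_metric S) x y"
      using iso[of "k x" "k y"] kM by simp
  qed
  from Lipschitz_continuous_imp_continuous_map[OF this]
  have ck: "continuous_map (top_of_set S) (mtopology_of m) k" by (simp add: mtopology_of_submetric)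
  have hom: "homeomorphic_maps (mtopology_of m) (top_of_set S) h k"
    unfolding homeomorphic_maps_def using ch ck kh kM by simp
  then have "compact_space (top_of_set S)"
    using cs homeomorphic_compact_space unfolding homeomorphic_space_def by blast
  then have "compact S" by (simp add: compact_space_subtopology compact_space_def compactin_subtopology)
  then show ?thesis using S_def[symmetric] hom iso by blast
qed

lemma compact_metrizable_model:
  assumes "compact_space K" "metrizable_space K"
  obtains S :: "(nat \<Rightarrow>\<^sub>C real) set" and h k where "compact S" "homeomorphic_maps K (top_of_set S) h k"
proof -
  obtain M d where M: "Metric_space M d" and K: "K = Metric_space.mtopology M d"
    using assms(2) by (auto simp: metrizable_space_def)
  have "mtopology_of (metric (M, d)) = K" using Metric_space.mtopology_of[OF M] K by simp
  then have "\<exists>(h :: 'a \<Rightarrow> (nat \<Rightarrow>\<^sub>C real)) k S. compact S \<and> homeomorphic_maps K (top_of_set S) h k"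
    using compact_model[of "metric (M, d)"] assms(1) by auto
  then show ?thesis using that by blast
qed

context
  fixes X :: "'a metric" and T :: "real \<Rightarrow> 'a \<Rightarrow> 'a"
  assumes fl: "flow (mtopology_of X) T"
begin

lemma flow_facts:
  shows flow_compact: "compact_space (mtopology_of X)"
    and flow_cont: "continuous_map (prod_topology euclideanreal (mtopology_of X)) (mtopology_of X) (\<lambda>(r, x). T r x)"
    and flow_0: "\<And>x. x \<in> mspace X \<Longrightarrow> T 0 x = x"
    and flow_add: "\<And>r s x. x \<in> mspace X \<Longrightarrow> T r (T s x) = T (r + s) x"
    and flow_in: "\<And>r x. x \<in> mspace X \<Longrightarrow> T r x \<in> mspace X"
proof -
  show cs: "compact_space (mtopology_of X)"
    and ct: "continuous_map (prod_topology euclideanreal (mtopology_of X)) (mtopology_of X) (\<lambda>(r, x). T r x)"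
    and "\<And>x. x \<in> mspace X \<Longrightarrow> T 0 x = x" and "\<And>r s x. x \<in> mspace X \<Longrightarrow> T r (T s x) = T (r + s) x"
    using fl unfolding flow_def topspace_mtopology_of by blast+
  show "T r x \<in> mspace X" if "x \<in> mspace X" for r x
    using continuous_map_image_subset_topspace[OF ct] that by auto
qed

lemma flow_map_continuous: "continuous_map (mtopology_of X) (mtopology_of X) (T r)"
proof -
  have "continuous_map (mtopology_of X) (prod_topology euclideanreal (mtopology_of X)) (\<lambda>x. (r, x))"
    by (intro continuous_map_pairedI) auto
  from continuous_map_compose[OF this flow_cont] show ?thesis by (simp add: o_def)
qed

lemma mdist_orbit_bound: "\<exists>B. \<forall>x\<in>mspace X. \<forall>y\<in>mspace X. \<forall>r. mdist X (T r x) (T r y) \<le> B"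
proof -
  interpret M: Metric_space "mspace X" "mdist X" by (rule Metric_space_mspace_mdist)
  have "M.mbounded (mspace X)"
    using flow_compact M.compactin_imp_mbounded
    unfolding compact_space_def mtopology_of_def M.topspace_mtopology by blast
  then obtain B where "\<And>x y. x \<in> mspace X \<Longrightarrow> y \<in> mspace X \<Longrightarrow> mdist X x y \<le> B"
    unfolding M.mbounded_alt by auto
  then show ?thesis using flow_in by blast
qed

lemma mspace_orbit_metric: "0 \<le> N \<Longrightarrow> mspace (orbit_metric X T N) = mspace X"
  unfolding orbit_metric_def by (rule Metric_space.mspace_metric[OF Metric_space_orbit[OF fl]])

lemma mdist_orbit_metric:
  assumes "0 \<le> N" "x \<in> mspace X" "y \<in> mspace X"
  shows "mdist (orbit_metric X T N) x y = (SUP r\<in>{0..N}. mdist X (T r x) (T r y))"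
  unfolding orbit_metric_def using Metric_space.mdist_metric[OF Metric_space_orbit[OF fl assms(1)]] assms by simp

lemma mdist_orbit_upper:
  assumes "x \<in> mspace X" "y \<in> mspace X" "0 \<le> r" "r \<le> N"
  shows "mdist X (T r x) (T r y) \<le> mdist (orbit_metric X T N) x y"
proof -
  from mdist_orbit_bound obtain B where B: "\<forall>x\<in>mspace X. \<forall>y\<in>mspace X. \<forall>r. mdist X (T r x) (T r y) \<le> B" ..
  have "mdist X (T r x) (T r y) \<le> (SUP r\<in>{0..N}. mdist X (T r x) (T r y))"
    by (rule cSUP_upper) (use assms B in \<open>auto intro!: bdd_aboveI[of _ B]\<close>)
  then show ?thesis using mdist_orbit_metric[of N x y] assms by simp
qed

lemma mdist_orbit_least:
  assumes "x \<in> mspace X" "y \<in> mspace X" "0 \<le> N" "\<And>r. 0 \<le> r \<Longrightarrow> r \<le> N \<Longrightarrow> mdist X (T r x) (T r y) \<le> c"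
  shows "mdist (orbit_metric X T N) x y \<le> c"
  unfolding mdist_orbit_metric[OF assms(3,1,2)] by (rule cSUP_least) (use assms in auto)

text \<open>Conjugating the flow by an isometry gives a \<open>compact_flow\<close> without changing
  any orbit distance.\<close>

lemma flow_model:
  "\<exists>(h :: 'a \<Rightarrow> (nat \<Rightarrow>\<^sub>C real)) k S. h ` mspace X = S \<and>
    homeomorphic_maps (mtopology_of X) (top_of_set S) h k \<and>
    (\<forall>x\<in>mspace X. \<forall>y\<in>mspace X. dist (h x) (h y) = mdist X x y) \<and>
    compact_flow S (\<lambda>r y. h (T r (k y)))"
proof -
  obtain h :: "'a \<Rightarrow> (nat \<Rightarrow>\<^sub>C real)" and k S where
    S: "compact S" "h ` mspace X = S" and hom: "homeomorphic_maps (mtopology_of X) (top_of_set S) h k"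
    and iso: "\<forall>x\<in>mspace X. \<forall>y\<in>mspace X. dist (h x) (h y) = mdist X x y"
    using compact_model[OF flow_compact] by (elim exE conjE)
  have ch: "continuous_map (mtopology_of X) (top_of_set S) h" and ck: "continuous_map (top_of_set S) (mtopology_of X) k"
    and kh: "\<And>x. x \<in> mspace X \<Longrightarrow> k (h x) = x" and hk: "\<And>y. y \<in> S \<Longrightarrow> h (k y) = y"
    using hom unfolding homeomorphic_maps_def topspace_mtopology_of topspace_euclidean_subtopology by blast+
  have kS: "k y \<in> mspace X" if "y \<in> S" for y
    using continuous_map_image_subset_topspace[OF ck] that by auto
  have hS: "h x \<in> S" if "x \<in> mspace X" for x using S(2) that by blast
  have "compact_flow S (\<lambda>r y. h (T r (k y)))"
  proof
    show "compact S" by (rule S(1))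
    have "continuous_map (prod_topology euclideanreal (top_of_set S)) (prod_topology euclideanreal (mtopology_of X)) (\<lambda>z. (fst z, k (snd z)))"
      by (intro continuous_map_pairedI continuous_map_fst continuous_map_compose[OF continuous_map_snd ck, unfolded o_def])
    from continuous_map_compose[OF continuous_map_compose[OF this flow_cont] ch]
    have "continuous_map (prod_topology euclideanreal (top_of_set S)) (top_of_set S) (\<lambda>z. h (T (fst z) (k (snd z))))"
      by (simp add: o_def)
    then have "continuous_map (top_of_set (UNIV \<times> S)) (top_of_set S) (\<lambda>z. h (T (fst z) (k (snd z))))"
      using prod_topology_subtopology_eu[of "UNIV :: real set" S] by simp
    then show "continuous_on (UNIV \<times> S) (\<lambda>z. h (T (fst z) (k (snd z))))"
      by (simp add: continuous_map_in_subtopology)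
    show "h (T r (k x)) \<in> S" if "x \<in> S" for x r by (intro hS flow_in kS that)
    show "h (T 0 (k x)) = x" if "x \<in> S" for x using flow_0[OF kS[OF that]] hk[OF that] by simp
    show "h (T r (k (h (T s (k x))))) = h (T (r + s) (k x))" if "x \<in> S" for x r s
      using kh[OF flow_in[OF kS[OF that]]] flow_add[OF kS[OF that]] by simp
  qed
  then show ?thesis using S(2) hom iso by (intro exI conjI)
qed

end

section \<open>Orbit metrics and Widim\<close>

lemma (in compact_flow) uniformly_equicontinuous:
  assumes e: "0 < e"
  shows "\<exists>d>0. \<forall>x\<in>S. \<forall>y\<in>S. \<forall>r\<in>{0..N}. dist x y < d \<longrightarrow> dist (T r x) (T r y) < e"
proof -
  have "uniformly_continuous_on ({0..N} \<times> S) (\<lambda>z. T (fst z) (snd z))"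
    by (intro compact_uniformly_continuous continuous_on_subset[OF cont] compact_Times compact) auto
  then have "\<exists>d>0. \<forall>z\<in>{0..N} \<times> S. \<forall>w\<in>{0..N} \<times> S. dist w z < d \<longrightarrow> dist (T (fst w) (snd w)) (T (fst z) (snd z)) < e"
    using e unfolding uniformly_continuous_on_def by (elim allE impE)
  then obtain d where d: "0 < d" "\<forall>z\<in>{0..N} \<times> S. \<forall>w\<in>{0..N} \<times> S. dist w z < d \<longrightarrow> dist (T (fst w) (snd w)) (T (fst z) (snd z)) < e"
    by (elim exE conjE)
  show ?thesis
  proof (intro exI[of _ d] conjI ballI impI d(1))
    fix x y r assume "x \<in> S" "y \<in> S" "dist x y < d" "r \<in> {0..N}"
    then show "dist (T r x) (T r y) < e"
      using d(2)[rule_format, of "(r, y)" "(r, x)"] by (simp add: dist_Pair_Pair)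
  qed
qed

lemma same_mtopology:
  assumes M: "mspace m1 = mspace m2"
    and 12: "\<And>x e. x \<in> mspace m1 \<Longrightarrow> 0 < e \<Longrightarrow> \<exists>d>0. \<forall>y\<in>mspace m1. mdist m1 x y < d \<longrightarrow> mdist m2 x y < e"
    and 21: "\<And>x e. x \<in> mspace m1 \<Longrightarrow> 0 < e \<Longrightarrow> \<exists>d>0. \<forall>y\<in>mspace m1. mdist m2 x y < d \<longrightarrow> mdist m1 x y < e"
  shows "mtopology_of m1 = mtopology_of m2"
proof -
  have op: "openin (mtopology_of m) U \<longleftrightarrow> U \<subseteq> mspace m \<and> (\<forall>x\<in>U. \<exists>r>0. \<forall>y\<in>mspace m. mdist m x y < r \<longrightarrow> y \<in> U)" for m :: "'a metric" and U
  proof -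
    interpret Metric_space "mspace m" "mdist m" by (rule Metric_space_mspace_mdist)
    show ?thesis
    proof (cases "U \<subseteq> mspace m")
      case True
      have "(mball x r \<subseteq> U) = (\<forall>y\<in>mspace m. mdist m x y < r \<longrightarrow> y \<in> U)" if "x \<in> U" for x r
        using True that by (auto simp: subset_iff)
      then show ?thesis unfolding mtopology_of_def openin_mtopology using True by (simp add: Ball_def)
    qed (simp add: mtopology_of_def openin_mtopology)
  qed
  show ?thesis
    unfolding topology_eq
  proof
    fix U
    show "openin (mtopology_of m1) U = openin (mtopology_of m2) U"
      unfolding op M[symmetric]
    proof (intro iffI conjI ballI; elim conjE)
      fix x assume U: "U \<subseteq> mspace m1" and x: "x \<in> U"
        and *: "\<forall>x\<in>U. \<exists>r>0. \<forall>y\<in>mspace m1. mdist m1 x y < r \<longrightarrow> y \<in> U"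
      obtain e where e: "0 < e" "\<forall>y\<in>mspace m1. mdist m1 x y < e \<longrightarrow> y \<in> U" using *[rule_format, OF x] by (elim exE conjE)
      obtain d where d: "0 < d" "\<forall>y\<in>mspace m1. mdist m2 x y < d \<longrightarrow> mdist m1 x y < e"
        using 21[OF subsetD[OF U x] e(1)] by (elim exE conjE)
      show "\<exists>r>0. \<forall>y\<in>mspace m1. mdist m2 x y < r \<longrightarrow> y \<in> U"
        using d e by (intro exI[of _ d] conjI ballI impI) simp_all
    next
      fix x assume U: "U \<subseteq> mspace m1" and x: "x \<in> U"
        and *: "\<forall>x\<in>U. \<exists>r>0. \<forall>y\<in>mspace m1. mdist m2 x y < r \<longrightarrow> y \<in> U"
      obtain e where e: "0 < e" "\<forall>y\<in>mspace m1. mdist m2 x y < e \<longrightarrow> y \<in> U" using *[rule_format, OF x] by (elim exE conjE)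
      obtain d where d: "0 < d" "\<forall>y\<in>mspace m1. mdist m1 x y < d \<longrightarrow> mdist m2 x y < e"
        using 12[OF subsetD[OF U x] e(1)] by (elim exE conjE)
      show "\<exists>r>0. \<forall>y\<in>mspace m1. mdist m1 x y < r \<longrightarrow> y \<in> U"
        using d e by (intro exI[of _ d] conjI ballI impI) simp_all
    qed
  qed
qed

text \<open>\<open>d\<close> is at most the orbit metric (time 0), and equicontinuity over the
  compact interval [0, N] gives the converse comparison. Continuity of an \<epsilon>-embedding thus
  does not depend on \<open>N\<close>.\<close>

lemma mtopology_orbit_metric:
  assumes fl: "flow (mtopology_of X) T" and N: "0 \<le> N"
  shows "mtopology_of (orbit_metric X T N) = mtopology_of X"
proof (rule same_mtopology)
  obtain h :: "'a \<Rightarrow> (nat \<Rightarrow>\<^sub>C real)" and k S where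
    S: "h ` mspace X = S" and hom: "homeomorphic_maps (mtopology_of X) (top_of_set S) h k"
    and iso': "\<forall>x\<in>mspace X. \<forall>y\<in>mspace X. dist (h x) (h y) = mdist X x y"
    and cf: "compact_flow S (\<lambda>r y. h (T r (k y)))"
    using flow_model[OF fl] by (elim exE conjE)
  note iso = iso'[rule_format]
  have kh: "k (h x) = x" if "x \<in> mspace X" for x using hom that unfolding homeomorphic_maps_def by simp
  note flow_in = flow_in[OF fl]
  show "mspace (orbit_metric X T N) = mspace X" by (rule mspace_orbit_metric[OF fl N])
  fix x and e :: real assume "x \<in> mspace (orbit_metric X T N)" and e: "0 < e"
  then have x: "x \<in> mspace X" using mspace_orbit_metric[OF fl N] by simp
  have "mdist X x y < e" if "y \<in> mspace X" "mdist (orbit_metric X T N) x y < e" for y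
    using mdist_orbit_upper[OF fl x that(1), of 0 N] N that flow_0[OF fl] x by simp
  then show "\<exists>d>0. \<forall>y\<in>mspace (orbit_metric X T N). mdist (orbit_metric X T N) x y < d \<longrightarrow> mdist X x y < e"
    using e mspace_orbit_metric[OF fl N] by auto
  \<comment> \<open>Half of \<open>e\<close>, because strict bounds for every \<open>r\<close> give
    only a weak bound for the supremum.\<close>
  obtain d where d: "0 < d" "\<forall>x\<in>S. \<forall>y\<in>S. \<forall>r\<in>{0..N}. dist x y < d \<longrightarrow> dist (h (T r (k x))) (h (T r (k y))) < e / 2"
    using compact_flow.uniformly_equicontinuous[OF cf half_gt_zero[OF e], of N] by (elim exE conjE)
  have "mdist (orbit_metric X T N) x y < e" if y: "y \<in> mspace X" and xy: "mdist X x y < d" for y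
  proof -
    have "mdist (orbit_metric X T N) x y \<le> e / 2"
    proof (rule mdist_orbit_least[OF fl x y N])
      fix r assume r: "0 \<le> r" "r \<le> N"
      have "dist (h (T r (k (h x)))) (h (T r (k (h y)))) < e / 2"
        using d(2)[rule_format, of "h x" "h y" r] S x y xy r iso[OF x y] by auto
      then show "mdist X (T r x) (T r y) \<le> e / 2"
        using iso[OF flow_in flow_in, of x y r r] x y kh by simp
    qed
    then show ?thesis using e by simp
  qed
  then show "\<exists>d>0. \<forall>y\<in>mspace (orbit_metric X T N). mdist X x y < d \<longrightarrow> mdist (orbit_metric X T N) x y < e"
    using d(1) mspace_orbit_metric[OF fl N] by auto
qed

text \<open>\<open>mean_dim_le X T \<epsilon> N n\<close> says that \<open>Widim\<^sub>\<epsilon> (X, d\<^sub>N) \<le> n\<close>.\<close>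

definition mean_dim_le :: "'a metric \<Rightarrow> (real \<Rightarrow> 'a \<Rightarrow> 'a) \<Rightarrow> real \<Rightarrow> real \<Rightarrow> nat \<Rightarrow> bool" where
  "mean_dim_le X T \<epsilon> N n \<longleftrightarrow>
     (\<exists>(K :: (nat \<Rightarrow> real) topology) f. compact_space K \<and> metrizable_space K \<and> covering_dim_le K (int n) \<and>
        eps_embedding (orbit_metric X T N) \<epsilon> K f)"

lemma covering_dim_le_nonempty:
  assumes "covering_dim_le K n" "x \<in> topspace K"
  shows "0 \<le> n"
proof -
  obtain \<V> where V: "\<Union>\<V> = topspace K" "\<forall>x\<in>topspace K. finite {V\<in>\<V>. x \<in> V} \<and> int (card {V\<in>\<V>. x \<in> V}) \<le> n + 1"
    using assms(1)[unfolded covering_dim_le_def, THEN spec, of "{topspace K}"] by auto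
  have "x \<in> \<Union>\<V>" using V(1) assms(2) by simp
  then have "{V\<in>\<V>. x \<in> V} \<noteq> {}" by blast
  moreover have "finite {V\<in>\<V>. x \<in> V}" "int (card {V\<in>\<V>. x \<in> V}) \<le> n + 1" using V(2) assms(2) by blast+
  ultimately have "0 < card {V\<in>\<V>. x \<in> V}" by (simp add: card_gt_0_iff)
  then show ?thesis using \<open>int (card {V\<in>\<V>. x \<in> V}) \<le> n + 1\<close> by linarith
qed

lemma eps_embeddingD:
  assumes "eps_embedding m \<epsilon> K f"
  shows "continuous_map (mtopology_of m) K f"
    and "x \<in> mspace m \<Longrightarrow> y \<in> mspace m \<Longrightarrow> f x = f y \<Longrightarrow> mdist m x y < \<epsilon>"
  using assms by (simp_all add: eps_embedding_def)

text \<open>A nonempty space forces a nonempty target, which excludes dimension -1; so the infimum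
  may run over natural numbers.\<close>

lemma widim_eq:
  assumes ne: "mspace m \<noteq> {}" and m: "m = orbit_metric X T N"
  shows "widim \<epsilon> m = (INF n\<in>Collect (mean_dim_le X T \<epsilon> N). ereal (real n))"
proof (rule antisym)
  show "widim \<epsilon> m \<le> (INF n\<in>Collect (mean_dim_le X T \<epsilon> N). ereal (real n))"
  proof (rule INF_greatest)
    fix n assume "n \<in> Collect (mean_dim_le X T \<epsilon> N)"
    then obtain K :: "(nat \<Rightarrow> real) topology" and f where K: "compact_space K" "metrizable_space K" "covering_dim_le K (int n)"
      "eps_embedding (orbit_metric X T N) \<epsilon> K f" unfolding mean_dim_le_def by blast
    have "widim \<epsilon> m \<le> covering_dim K"
      unfolding widim_def by (rule INF_lower) (use K m in blast)
    also have "\<dots> \<le> ereal (real_of_int (int n))"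
      unfolding covering_dim_def by (rule INF_lower) (use K in simp)
    finally show "widim \<epsilon> m \<le> ereal (real n)" by simp
  qed
  show "(INF n\<in>Collect (mean_dim_le X T \<epsilon> N). ereal (real n)) \<le> widim \<epsilon> m"
    unfolding widim_def covering_dim_def
  proof (intro INF_greatest)
    fix K :: "(nat \<Rightarrow> real) topology" and n :: int
    assume "K \<in> {K. compact_space K \<and> metrizable_space K \<and> (\<exists>f. eps_embedding m \<epsilon> K f)}"
      and "n \<in> {n. - 1 \<le> n \<and> covering_dim_le K n}"
    then obtain f where K: "compact_space K" "metrizable_space K" "eps_embedding m \<epsilon> K f" and n: "covering_dim_le K n" by blast
    obtain x where x: "x \<in> mspace m" using ne by blast
    have "f x \<in> topspace K"
      using continuous_map_image_subset_topspace[OF eps_embeddingD(1)[OF K(3)]] x by auto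
    then have n0: "0 \<le> n" by (rule covering_dim_le_nonempty[OF n])
    have "mean_dim_le X T \<epsilon> N (nat n)"
      unfolding mean_dim_le_def using K n n0 m by auto
    then have "(INF n\<in>Collect (mean_dim_le X T \<epsilon> N). ereal (real n)) \<le> ereal (real (nat n))"
      by (intro INF_lower) simp
    then show "(INF n\<in>Collect (mean_dim_le X T \<epsilon> N). ereal (real n)) \<le> ereal (real_of_int n)" using n0 by simp
  qed
qed

lemma homeomorphic_maps_imp:
  assumes "homeomorphic_maps X Y h k"
  shows "X homeomorphic_space Y" and "continuous_map X Y h" and "inj_on h (topspace X)"
proof -
  show "X homeomorphic_space Y" using assms unfolding homeomorphic_space_def by (intro exI)
  show "continuous_map X Y h" using assms by (simp add: homeomorphic_maps_def)
  show "inj_on h (topspace X)"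
    by (rule inj_on_inverseI[of _ k]) (use assms in \<open>simp add: homeomorphic_maps_def\<close>)
qed

lemma compact_metrizable_typed_model:
  assumes "compact_space K" "metrizable_space K" "covering_dim_le K n"
  shows "\<exists>(S :: (nat \<Rightarrow>\<^sub>C real) set) h. compact S \<and> covering_dim_le (top_of_set S) n \<and>
    continuous_map K (top_of_set S) h \<and> inj_on h (topspace K)"
proof (rule compact_metrizable_model[OF assms(1,2)])
  fix S :: "(nat \<Rightarrow>\<^sub>C real) set" and h k
  assume S: "compact S" and h: "homeomorphic_maps K (top_of_set S) h k"
  show ?thesis
    using S covering_dim_le_homeomorphic[OF homeomorphic_maps_imp(1)[OF h] assms(3)] homeomorphic_maps_imp(2,3)[OF h]
    by (intro exI conjI)
qed

lemma compact_metrizable_sequence_model: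
  assumes "compact_space K" "metrizable_space K" "covering_dim_le K n"
  shows "\<exists>(P :: (nat \<Rightarrow> real) topology) h. compact_space P \<and> metrizable_space P \<and> covering_dim_le P n \<and>
    continuous_map K P h \<and> inj_on h (topspace K)"
proof -
  obtain P :: "(nat \<Rightarrow> real) topology" where P: "compact_space P" "metrizable_space P" and hP: "K homeomorphic_space P"
    using compact_metrizable_representative[OF assms(1,2)] by (elim exE conjE)
  obtain h k where h: "homeomorphic_maps K P h k" using hP unfolding homeomorphic_space_def by (elim exE)
  show ?thesis
    using P covering_dim_le_homeomorphic[OF hP assms(3)] homeomorphic_maps_imp(2,3)[OF h] by (intro exI conjI)
qed

section \<open>Subadditivity of Widim and existence of the limits\<close>

context
  fixes X :: "'a metric" and T :: "real \<Rightarrow> 'a \<Rightarrow> 'a"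
  assumes fl: "flow (mtopology_of X) T"
begin

lemma mean_dim_leD:
  assumes "mean_dim_le X T \<epsilon> N n" "0 \<le> N"
  obtains K :: "(nat \<Rightarrow> real) topology" and f where "compact_space K" "metrizable_space K" "covering_dim_le K (int n)"
    "continuous_map (mtopology_of X) K f"
    "\<forall>x\<in>mspace X. \<forall>y\<in>mspace X. f x = f y \<longrightarrow> mdist (orbit_metric X T N) x y < \<epsilon>"
proof -
  obtain K :: "(nat \<Rightarrow> real) topology" and f where K: "compact_space K" "metrizable_space K" "covering_dim_le K (int n)"
      and f: "eps_embedding (orbit_metric X T N) \<epsilon> K f" using assms(1) unfolding mean_dim_le_def by blast
  show ?thesis
  proof (rule that[OF K])
    show "continuous_map (mtopology_of X) K f"
      using eps_embeddingD(1)[OF f] unfolding mtopology_orbit_metric[OF fl assms(2)] .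
    show "\<forall>x\<in>mspace X. \<forall>y\<in>mspace X. f x = f y \<longrightarrow> mdist (orbit_metric X T N) x y < \<epsilon>"
      using eps_embeddingD(2)[OF f] unfolding mspace_orbit_metric[OF fl assms(2)] by blast
  qed
qed

lemma mean_dim_leI:
  fixes K :: "(nat \<Rightarrow> real) topology"
  assumes "0 \<le> N" "compact_space K" "metrizable_space K" "covering_dim_le K (int n)"
    "continuous_map (mtopology_of X) K f"
    "\<And>x y. x \<in> mspace X \<Longrightarrow> y \<in> mspace X \<Longrightarrow> f x = f y \<Longrightarrow> mdist (orbit_metric X T N) x y < \<epsilon>"
  shows "mean_dim_le X T \<epsilon> N n"
proof -
  have "eps_embedding (orbit_metric X T N) \<epsilon> K f"
    unfolding eps_embedding_def mtopology_orbit_metric[OF fl assms(1)] mspace_orbit_metric[OF fl assms(1)]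
    using assms(5,6) by blast
  then show ?thesis unfolding mean_dim_le_def using assms(2-4) by blast
qed

lemma mean_dim_le_mono:
  assumes "mean_dim_le X T \<epsilon> N n" "0 \<le> N'" "N' \<le> N" "\<epsilon> \<le> \<epsilon>'"
  shows "mean_dim_le X T \<epsilon>' N' n"
proof -
  have N: "0 \<le> N" using assms by simp
  obtain K :: "(nat \<Rightarrow> real) topology" and f where K: "compact_space K" "metrizable_space K" "covering_dim_le K (int n)"
    "continuous_map (mtopology_of X) K f"
    and f: "\<forall>x\<in>mspace X. \<forall>y\<in>mspace X. f x = f y \<longrightarrow> mdist (orbit_metric X T N) x y < \<epsilon>"
    by (rule mean_dim_leD[OF assms(1) N])
  show ?thesis
  proof (rule mean_dim_leI[OF assms(2) K])
    fix x y assume xy: "x \<in> mspace X" "y \<in> mspace X" "f x = f y"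
    have "mdist (orbit_metric X T N') x y \<le> mdist (orbit_metric X T N) x y"
      using assms(3) by (intro mdist_orbit_least[OF fl xy(1,2) assms(2)] mdist_orbit_upper[OF fl xy(1,2)]) auto
    then show "mdist (orbit_metric X T N') x y < \<epsilon>'" using f xy assms(4) by fastforce
  qed
qed

text \<open>The map x \<mapsto> (f x, g (T N x)) controls the times up to \<open>N\<close> by its
  first component and the remaining ones by its second; its target has dimension at most n + m by
  the product theorem.\<close>

lemma mean_dim_le_add:
  assumes A: "mean_dim_le X T \<epsilon> N n" and B: "mean_dim_le X T \<epsilon> M m" and N: "0 \<le> N" and M: "0 \<le> M"
  shows "mean_dim_le X T \<epsilon> (N + M) (n + m)"
proof -
  obtain K :: "(nat \<Rightarrow> real) topology" and f where K: "compact_space K" "metrizable_space K" "covering_dim_le K (int n)"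
    "continuous_map (mtopology_of X) K f"
    and f: "\<forall>x\<in>mspace X. \<forall>y\<in>mspace X. f x = f y \<longrightarrow> mdist (orbit_metric X T N) x y < \<epsilon>"
    by (rule mean_dim_leD[OF A N])
  obtain L :: "(nat \<Rightarrow> real) topology" and g where L: "compact_space L" "metrizable_space L" "covering_dim_le L (int m)"
    "continuous_map (mtopology_of X) L g"
    and g: "\<forall>x\<in>mspace X. \<forall>y\<in>mspace X. g x = g y \<longrightarrow> mdist (orbit_metric X T M) x y < \<epsilon>"
    by (rule mean_dim_leD[OF B M])
  obtain S :: "(nat \<Rightarrow>\<^sub>C real) set" and h1 where S: "compact S" and dS: "covering_dim_le (top_of_set S) (int n)"
    and ch1: "continuous_map K (top_of_set S) h1" and i1: "inj_on h1 (topspace K)"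
    using compact_metrizable_typed_model[OF K(1,2,3)] by (elim exE conjE)
  obtain S' :: "(nat \<Rightarrow>\<^sub>C real) set" and h2 where S': "compact S'" and dS': "covering_dim_le (top_of_set S') (int m)"
    and ch2: "continuous_map L (top_of_set S') h2" and i2: "inj_on h2 (topspace L)"
    using compact_metrizable_typed_model[OF L(1,2,3)] by (elim exE conjE)
  have dP: "covering_dim_le (top_of_set (S \<times> S')) (int (n + m))" by (rule covering_dim_le_Times[OF S dS S' dS'])
  have cP: "compact_space (top_of_set (S \<times> S'))"
    using compact_Times[OF S S'] by (simp add: compact_space_def compactin_subtopology)
  have mP: "metrizable_space (top_of_set (S \<times> S'))"
    by (intro metrizable_space_subtopology metrizable_space_euclidean)
  obtain P :: "(nat \<Rightarrow> real) topology" and h where P: "compact_space P" "metrizable_space P" "covering_dim_le P (int (n + m))"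
    and ch: "continuous_map (top_of_set (S \<times> S')) P h" and ih: "inj_on h (topspace (top_of_set (S \<times> S')))"
    using compact_metrizable_sequence_model[OF cP mP dP] by (elim exE conjE)
  define F where "F x = (h1 (f x), h2 (g (T N x)))" for x
  have cf: "continuous_map (mtopology_of X) (top_of_set S) (\<lambda>x. h1 (f x))"
    using continuous_map_compose[OF K(4) ch1] by (simp add: o_def)
  have cg: "continuous_map (mtopology_of X) (top_of_set S') (\<lambda>x. h2 (g (T N x)))"
    using continuous_map_compose[OF continuous_map_compose[OF flow_map_continuous[OF fl] L(4)] ch2] by (simp add: o_def)
  have cF: "continuous_map (mtopology_of X) (top_of_set (S \<times> S')) F"
    using continuous_map_pairedI[OF cf cg] unfolding F_def prod_topology_subtopology_eu .
  have FS: "F x \<in> S \<times> S'" if "x \<in> mspace X" for x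
    using continuous_map_image_subset_topspace[OF cF] that by auto
  have NM: "0 \<le> N + M" using N M by simp
  show ?thesis
  proof (rule mean_dim_leI[OF NM P])
    show "continuous_map (mtopology_of X) P (\<lambda>x. h (F x))"
      using continuous_map_compose[OF cF ch] by (simp add: o_def)
    fix x y assume x: "x \<in> mspace X" and y: "y \<in> mspace X" and eq: "h (F x) = h (F y)"
    have "F x = F y" using inj_onD[OF ih eq] FS[OF x] FS[OF y] by simp
    then have e1: "h1 (f x) = h1 (f y)" and e2: "h2 (g (T N x)) = h2 (g (T N y))" by (simp_all add: F_def)
    have fK: "f z \<in> topspace K" "g z \<in> topspace L" if "z \<in> mspace X" for z
      using continuous_map_image_subset_topspace[OF K(4)] continuous_map_image_subset_topspace[OF L(4)] that by auto
    note TN = flow_in[OF fl, of _ N]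
    have "f x = f y" by (rule inj_onD[OF i1 e1 fK(1)[OF x] fK(1)[OF y]])
    then have 1: "mdist (orbit_metric X T N) x y < \<epsilon>" using f x y by blast
    have "g (T N x) = g (T N y)" by (rule inj_onD[OF i2 e2 fK(2)[OF TN[OF x]] fK(2)[OF TN[OF y]]])
    then have 2: "mdist (orbit_metric X T M) (T N x) (T N y) < \<epsilon>" using g TN x y by blast
    have "mdist (orbit_metric X T (N + M)) x y \<le> max (mdist (orbit_metric X T N) x y) (mdist (orbit_metric X T M) (T N x) (T N y))"
    proof (rule mdist_orbit_least[OF fl x y NM])
      fix r assume r: "0 \<le> r" "r \<le> N + M"
      show "mdist X (T r x) (T r y) \<le> max (mdist (orbit_metric X T N) x y) (mdist (orbit_metric X T M) (T N x) (T N y))"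
      proof (cases "r \<le> N")
        case True
        from mdist_orbit_upper[OF fl x y r(1) True] show ?thesis by (rule max.coboundedI1)
      next
        case False
        then have rN: "0 \<le> r - N" "r - N \<le> M" using r by auto
        have "T (r - N) (T N x) = T r x" "T (r - N) (T N y) = T r y"
          using flow_add[OF fl x, of "r - N" N] flow_add[OF fl y, of "r - N" N] by simp_all
        with mdist_orbit_upper[OF fl TN[OF x] TN[OF y] rN]
        have "mdist X (T r x) (T r y) \<le> mdist (orbit_metric X T M) (T N x) (T N y)" by simp
        then show ?thesis by (rule max.coboundedI2)
      qed
    qed
    also have "\<dots> < \<epsilon>" using 1 2 by simp
    finally show "mdist (orbit_metric X T (N + M)) x y < \<epsilon>" .
  qed
qed

lemma mean_dim_le_mult:
  assumes A: "mean_dim_le X T \<epsilon> N n" and N: "0 \<le> N"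
  shows "mean_dim_le X T \<epsilon> (real (Suc q) * N) (Suc q * n)"
proof (induction q)
  case 0 then show ?case using A by simp
next
  case (Suc q)
  have "0 \<le> real (Suc q) * N" using N by simp
  from mean_dim_le_add[OF A Suc N this] show ?case by (simp add: distrib_right add.commute add.left_commute)
qed

text \<open>The limit exists by Fekete's argument, since \<open>Widim\<^sub>\<epsilon> (X, d\<^sub>N)\<close> is subadditive and monotone in \<open>N\<close>.\<close>

lemma widim_limit:
  assumes ne: "mspace X \<noteq> {}"
  shows "((\<lambda>N. widim \<epsilon> (orbit_metric X T N) / ereal N) \<longlongrightarrow>
            (INF N\<in>{0<..}. widim \<epsilon> (orbit_metric X T N) / ereal N)) at_top"
    (is "(?g \<longlongrightarrow> ?L) at_top")
proof (rule order_tendstoI)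
  fix l assume "l < ?L"
  then show "\<forall>\<^sub>F N in at_top. l < ?g N"
  proof -
    have "l < ?g N" if "0 < N" for N
      using \<open>l < ?L\<close> INF_lower[of N "{0<..}" ?g] that by (simp add: less_le_trans)
    then show ?thesis by (rule eventually_mono[OF eventually_gt_at_top[of 0]])
  qed
next
  have w: "widim \<epsilon> (orbit_metric X T N) = (INF n\<in>Collect (mean_dim_le X T \<epsilon> N). ereal (real n))" if "0 < N" for N
    by (rule widim_eq[OF _ refl]) (use ne mspace_orbit_metric[OF fl, of N] that in simp)
  fix c assume "?L < c"
  then obtain c' where c': "?L < ereal c'" "ereal c' < c" using ereal_dense2 by blast
  then obtain N0 where N0: "0 < N0" "?g N0 < ereal c'" unfolding INF_less_iff by auto
  have "widim \<epsilon> (orbit_metric X T N0) < ereal (c' * N0)"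
    using N0 by (simp add: ereal_divide_less_iff mult.commute)
  then obtain n0 where n0: "mean_dim_le X T \<epsilon> N0 n0" "real n0 < c' * N0"
    unfolding w[OF N0(1)] INF_less_iff by auto
  have bound: "?g N \<le> ereal (real n0 / N0 + real n0 / N)" if N: "0 < N" for N
  proof -
    \<comment> \<open>Rounding \<open>N / N0\<close> up to \<open>Suc q\<close> blocks costs at most
      one extra block, which is the vanishing term \<open>n0 / N\<close>.\<close>
    define q where "q = nat \<lfloor>N / N0\<rfloor>"
    have q: "real q \<le> N / N0" "N / N0 < real (Suc q)"
      using N N0(1) unfolding q_def by (simp_all add: of_nat_nat) linarith+
    have "N \<le> real (Suc q) * N0" using q(2) N0(1) by (simp add: pos_divide_less_eq less_imp_le)
    then have "mean_dim_le X T \<epsilon> N (Suc q * n0)"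
      using mean_dim_le_mono[OF mean_dim_le_mult[OF n0(1) less_imp_le[OF N0(1)]] less_imp_le[OF N]] by blast
    then have "widim \<epsilon> (orbit_metric X T N) \<le> ereal (real (Suc q * n0))"
      unfolding w[OF N] by (intro INF_lower) simp
    then have "?g N \<le> ereal (real (Suc q * n0)) / ereal N" using N by (intro ereal_divide_right_mono) auto
    also have "\<dots> = ereal (real (Suc q) * real n0 / N)" using N by (simp add: distrib_right)
    also have "\<dots> \<le> ereal ((N / N0 + 1) * real n0 / N)"
      using q N by (simp add: divide_right_mono mult_right_mono)
    also have "(N / N0 + 1) * real n0 / N = real n0 / N0 + real n0 / N" using N N0(1) by (simp add: field_simps)
    finally show ?thesis .
  qed
  have "((\<lambda>N. real n0 / N0 + real n0 / N) \<longlongrightarrow> real n0 / N0 + 0) at_top"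
    by (intro tendsto_add tendsto_const tendsto_divide_0[OF tendsto_const] filterlim_at_top_imp_at_infinity filterlim_ident)
  moreover have "real n0 / N0 + 0 < c'" using n0(2) N0(1) by (simp add: pos_divide_less_eq)
  ultimately have "\<forall>\<^sub>F N in at_top. real n0 / N0 + real n0 / N < c'" by (rule order_tendstoD(2))
  then show "\<forall>\<^sub>F N in at_top. ?g N < c"
    using eventually_gt_at_top[of 0]
  proof eventually_elim
    case (elim N)
    have "?g N \<le> ereal (real n0 / N0 + real n0 / N)" by (rule bound[OF elim(2)])
    also have "\<dots> < ereal c'" using elim(1) by simp
    finally show ?case using c'(2) by simp
  qed
qed

text \<open>Identifies the inner \<open>Lim\<close> with an infimum over \<open>N\<close> and the
  outer one with a supremum over \<epsilon>, so that an upper bound on \<open>mdim\<close> holds for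
  every single \<epsilon>.\<close>

lemma mdim_less_imp:
  assumes ne: "mspace X \<noteq> {}" and \<rho>: "mdim X T < ereal \<rho>" and \<epsilon>: "0 < \<epsilon>"
  shows "\<forall>\<^sub>F N in at_top. \<exists>n. mean_dim_le X T \<epsilon> N n \<and> real n < \<rho> * N"
proof -
  define L where "L \<epsilon> = (INF N\<in>{0<..}. widim \<epsilon> (orbit_metric X T N) / ereal N)" for \<epsilon>
  have w: "widim \<epsilon> (orbit_metric X T N) = (INF n\<in>Collect (mean_dim_le X T \<epsilon> N). ereal (real n))" if "0 < N" for N \<epsilon>
    by (rule widim_eq[OF _ refl]) (use ne mspace_orbit_metric[OF fl, of N] that in simp)
  have LimL: "Lim at_top (\<lambda>N. widim \<epsilon> (orbit_metric X T N) / ereal N) = L \<epsilon>" for \<epsilon>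
    unfolding L_def by (rule tendsto_Lim[OF _ widim_limit[OF ne]]) simp
  \<comment> \<open>An \<epsilon>-embedding is also one for any larger \<epsilon>', so the limit as
    \<epsilon> decreases to 0 is a supremum.\<close>
  have anti: "L \<epsilon>' \<le> L \<epsilon>" if "\<epsilon> \<le> \<epsilon>'" for \<epsilon> \<epsilon>'
    unfolding L_def
  proof (rule INF_mono)
    fix N :: real assume N: "N \<in> {0<..}"
    have "widim \<epsilon>' (orbit_metric X T N) \<le> widim \<epsilon> (orbit_metric X T N)"
      unfolding w[OF N[simplified]]
      by (rule INF_superset_mono) (use mean_dim_le_mono[OF _ _ order_refl that] N in auto)
    then show "\<exists>M\<in>{0<..}. widim \<epsilon>' (orbit_metric X T M) / ereal M \<le> widim \<epsilon> (orbit_metric X T N) / ereal N"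
      using N by (intro bexI[of _ N] ereal_divide_right_mono) auto
  qed
  have "(L \<longlongrightarrow> (SUP \<epsilon>\<in>{0<..}. L \<epsilon>)) (at_right 0)"
  proof (rule order_tendstoI)
    fix l assume "l < (SUP \<epsilon>\<in>{0<..}. L \<epsilon>)"
    then obtain d where d: "0 < d" "l < L d" unfolding less_SUP_iff by auto
    have "l < L \<epsilon>" if "\<epsilon> < d" for \<epsilon> using d(2) anti[of \<epsilon> d] that by simp
    then show "\<forall>\<^sub>F \<epsilon> in at_right 0. l < L \<epsilon>"
      unfolding eventually_at_right_field using d(1) by blast
  next
    fix c assume c: "(SUP \<epsilon>\<in>{0<..}. L \<epsilon>) < c"
    have "L \<epsilon> < c" if "0 < \<epsilon>" for \<epsilon>
      using c SUP_upper[of \<epsilon> "{0<..}" L] that by (simp add: le_less_trans)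
    then show "\<forall>\<^sub>F \<epsilon> in at_right 0. L \<epsilon> < c"
      unfolding eventually_at_right_field using zero_less_one by blast
  qed
  then have "mdim X T = (SUP \<epsilon>\<in>{0<..}. L \<epsilon>)"
    unfolding mdim_def LimL by (intro tendsto_Lim) auto
  then have "L \<epsilon> < ereal \<rho>"
    using \<rho> SUP_upper[of \<epsilon> "{0<..}" L] \<epsilon> by (simp add: le_less_trans)
  then have "\<forall>\<^sub>F N in at_top. widim \<epsilon> (orbit_metric X T N) / ereal N < ereal \<rho>"
    using order_tendstoD(2)[OF widim_limit[OF ne, of \<epsilon>]] by (simp add: L_def)
  then show ?thesis
    using eventually_gt_at_top[of 0]
  proof eventually_elim
    case (elim N)
    then have "widim \<epsilon> (orbit_metric X T N) < ereal (\<rho> * N)" by (simp add: ereal_divide_less_iff mult.commute)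
    then show ?case unfolding w[OF elim(2)] INF_less_iff by auto
  qed
qed

end

section \<open>From small fibres to fine covers\<close>

context compact_flow
begin

text \<open>The triples (x, y, r) whose images under time \<open>r\<close> are at distance at least
  \<epsilon> form a compact set on which the distance of \<open>F x\<close> and \<open>F y\<close>
  is positive; its minimum is the required \<open>d\<close>.\<close>

lemma fibre_small_imp_near_small:
  fixes F :: "'a \<Rightarrow> 'b::metric_space"
  assumes cF: "continuous_on S F"
    and small: "\<forall>x\<in>S. \<forall>y\<in>S. \<forall>r\<in>{0..N}. F x = F y \<longrightarrow> dist (T r x) (T r y) < \<epsilon>"
  shows "\<exists>d>0. \<forall>x\<in>S. \<forall>y\<in>S. \<forall>r\<in>{0..N}. dist (F x) (F y) < d \<longrightarrow> dist (T r x) (T r y) < \<epsilon>"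
proof -
  define A where "A = (S \<times> S) \<times> {0..N}"
  define g where "g z = dist (T (snd z) (fst (fst z))) (T (snd z) (snd (fst z)))" for z
  define f where "f z = dist (F (fst (fst z))) (F (snd (fst z)))" for z :: "('a \<times> 'a) \<times> real"
  have cA: "compact A" unfolding A_def by (intro compact_Times compact compact_Icc)
  have cg: "continuous_on A g"
    unfolding g_def by (intro continuous_on_dist continuous_on_T continuous_intros) (auto simp: A_def)
  have cf: "continuous_on A f"
    unfolding f_def
    by (intro continuous_on_dist continuous_on_compose2[OF cF] continuous_intros) (auto simp: A_def)
  define B where "B = A \<inter> g -` {\<epsilon>..}"
  have "closed B" unfolding B_def by (intro continuous_closed_preimage cg compact_imp_closed cA closed_atLeast)
  then have cB: "compact B" using compact_Int_closed[OF cA, of B] by (simp add: B_def Int_absorb1)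
  have fpos: "0 < f z" if "z \<in> B" for z
  proof -
    have "F (fst (fst z)) \<noteq> F (snd (fst z))"
      using small[rule_format, of "fst (fst z)" "snd (fst z)" "snd z"] that by (auto simp: B_def A_def g_def)
    then show ?thesis by (simp add: f_def)
  qed
  have far: "((x, y), r) \<in> B" if "x \<in> S" "y \<in> S" "r \<in> {0..N}" "\<not> dist (T r x) (T r y) < \<epsilon>" for x y r
    using that by (simp add: B_def A_def g_def)
  show ?thesis
  proof (cases "B = {}")
    case True
    then have "dist (T r x) (T r y) < \<epsilon>" if "x \<in> S" "y \<in> S" "r \<in> {0..N}" for x y r
      using far[OF that] by blast
    then show ?thesis by (intro exI[of _ 1] conjI ballI impI) simp_all
  next
    case False
    obtain z where z: "z \<in> B" "\<forall>w\<in>B. f z \<le> f w"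
      using continuous_attains_inf[OF cB False continuous_on_subset[OF cf]] by (auto simp: B_def)
    show ?thesis
    proof (intro exI[of _ "f z"] conjI fpos z(1) ballI impI, rule ccontr)
      fix x y r assume "x \<in> S" "y \<in> S" "r \<in> {0..N}" "dist (F x) (F y) < f z" "\<not> dist (T r x) (T r y) < \<epsilon>"
      then show False using z(2)[rule_format, OF far[of x y r]] by (simp add: f_def)
    qed
  qed
qed

text \<open>Pull back a finite cover of \<open>K\<close> by sets inside balls of radius
  \<open>d / 2\<close>, of multiplicity at most n + 1 \<le> m.\<close>

lemma fine_cover_if_fibres_small:
  fixes F :: "'a \<Rightarrow> 'b::metric_space"
  assumes K: "compact K" "covering_dim_le (top_of_set K) (int n)" and nm: "n < m"
    and cF: "continuous_on S F" and FK: "F ` S \<subseteq> K"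
    and small: "\<forall>x\<in>S. \<forall>y\<in>S. \<forall>r\<in>{0..N}. F x = F y \<longrightarrow> dist (T r x) (T r y) < \<epsilon>"
  shows "fine_cover N m \<epsilon>"
proof -
  obtain d where d: "0 < d" "\<forall>x\<in>S. \<forall>y\<in>S. \<forall>r\<in>{0..N}. dist (F x) (F y) < d \<longrightarrow> dist (T r x) (T r y) < \<epsilon>"
    using fibre_small_imp_near_small[OF cF small] by (elim exE conjE)
  define \<U> where "\<U> = (\<lambda>z. K \<inter> ball z (d / 2)) ` K"
  have opU: "openin (top_of_set K) U" if "U \<in> \<U>" for U
    using that unfolding \<U>_def by (elim imageE) (simp add: openin_open_Int)
  have covU: "\<Union>\<U> = K" using d(1) by (force simp: \<U>_def)
  obtain \<V> where V: "finite \<V>" "\<And>V. V \<in> \<V> \<Longrightarrow> openin (top_of_set K) V" "\<And>V. V \<in> \<V> \<Longrightarrow> \<exists>U\<in>\<U>. V \<subseteq> U"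
    "\<Union>\<V> = K" "\<And>x. x \<in> K \<Longrightarrow> int (card {V\<in>\<V>. x \<in> V}) \<le> int n + 1"
    using finite_refinement[OF K opU covU] by blast
  have exG: "\<exists>G. open G \<and> S \<inter> G = S \<inter> F -` V" if "V \<in> \<V>" for V
  proof -
    have "openin (top_of_set S) (S \<inter> F -` V)"
      by (rule continuous_openin_preimage[OF cF _ V(2)[OF that]]) (use FK in auto)
    then show ?thesis unfolding openin_open by auto
  qed
  \<comment> \<open>Preimages are only relatively open; \<open>fine_cover\<close> asks for open sets
    of the whole type, so each is extended off \<open>S\<close>.\<close>
  define G where "G V = (SOME G. open G \<and> S \<inter> G = S \<inter> F -` V)" for V
  have G: "open (G V)" "S \<inter> G V = S \<inter> F -` V" if "V \<in> \<V>" for V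
    using someI_ex[OF exG[OF that]] by (simp_all add: G_def)
  obtain g where g: "bij_betw g {0..<card \<V>} \<V>" using ex_bij_betw_nat_finite[OF V(1)] by blast
  have gV: "g i \<in> \<V>" if "i < card \<V>" for i using bij_betwE[OF g] that by simp
  have mem: "x \<in> G (g i) \<longleftrightarrow> F x \<in> g i" if "i < card \<V>" "x \<in> S" for i x
    using G(2)[OF gV[OF that(1)]] that(2) by blast
  show ?thesis
    unfolding fine_cover_def
  proof (intro exI[of _ "card \<V>"] exI[of _ "\<lambda>i. G (g i)"] conjI allI impI ballI)
    show "open (G (g i))" if "i < card \<V>" for i by (rule G(1)[OF gV[OF that]])
    show "S \<subseteq> (\<Union>i<card \<V>. G (g i))"
    proof
      fix x assume x: "x \<in> S"
      then have "F x \<in> \<Union>\<V>" using FK V(4) by blast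
      then obtain V where V': "V \<in> \<V>" "F x \<in> V" by blast
      then have "V \<in> g ` {0..<card \<V>}" using bij_betw_imp_surj_on[OF g] by simp
      then obtain i where "i < card \<V>" "g i = V" by (elim imageE) simp
      then show "x \<in> (\<Union>i<card \<V>. G (g i))" using mem[of i x] x V' by auto
    qed
    show "card {i. i < card \<V> \<and> x \<in> G (g i)} \<le> m" if x: "x \<in> S" for x
    proof -
      have "card {i. i < card \<V> \<and> x \<in> G (g i)} = card (g ` {i. i < card \<V> \<and> x \<in> G (g i)})"
        by (rule card_image[symmetric], rule inj_on_subset[OF bij_betw_imp_inj_on[OF g]]) auto
      also have "\<dots> \<le> card {V\<in>\<V>. F x \<in> V}"
      proof (rule card_mono)
        show "finite {V\<in>\<V>. F x \<in> V}" using V(1) by simp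
        show "g ` {i. i < card \<V> \<and> x \<in> G (g i)} \<subseteq> {V\<in>\<V>. F x \<in> V}"
        proof
          fix W assume "W \<in> g ` {i. i < card \<V> \<and> x \<in> G (g i)}"
          then obtain i where i: "i < card \<V>" "x \<in> G (g i)" "W = g i" by blast
          then show "W \<in> {V\<in>\<V>. F x \<in> V}" using gV[OF i(1)] mem[OF i(1) x] by simp
        qed
      qed
      also have "\<dots> \<le> n + 1"
      proof -
        have "F x \<in> K" using FK x by blast
        from V(5)[OF this] show ?thesis by simp
      qed
      finally show ?thesis using nm by simp
    qed
    fix i x y r assume i: "i < card \<V>" and x: "x \<in> S \<inter> G (g i)" and y: "y \<in> S \<inter> G (g i)" and r: "r \<in> {0..N}"
    obtain z where z: "g i \<subseteq> K \<inter> ball z (d / 2)" using V(3)[OF gV[OF i]] unfolding \<U>_def by blast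
    have "F x \<in> g i" "F y \<in> g i" using mem[OF i, of x] mem[OF i, of y] x y by simp_all
    then have "F x \<in> ball z (d / 2)" "F y \<in> ball z (d / 2)" using z by blast+
    then have "dist (F x) (F y) < d" using dist_triangle3[of "F x" "F y" z] by simp
    moreover have "x \<in> S" "y \<in> S" using x y by blast+
    ultimately show "dist (T r x) (T r y) < \<epsilon>" using d(2)[rule_format, of x y r] r by blast
  qed
qed

end

section \<open>The solenoid\<close>

lemma coset_eq_iff: "coset n r = coset n s \<longleftrightarrow> (\<exists>k::int. r = s + of_int k * fact n)"
proof
  assume "coset n r = coset n s"
  moreover have "r \<in> coset n r" unfolding coset_def by (rule range_eqI[of _ _ 0]) simp
  ultimately show "\<exists>k::int. r = s + of_int k * fact n" unfolding coset_def by blast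
next
  assume "\<exists>k::int. r = s + of_int k * fact n"
  then obtain k :: int where k: "r = s + of_int k * fact n" by blast
  show "coset n r = coset n s"
  proof (intro equalityI subsetI)
    fix z assume "z \<in> coset n r"
    then obtain l :: int where "z = r + of_int l * fact n" unfolding coset_def by blast
    then show "z \<in> coset n s" unfolding coset_def by (intro range_eqI[of _ _ "k + l"]) (simp add: k distrib_right)
  next
    fix z assume "z \<in> coset n s"
    then obtain l :: int where "z = s + of_int l * fact n" unfolding coset_def by blast
    then show "z \<in> coset n r" unfolding coset_def by (intro range_eqI[of _ _ "l - k"]) (simp add: k left_diff_distrib)
  qed
qed

lemma translate_coset: "(\<lambda>a. a + t) ` coset n r = coset n (r + t)"
  unfolding coset_def image_image by (rule image_cong) auto

lemma reduce_coset: "reduce n (coset (Suc n) r) = coset n r"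
proof -
  have "coset n a = coset n r" if a: "a \<in> coset (Suc n) r" for a
  proof -
    obtain k :: int where "a = r + of_int k * fact (Suc n)" using a unfolding coset_def by blast
    then have "a = r + of_int (k * int (Suc n)) * fact n" by simp
    then show ?thesis unfolding coset_eq_iff by blast
  qed
  moreover have "r \<in> coset (Suc n) r" unfolding coset_def by (rule range_eqI[of _ _ 0]) simp
  ultimately show ?thesis unfolding reduce_def by blast
qed

text \<open>The character of frequency 1 / n!. The chosen representative does not matter, since two
  of them differ by a multiple of n!.\<close>

definition circle_character :: "nat \<Rightarrow> real set \<Rightarrow> complex" where
  "circle_character n A = cis (2 * pi * (SOME r. A = coset n r) / fact n)"

lemma circle_character_coset: "circle_character n (coset n r) = cis (2 * pi * r / fact n)"
proof -
  define s where "s = (SOME s. coset n r = coset n s)"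
  have "coset n r = coset n s" unfolding s_def by (rule someI[of _ r]) simp
  then obtain k :: int where k: "r = s + of_int k * fact n" unfolding coset_eq_iff by blast
  have "2 * pi * r / fact n = 2 * pi * s / fact n + 2 * pi * of_int k" unfolding k by (simp add: field_simps)
  then have "cis (2 * pi * r / fact n) = cis (2 * pi * s / fact n) * cis (2 * pi * of_int k)" by (simp only: cis_mult)
  then show ?thesis by (simp add: circle_character_def s_def)
qed

lemma continuous_circle_character: "continuous_map (circle n) euclidean (circle_character n)"
proof (rule continuous_compose_quotient_map[OF quotient_map_circle])
  have "circle_character n \<circ> coset n = (\<lambda>r. cis (2 * pi * r / fact n))"
    by (simp add: fun_eq_iff circle_character_coset)
  moreover have "continuous_map euclideanreal euclidean (\<lambda>r. cis (2 * pi * r / fact n))"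
    by (simp add: continuous_on_cis continuous_intros)
  ultimately show "continuous_map euclideanreal euclidean (circle_character n \<circ> coset n)" by simp
qed

lemma topspace_circle: "topspace (circle n) = range (coset n)"
  using quotient_imp_surjective_map[OF quotient_map_circle[of n]] by simp

text \<open>The characters of the coordinate circles pulled back along the factor map are
  eigenfunctions; reduction modulo n! makes each one a power of the next.\<close>

lemma solenoid_characters:
  assumes "flow_extension Y T solenoid solenoid_action"
  shows "\<exists>e :: nat \<Rightarrow> 'a \<Rightarrow> complex. \<forall>n. continuous_map Y euclidean (e n) \<and>
      (\<forall>x\<in>topspace Y. norm (e n x) = 1 \<and> (\<forall>t. e n (T t x) = cis (2 * pi * t / fact n) * e n x) \<and> e n x = e (Suc n) x ^ Suc n)"
    and "topspace Y \<noteq> {}"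
proof -
  obtain \<psi> where c\<psi>: "continuous_map Y solenoid \<psi>" and surj: "\<psi> ` topspace Y = topspace solenoid"
    and eq\<psi>: "equivariant_on (topspace Y) T solenoid_action \<psi>"
    using assms unfolding flow_extension_def by blast
  have top: "topspace solenoid = {x \<in> PiE {1..} (\<lambda>n. range (coset n)). \<forall>n\<ge>1. x n = reduce n (x (Suc n))}"
    unfolding solenoid_def topspace_subtopology topspace_product_topology topspace_circle by blast
  have "(\<lambda>n\<in>{1..}. coset n 0) \<in> topspace solenoid"
    unfolding top by (intro CollectI conjI restrict_PiE_iff[THEN iffD2] allI impI ballI) (simp_all add: reduce_coset)
  then show "topspace Y \<noteq> {}" using surj by auto
  define e' where "e' n x = circle_character n (\<psi> x n)" for n x
  have rep: "\<exists>r. \<psi> x n = coset n r" if "x \<in> topspace Y" "1 \<le> n" for x n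
  proof -
    have "\<psi> x \<in> topspace solenoid" using surj that(1) by blast
    then have "\<psi> x \<in> PiE {1..} (\<lambda>n. range (coset n))" unfolding top mem_Collect_eq by (rule conjunct1)
    then have "\<psi> x n \<in> range (coset n)" by (rule PiE_mem) (use that(2) in simp)
    then show ?thesis by blast
  qed
  have red: "\<psi> x n = reduce n (\<psi> x (Suc n))" if "x \<in> topspace Y" "1 \<le> n" for x n
  proof -
    have "\<psi> x \<in> topspace solenoid" using surj that(1) by blast
    then have "\<forall>n\<ge>1. \<psi> x n = reduce n (\<psi> x (Suc n))" unfolding top mem_Collect_eq by (rule conjunct2)
    then show ?thesis using that(2) by blast
  qed
  have ce: "continuous_map Y euclidean (e' n)" if "1 \<le> n" for n
  proof -
    have "continuous_map (product_topology circle {1..}) (circle n) (\<lambda>x. x n)"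
      by (rule continuous_map_product_projection) (use that in simp)
    then have "continuous_map solenoid (circle n) (\<lambda>x. x n)"
      unfolding solenoid_def by (rule continuous_map_from_subtopology)
    from continuous_map_compose[OF continuous_map_compose[OF c\<psi> this] continuous_circle_character]
    show ?thesis by (simp add: o_def e'_def[abs_def])
  qed
  have n1: "norm (e' n x) = 1" for n x by (simp add: e'_def circle_character_def)
  have eT: "e' n (T t x) = cis (2 * pi * t / fact n) * e' n x" if x: "x \<in> topspace Y" and n: "1 \<le> n" for n x t
  proof -
    obtain r where r: "\<psi> x n = coset n r" using rep[OF x n] by blast
    have "\<psi> (T t x) n = (\<lambda>a. a + t) ` \<psi> x n"
      using eq\<psi> x n unfolding equivariant_on_def solenoid_action_def by simp
    then have "\<psi> (T t x) n = coset n (r + t)" unfolding r translate_coset .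
    then show ?thesis unfolding e'_def r circle_character_coset cis_mult by (simp add: circle_character_coset add_divide_distrib distrib_left add.commute)
  qed
  have tower: "e' n x = e' (Suc n) x ^ Suc n" if x: "x \<in> topspace Y" and n: "1 \<le> n" for n x
  proof -
    have "1 \<le> Suc n" by simp
    from rep[OF x this] obtain r where r: "\<psi> x (Suc n) = coset (Suc n) r" by blast
    have "\<psi> x n = coset n r" using red[OF x n] unfolding r reduce_coset .
    then have "e' n x = cis (2 * pi * r / fact n)" unfolding e'_def by (simp only: circle_character_coset)
    moreover have "e' (Suc n) x ^ Suc n = cis (real (Suc n) * (2 * pi * r / fact (Suc n)))"
      unfolding e'_def r circle_character_coset by (rule Complex.DeMoivre)
    moreover have "real (Suc n) * (2 * pi * r / fact (Suc n)) = 2 * pi * r / fact n" by simp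
    ultimately show ?thesis by (simp only:)
  qed
  \<comment> \<open>The solenoid has no coordinate 0. Repeating the character of index 1 there is
    consistent because 0! = 1! and the step of the tower is a first power.\<close>
  define e where "e n = e' (max 1 n)" for n
  have "continuous_map Y euclidean (e n) \<and>
      (\<forall>x\<in>topspace Y. norm (e n x) = 1 \<and> (\<forall>t. e n (T t x) = cis (2 * pi * t / fact n) * e n x) \<and> e n x = e (Suc n) x ^ Suc n)" for n
  proof (cases n)
    case 0
    have "e n = e' 1" "e (Suc n) = e' 1" "(fact n :: real) = fact 1" using 0 by (simp_all add: e_def)
    moreover have "e' 1 x = e' 1 x ^ Suc n" for x using 0 by simp
    moreover have "continuous_map Y euclidean (e' 1)" by (rule ce) simp
    moreover have "e' 1 (T t x) = cis (2 * pi * t / fact 1) * e' 1 x" if "x \<in> topspace Y" for x t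
      by (rule eT[OF that]) simp
    ultimately show ?thesis using n1 by (simp only:) blast
  next
    case (Suc m)
    then have n: "1 \<le> n" and en: "e n = e' n" "e (Suc n) = e' (Suc n)" by (simp_all add: e_def max_def)
    show ?thesis unfolding en by (intro conjI ballI allI ce n1 eT tower n)
  qed
  then show "\<exists>e :: nat \<Rightarrow> 'a \<Rightarrow> complex. \<forall>n. continuous_map Y euclidean (e n) \<and>
      (\<forall>x\<in>topspace Y. norm (e n x) = 1 \<and> (\<forall>t. e n (T t x) = cis (2 * pi * t / fact n) * e n x) \<and> e n x = e (Suc n) x ^ Suc n)"
    by blast
qed

section \<open>The embedding\<close>

text \<open>The first \<open>J\<close> terms are controlled on [-J, J], with total weight at most 1;
  every later supremum is at most 2, so the tail is at most 2 times 2^(-J).\<close>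

lemma local_uniform_dist_le:
  fixes f g :: "real \<Rightarrow>\<^sub>C complex"
  assumes f: "norm f \<le> 1" and g: "norm g \<le> 1" and \<eta>: "0 \<le> \<eta>"
    and near: "\<And>t. \<bar>t\<bar> \<le> real J \<Longrightarrow> norm (f t - g t) \<le> \<eta>"
  shows "local_uniform_dist f g \<le> \<eta> + 2 * (1/2) ^ J"
proof -
  define s where "s n = (SUP t\<in>{- real (Suc n)..real (Suc n)}. cmod (f t - g t))" for n
  have le2: "norm (f t - g t) \<le> 2" for t
    using norm_triangle_ineq4[of "f t" "g t"] norm_bounded[of f t] norm_bounded[of g t] f g by linarith
  have s2: "s n \<le> 2" for n unfolding s_def by (rule cSUP_least) (use le2 in auto)
  have s0: "0 \<le> s n" for n
  proof -
    have "cmod (f 0 - g 0) \<le> s n" unfolding s_def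
      by (rule cSUP_upper) (use le2 in \<open>auto intro!: bdd_aboveI[of _ 2]\<close>)
    then show ?thesis using norm_ge_zero order_trans by blast
  qed
  have s\<eta>: "s n \<le> \<eta>" if "n < J" for n
    unfolding s_def
  proof (rule cSUP_least)
    fix t assume "t \<in> {- real (Suc n)..real (Suc n)}"
    then have "\<bar>t\<bar> \<le> real (Suc n)" by auto
    also have "\<dots> \<le> real J" using that by simp
    finally show "cmod (f t - g t) \<le> \<eta>" by (rule near)
  qed simp
  have geo: "(\<lambda>n. (1/2 :: real) ^ Suc n) sums 1" by (rule power_half_series)
  have sg: "summable (\<lambda>n. (1/2 :: real) ^ Suc n)" using geo by (rule sums_summable)
  have summ: "summable (\<lambda>n. (1/2) ^ Suc n * s n)"
  proof (rule summable_comparison_test'[where N = 0])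
    show "summable (\<lambda>n. (1/2 :: real) ^ Suc n * 2)" by (rule summable_mult2[OF sg])
    show "norm ((1/2) ^ Suc n * s n) \<le> (1/2) ^ Suc n * 2" for n
      using s0[of n] s2[of n] by (simp add: abs_mult mult_left_mono)
  qed
  have "local_uniform_dist f g = (\<Sum>n. (1/2) ^ Suc (n + J) * s (n + J)) + (\<Sum>n<J. (1/2) ^ Suc n * s n)"
    using suminf_split_initial_segment[OF summ, of J] by (simp add: local_uniform_dist_def s_def)
  also have "(\<Sum>n. (1/2) ^ Suc (n + J) * s (n + J)) \<le> (\<Sum>n. (1/2) ^ Suc n * (2 * (1/2) ^ J))"
  proof (rule suminf_le)
    show "(1/2) ^ Suc (n + J) * s (n + J) \<le> (1/2) ^ Suc n * (2 * (1/2) ^ J)" for n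
    proof -
      have "(1/2) ^ Suc (n + J) * s (n + J) \<le> (1/2 :: real) ^ Suc (n + J) * 2" by (rule mult_left_mono[OF s2]) simp
      then show ?thesis by (simp add: power_add)
    qed
    show "summable (\<lambda>n. (1/2) ^ Suc (n + J) * s (n + J))" using summable_ignore_initial_segment[OF summ] .
    show "summable (\<lambda>n. (1/2 :: real) ^ Suc n * (2 * (1/2) ^ J))" by (rule summable_mult2[OF sg])
  qed
  also have "(\<Sum>n. (1/2 :: real) ^ Suc n * (2 * (1/2) ^ J)) = 2 * (1/2) ^ J"
    using sums_mult2[OF geo, of "2 * (1/2) ^ J"] by (simp add: sums_iff)
  also have "(\<Sum>n<J. (1/2) ^ Suc n * s n) \<le> (\<Sum>n<J. (1/2) ^ Suc n * \<eta>)"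
    by (intro sum_mono mult_left_mono s\<eta>) auto
  also have "\<dots> = (\<Sum>n<J. (1/2) ^ Suc n) * \<eta>" by (rule sum_distrib_right[symmetric])
  also have "\<dots> \<le> 1 * \<eta>"
  proof (rule mult_right_mono[OF _ \<eta>])
    have "(\<Sum>n<J. (1/2 :: real) ^ Suc n) \<le> (\<Sum>n. (1/2) ^ Suc n)" by (rule sum_le_suminf[OF sg]) auto
    then show "(\<Sum>n<J. (1/2 :: real) ^ Suc n) \<le> 1" using geo by (simp only: sums_iff)
  qed
  finally show ?thesis by simp
qed

context compact_flow
begin

definition orbit_function :: "('a \<Rightarrow> complex) \<Rightarrow> 'a \<Rightarrow> (real \<Rightarrow>\<^sub>C complex)" where
  "orbit_function v y = Bcontfun (\<lambda>t. v (T t y))"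

lemma apply_orbit_function:
  assumes cv: "continuous_on S v" and y: "y \<in> S"
  shows "apply_bcontfun (orbit_function v y) t = v (T t y)"
proof -
  obtain B where B: "\<And>x. x \<in> S \<Longrightarrow> norm (v x) \<le> B" using bounded_obs[OF cv] by blast
  have "(\<lambda>t. v (T t y)) \<in> bcontfun"
    unfolding bcontfun_def
  proof (intro CollectI conjI)
    show "continuous_on UNIV (\<lambda>t. v (T t y))" by (rule continuous_on_orbit[OF cv y])
    show "bounded (range (\<lambda>t. v (T t y)))" by (rule boundedI[of _ B]) (use B y in auto)
  qed
  then show ?thesis by (simp add: orbit_function_def Bcontfun_inverse)
qed

lemma orbit_function_continuous:
  assumes cv: "continuous_on S v" and v1: "\<And>x. x \<in> S \<Longrightarrow> norm (v x) \<le> 1" and e: "0 < e"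
  shows "\<exists>d>0. \<forall>x\<in>S. \<forall>y\<in>S. dist x y < d \<longrightarrow> local_uniform_dist (orbit_function v x) (orbit_function v y) < e"
proof -
  obtain J where J: "(1/2 :: real) ^ J < e / 4" using real_arch_pow_inv[of "e / 4" "1/2"] e by auto
  have "continuous_on ({- real J..real J} \<times> S) (\<lambda>z. v (T (fst z) (snd z)))"
    by (rule continuous_on_compose2[OF cv continuous_on_subset[OF cont]]) auto
  then have "uniformly_continuous_on ({- real J..real J} \<times> S) (\<lambda>z. v (T (fst z) (snd z)))"
    by (intro compact_uniformly_continuous compact_Times compact compact_Icc)
  moreover have "0 < e / 2" using e by simp
  ultimately have "\<exists>d>0. \<forall>z\<in>{- real J..real J} \<times> S. \<forall>w\<in>{- real J..real J} \<times> S. dist w z < d \<longrightarrow> dist (v (T (fst w) (snd w))) (v (T (fst z) (snd z))) < e / 2"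
    unfolding uniformly_continuous_on_def by (elim allE impE)
  then obtain d where d: "0 < d" "\<forall>z\<in>{- real J..real J} \<times> S. \<forall>w\<in>{- real J..real J} \<times> S. dist w z < d \<longrightarrow> dist (v (T (fst w) (snd w))) (v (T (fst z) (snd z))) < e / 2"
    by (elim exE conjE)
  have n1: "norm (orbit_function v x) \<le> 1" if "x \<in> S" for x
    by (rule norm_bound) (use apply_orbit_function[OF cv that] v1 that in simp)
  show ?thesis
  proof (intro exI[of _ d] conjI d(1) ballI impI)
    fix x y assume x: "x \<in> S" and y: "y \<in> S" and xy: "dist x y < d"
    have "local_uniform_dist (orbit_function v x) (orbit_function v y) \<le> e / 2 + 2 * (1/2) ^ J"
    proof (rule local_uniform_dist_le[OF n1[OF x] n1[OF y]])
      show "0 \<le> e / 2" using e by simp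
      fix t assume t: "\<bar>t\<bar> \<le> real J"
      have "dist (v (T t x)) (v (T t y)) < e / 2"
        using d(2)[rule_format, of "(t, y)" "(t, x)"] t x y xy by (simp add: dist_Pair_Pair abs_le_iff)
      then show "norm (orbit_function v x t - orbit_function v y t) \<le> e / 2"
        by (simp add: apply_orbit_function[OF cv x] apply_orbit_function[OF cv y] dist_norm)
    qed
    also have "\<dots> < e" using J by simp
    finally show "local_uniform_dist (orbit_function v x) (orbit_function v y) < e" .
  qed
qed

end

text \<open>A rational density i / j makes \<rho> n! an integer as soon as n \<ge> j, because then j
  divides n!. Taking the maximum with 0 in the proof keeps the density positive.\<close>

lemma rational_above_mdim:
  assumes "z < ereal c" "0 < c"
  obtains i j :: nat where "0 < i" "0 < j" "z < ereal (real i / real j)" "real i / real j < c"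
proof -
  obtain \<rho>0 where \<rho>0: "z < ereal \<rho>0" "ereal \<rho>0 < ereal c" using ereal_dense2[OF assms(1)] by blast
  then have "max \<rho>0 0 < c" using assms(2) by simp
  then obtain \<rho> where \<rho>: "\<rho> \<in> \<rat>" "max \<rho>0 0 < \<rho>" "\<rho> < c" using Rats_dense_in_real by blast
  obtain i j :: nat where ij: "j \<noteq> 0" "\<bar>\<rho>\<bar> = real i / real j" using Rats_abs_nat_div_natE[OF \<rho>(1)] by blast
  have r: "\<rho> = real i / real j" using ij(2) \<rho>(2) by simp
  show ?thesis
  proof (rule that[of i j])
    show "0 < j" using ij(1) by simp
    show "0 < i" using \<rho>(2) r by (cases i) auto
    have "ereal \<rho>0 < ereal \<rho>" using \<rho>(2) by simp
    with \<rho>0(1) show "z < ereal (real i / real j)" unfolding r by (rule less_trans)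
    show "real i / real j < c" using \<rho>(3) r by simp
  qed
qed

theorem theorem5p1:
  fixes a b :: real and X :: "'a metric" and T :: "real \<Rightarrow> 'a \<Rightarrow> 'a"
  assumes "a < b"
    and "flow (mtopology_of X) T"
    and "flow_extension (mtopology_of X) T solenoid solenoid_action"
    and "mdim X T < ereal (b - a)"
  shows "flow_embeddable (mtopology_of X) T (mtopology_of (bandlimited_ball a b)) shift"
proof -
  note fl = assms(2)
  obtain e :: "nat \<Rightarrow> 'a \<Rightarrow> complex" where e: "\<forall>n. continuous_map (mtopology_of X) euclidean (e n) \<and>
      (\<forall>x\<in>topspace (mtopology_of X). norm (e n x) = 1 \<and> (\<forall>t. e n (T t x) = cis (2 * pi * t / fact n) * e n x) \<and> e n x = e (Suc n) x ^ Suc n)"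
    using solenoid_characters(1)[OF assms(3)] by (elim exE)
  have ne: "mspace X \<noteq> {}" using solenoid_characters(2)[OF assms(3)] by simp
  obtain i j :: nat where ij: "0 < i" "0 < j" "mdim X T < ereal (real i / real j)" "real i / real j < b - a"
    using rational_above_mdim[OF assms(4)] assms(1) by auto
  define \<rho> where "\<rho> = real i / real j"
  have \<rho>: "0 < \<rho>" "\<rho> < b - a" using ij by (simp_all add: \<rho>_def)
  obtain h :: "'a \<Rightarrow> (nat \<Rightarrow>\<^sub>C real)" and k S where
    S: "h ` mspace X = S" and hom: "homeomorphic_maps (mtopology_of X) (top_of_set S) h k"
    and iso: "\<forall>x\<in>mspace X. \<forall>y\<in>mspace X. dist (h x) (h y) = mdist X x y"
    and cf: "compact_flow S (\<lambda>r y. h (T r (k y)))"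
    using flow_model[OF fl] by (elim exE conjE)
  interpret compact_flow S "\<lambda>r y. h (T r (k y))" by (rule cf)
  have ck: "continuous_map (top_of_set S) (mtopology_of X) k"
    and kh: "\<And>x. x \<in> mspace X \<Longrightarrow> k (h x) = x"
    using hom unfolding homeomorphic_maps_def topspace_mtopology_of topspace_euclidean_subtopology by blast+
  have kX: "k y \<in> mspace X" if "y \<in> S" for y
    using continuous_map_image_subset_topspace[OF ck] that by auto
  have hS: "h x \<in> S" if "x \<in> mspace X" for x using S that by blast
  note TX = flow_in[OF fl]
  define e' where "e' n y = e n (k y)" for n y
  obtain v where cv: "continuous_on S v" and v1: "\<And>x. x \<in> S \<Longrightarrow> norm (v x) \<le> 1"
    and sv: "\<And>x. x \<in> S \<Longrightarrow> spectrum_in {a..b} (\<lambda>t. v (h (T t (k x))))"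
    and sep: "\<And>x y. x \<in> S \<Longrightarrow> y \<in> S \<Longrightarrow> (\<And>t. v (h (T t (k x))) = v (h (T t (k y)))) \<Longrightarrow> x = y"
  proof (rule bandlimited_observable[OF \<rho>, where e = e' and ?n0.0 = j])
    show "\<exists>m::nat. \<rho> * fact n = real m" if "j \<le> n" for n
    proof -
      have "j dvd fact n" by (rule dvd_fact) (use ij that in auto)
      then obtain q where q: "fact n = j * q" by blast
      have "\<rho> * fact n = \<rho> * real (fact n)" by simp
      also have "\<dots> = real (i * q)" unfolding q \<rho>_def using ij by simp
      finally show ?thesis by blast
    qed
    show "continuous_on S (e' n)" for n
      using continuous_map_compose[OF ck, of euclidean "e n"] e by (simp add: e'_def[abs_def] o_def)
    show "norm (e' n x) = 1" "e' n x = e' (Suc n) x ^ Suc n" if "x \<in> S" for n x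
      using e kX[OF that] unfolding e'_def topspace_mtopology_of by blast+
    show "e' n (h (T t (k x))) = cis (2 * pi * t / fact n) * e' n x" if "x \<in> S" for n x t
    proof -
      have "e n (T t (k x)) = cis (2 * pi * t / fact n) * e n (k x)"
        using e kX[OF that] unfolding topspace_mtopology_of by blast
      then show ?thesis unfolding e'_def kh[OF TX[OF kX[OF that]]] .
    qed
    fix \<epsilon> :: real assume \<epsilon>: "0 < \<epsilon>"
    obtain N1 where N1: "\<forall>N\<ge>N1. \<exists>n. mean_dim_le X T \<epsilon> N n \<and> real n < \<rho> * N"
      using mdim_less_imp[OF fl ne ij(3)[folded \<rho>_def] \<epsilon>] unfolding eventually_at_top_linorder by (elim exE)
    obtain n1 :: nat where n1: "N1 \<le> real n1" using real_arch_simple by blast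
    have "fine_cover (fact n) m \<epsilon>" if n: "n1 \<le> n" and m: "real m = \<rho> * fact n" for n m
    proof -
      have "real n \<le> fact n" using fact_ge_self[of n] by (metis of_nat_fact of_nat_mono)
      then have "N1 \<le> fact n" using n1 n by linarith
      then obtain p where p: "mean_dim_le X T \<epsilon> (fact n) p" "real p < \<rho> * fact n" using N1 by blast
      \<comment> \<open>Strictness matters: a target of dimension \<open>p\<close> yields covers of
        multiplicity p + 1, which must not exceed the number \<open>m\<close> of complex
        samples.\<close>
      have pm: "p < m" using p(2) m by simp
      have f0: "(0::real) \<le> fact n" by simp
      obtain K :: "(nat \<Rightarrow> real) topology" and f where K: "compact_space K" "metrizable_space K" "covering_dim_le K (int p)"
        and cfK: "continuous_map (mtopology_of X) K f"
        and f: "\<forall>x\<in>mspace X. \<forall>y\<in>mspace X. f x = f y \<longrightarrow> mdist (orbit_metric X T (fact n)) x y < \<epsilon>"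
        by (rule mean_dim_leD[OF fl p(1) f0])
      obtain Q :: "(nat \<Rightarrow>\<^sub>C real) set" and g where Q: "compact Q" "covering_dim_le (top_of_set Q) (int p)"
        and cg: "continuous_map K (top_of_set Q) g" and ig: "inj_on g (topspace K)"
        using compact_metrizable_typed_model[OF K] by (elim exE conjE)
      have cF: "continuous_map (top_of_set S) (top_of_set Q) (\<lambda>y. g (f (k y)))"
        using continuous_map_compose[OF continuous_map_compose[OF ck cfK] cg] by (simp add: o_def)
      show ?thesis
      proof (rule fine_cover_if_fibres_small[OF Q pm])
        show "continuous_on S (\<lambda>y. g (f (k y)))" "(\<lambda>y. g (f (k y))) ` S \<subseteq> Q"
          using cF by (simp_all add: continuous_map_in_subtopology image_subset_iff Pi_iff)
        show "\<forall>x\<in>S. \<forall>y\<in>S. \<forall>r\<in>{0..fact n}. g (f (k x)) = g (f (k y)) \<longrightarrow> dist (h (T r (k x))) (h (T r (k y))) < \<epsilon>"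
        proof (intro ballI impI)
          fix x y and r :: real assume x: "x \<in> S" and y: "y \<in> S" and r: "r \<in> {0..fact n}" and eq: "g (f (k x)) = g (f (k y))"
          have fK: "f z \<in> topspace K" if "z \<in> mspace X" for z
            using continuous_map_image_subset_topspace[OF cfK] that by auto
          have "f (k x) = f (k y)" by (rule inj_onD[OF ig eq fK[OF kX[OF x]] fK[OF kX[OF y]]])
          then have "mdist (orbit_metric X T (fact n)) (k x) (k y) < \<epsilon>" using f kX[OF x] kX[OF y] by blast
          moreover have "mdist X (T r (k x)) (T r (k y)) \<le> mdist (orbit_metric X T (fact n)) (k x) (k y)"
            using r by (intro mdist_orbit_upper[OF fl kX[OF x] kX[OF y]]) auto
          ultimately show "dist (h (T r (k x))) (h (T r (k y))) < \<epsilon>"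
            using iso[rule_format, OF TX[OF kX[OF x]] TX[OF kX[OF y]]] by simp
        qed
      qed
    qed
    then show "\<exists>n1. \<forall>n\<ge>n1. \<forall>m. real m = \<rho> * fact n \<longrightarrow> fine_cover (fact n) m \<epsilon>" by blast
  qed blast
  define F where "F x = orbit_function v (h x)" for x
  have Fapp: "apply_bcontfun (F x) t = v (h (T t x))" if "x \<in> mspace X" for x t
    unfolding F_def apply_orbit_function[OF cv hS[OF that]] kh[OF that] ..
  have Fball: "F x \<in> bandlimited a b" "norm (F x) \<le> 1" if x: "x \<in> mspace X" for x
  proof -
    have "apply_bcontfun (F x) = (\<lambda>t. v (h (T t x)))" using Fapp[OF x] by blast
    then show "F x \<in> bandlimited a b"
      using sv[OF hS[OF x]] unfolding kh[OF x] by (intro bandlimited_if_spectrum_in) simp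
    show "norm (F x) \<le> 1" by (rule norm_bound) (use Fapp[OF x] v1 hS TX[OF x] in simp)
  qed
  define Y where "Y = {f \<in> bandlimited a b. norm f \<le> 1}"
  interpret Y: Metric_space Y local_uniform_dist by (rule Metric_space_local_uniform_dist)
  have topY: "mtopology_of (bandlimited_ball a b) = Y.mtopology"
    unfolding bandlimited_ball_def Y_def[symmetric] by (rule Y.mtopology_of)
  have FY: "F x \<in> Y" if "x \<in> mspace X" for x using Fball[OF that] by (simp add: Y_def)
  have contF: "continuous_map (mtopology_of X) Y.mtopology F"
    unfolding Y.continuous_map_to_metric
  proof (intro ballI allI impI)
    fix x and \<epsilon> :: real assume "x \<in> topspace (mtopology_of X)" and \<epsilon>: "0 < \<epsilon>"
    then have x: "x \<in> mspace X" by simp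
    interpret M: Metric_space "mspace X" "mdist X" by (rule Metric_space_mspace_mdist)
    have "\<exists>d>0. \<forall>x\<in>S. \<forall>y\<in>S. dist x y < d \<longrightarrow> local_uniform_dist (orbit_function v x) (orbit_function v y) < \<epsilon>"
      by (rule orbit_function_continuous[OF cv _ \<epsilon>]) (rule v1)
    then obtain d where d: "0 < d" "\<forall>x\<in>S. \<forall>y\<in>S. dist x y < d \<longrightarrow> local_uniform_dist (orbit_function v x) (orbit_function v y) < \<epsilon>"
      by (elim exE conjE)
    show "\<exists>U. openin (mtopology_of X) U \<and> x \<in> U \<and> (\<forall>y\<in>U. F y \<in> Y.mball (F x) \<epsilon>)"
    proof (intro exI[of _ "M.mball x d"] conjI ballI)
      show "openin (mtopology_of X) (M.mball x d)" unfolding mtopology_of_def by (rule M.openin_mball)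
      show "x \<in> M.mball x d" using x d(1) by simp
      fix y assume "y \<in> M.mball x d"
      then have y: "y \<in> mspace X" "mdist X x y < d" by simp_all
      have "local_uniform_dist (F x) (F y) < \<epsilon>"
        unfolding F_def using d(2) hS[OF x] hS[OF y(1)] iso[rule_format, OF x y(1)] y(2) by simp
      then show "F y \<in> Y.mball (F x) \<epsilon>" using FY[OF x] FY[OF y(1)] by simp
    qed
  qed
  have inj: "inj_on F (mspace X)"
  proof (rule inj_onI)
    fix x y assume x: "x \<in> mspace X" and y: "y \<in> mspace X" and eq: "F x = F y"
    have "v (h (T t (k (h x)))) = v (h (T t (k (h y))))" for t
      unfolding kh[OF x] kh[OF y] Fapp[OF x, symmetric] Fapp[OF y, symmetric] eq ..
    then have "h x = h y" by (rule sep[OF hS[OF x] hS[OF y]])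
    then have "k (h x) = k (h y)" by (rule arg_cong)
    then show "x = y" unfolding kh[OF x] kh[OF y] .
  qed
  have emb: "embedding_map (mtopology_of X) Y.mtopology F"
    by (rule continuous_imp_embedding_map[OF contF flow_compact[OF fl] Y.Hausdorff_space_mtopology])
      (use inj in simp)
  have equi: "F (T r x) = shift r (F x)" if x: "x \<in> mspace X" for r :: real and x
  proof (rule bcontfun_eqI)
    fix t
    show "apply_bcontfun (F (T r x)) t = apply_bcontfun (shift r (F x)) t"
      by (simp only: apply_bcontfun_shift Fapp[OF x] Fapp[OF TX[OF x]] flow_add[OF fl x])
  qed
  show ?thesis
    unfolding flow_embeddable_def topY
  proof (intro exI conjI)
    show "embedding_map (mtopology_of X) Y.mtopology F" by (rule emb)
    show "equivariant_on (topspace (mtopology_of X)) T shift F"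
      unfolding equivariant_on_def topspace_mtopology_of using equi by blast
  qed
qed

end
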